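(* For every integer $k\ge 3$, $$\lim_{\ell\to\infty}\left(\lim_{n\to\infty}\frac{\mathrm{ex}(n,C_{2k},\mathcal{C}_{\ge \ell+1})}{\left\lfloor\frac{\ell}{2}\right\rfloor^{k}n^{k}}\right)=\frac{1}{2k}$$ and $$\lim_{\ell\to\infty}\left(\lim_{n\to\infty}\frac{\mathrm{ex}(n,C_{2k+1},\mathcal{C}_{\ge \ell+1})}{\left\lfloor\frac{\ell}{2}\right\rfloor^{k+1}n^{k}}\right)=\frac{1}{2}.$$
   Context: Graphs are finite and simple. $C_m$ is the cycle of length $m$, and $\mathcal{C}_{\ge m}$ is the family of all cycles of length at least $m$. For a graph $H$ and a family of graphs $\mathcal{F}$, $\mathrm{ex}(n,H,\mathcal{F})$ is the maximum number of copies of $H$ as a (not necessarily induced) subgraph in an $n$-vertex graph containing no $F\in\mathcal{F}$ as a subgraph. *)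

theory Defs
  imports Complex_Main
begin

type_synonym 'a graph = "'a set \<times> 'a set set"

abbreviation verts :: "'a graph \<Rightarrow> 'a set" where "verts G \<equiv> fst G"
abbreviation edges :: "'a graph \<Rightarrow> 'a set set" where "edges G \<equiv> snd G"

definition simple_graph :: "'a graph \<Rightarrow> bool" where
  "simple_graph G \<longleftrightarrow> finite (verts G) \<and> (\<forall>e\<in>edges G. e \<subseteq> verts G \<and> card e = 2)"

definition subgraph :: "'a graph \<Rightarrow> 'a graph \<Rightarrow> bool" where
  "subgraph H G \<longleftrightarrow> simple_graph H \<and> verts H \<subseteq> verts G \<and> edges H \<subseteq> edges G"

definition graph_iso :: "'a graph \<Rightarrow> 'b graph \<Rightarrow> bool" where
  "graph_iso G H \<longleftrightarrow>
     (\<exists>f. bij_betw f (verts G) (verts H) \<and> edges H = (\<lambda>e. f ` e) ` edges G)"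

definition copies :: "'a graph \<Rightarrow> 'b graph \<Rightarrow> 'b graph set" where
  "copies H G = {H'. subgraph H' G \<and> graph_iso H H'}"

definition free_of :: "'a graph set \<Rightarrow> 'b graph \<Rightarrow> bool" where
  "free_of \<F> G \<longleftrightarrow> (\<forall>F\<in>\<F>. copies F G = {})"

text \<open>This is a cycle only for \<open>m \<ge> 3\<close>.\<close>

definition cycle_graph :: "nat \<Rightarrow> nat graph" where
  "cycle_graph m = ({..<m}, {{i, Suc i mod m} | i. i < m})"

definition cycles_ge :: "nat \<Rightarrow> nat graph set" where
  "cycles_ge m = {cycle_graph j | j. j \<ge> 3 \<and> j \<ge> m}"

text \<open>Natural numbers as vertices represent every finite graph up to isomorphism. The
  values form a finite set by \<open>finite_copy_counts\<close>; the maximum is unspecified only if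
  there is no \<open>\<F>\<close>-free graph on \<open>n\<close> vertices, which cannot happen for families of cycles
  (\<open>copy_counts_cycles_ge_nonempty\<close>).\<close>

definition copy_counts :: "nat \<Rightarrow> 'a graph \<Rightarrow> 'b graph set \<Rightarrow> nat set" where
  "copy_counts n H \<F> =
     {card (copies H G) | G :: nat graph. simple_graph G \<and> card (verts G) = n \<and> free_of \<F> G}"

definition gen_turan :: "nat \<Rightarrow> 'a graph \<Rightarrow> 'b graph set \<Rightarrow> nat" where
  "gen_turan n H \<F> = Max (copy_counts n H \<F>)"

lemma finite_copy_counts: "finite (copy_counts n H \<F>)"
proof (rule finite_subset)
  show "copy_counts n H \<F> \<subseteq> {..2 ^ n * 2 ^ (2 ^ n)}"
  proof
    fix c assume "c \<in> copy_counts n H \<F>"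
    then obtain G :: "nat graph" where G: "simple_graph G" "card (verts G) = n"
      and c: "c = card (copies H G)"
      unfolding copy_counts_def by blast
    let ?S = "Pow (verts G) \<times> Pow (Pow (verts G))"
    have fin: "finite (verts G)" using G(1) by (simp add: simple_graph_def)
    have "copies H G \<subseteq> ?S"
      using G(1) by (force simp: copies_def subgraph_def simple_graph_def)
    moreover have "finite ?S" using fin by simp
    ultimately have "card (copies H G) \<le> card ?S" by (rule card_mono[rotated])
    also have "card ?S = 2 ^ n * 2 ^ (2 ^ n)"
      using fin G(2) by (simp add: card_cartesian_product card_Pow)
    finally show "c \<in> {..2 ^ n * 2 ^ (2 ^ n)}" using c by simp
  qed
qed simp

lemma copy_counts_cycles_ge_nonempty: "copy_counts n H (cycles_ge m) \<noteq> {}"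
proof -
  let ?G = "({..<n}, {}) :: nat graph"
  have "copies (cycle_graph j) ?G = {}" if "j \<ge> 3" for j
  proof -
    have "edges (cycle_graph j) \<noteq> {}"
      using that by (auto simp: cycle_graph_def intro: exI[of _ 0])
    then show ?thesis
      by (auto simp: copies_def subgraph_def graph_iso_def)
  qed
  then have "free_of (cycles_ge m) ?G"
    by (auto simp: free_of_def cycles_ge_def)
  moreover have "simple_graph ?G" by (simp add: simple_graph_def)
  moreover have "card (verts ?G) = n" by simp
  ultimately show ?thesis unfolding copy_counts_def by blast
qed

lemma simple_graph_cycle_graph: "m \<ge> 3 \<Longrightarrow> simple_graph (cycle_graph m)"
  by (auto simp: simple_graph_def cycle_graph_def card_insert_if mod_Suc)

end

theory Submission
  imports Defs "HOL-Library.FuncSet"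
begin

text \<open>A graph of circumference at most \<open>l\<close> is \<open>l\<close>-degenerate, so its edges can be oriented
  acyclically with out-degrees at most \<open>l\<close>. Each cycle then inherits an orientation, and its sources
  together with boundedly many choices determine it. Hence all but \<open>O(n ^ (k - 1))\<close> cycles of length
  \<open>m\<close> have \<open>k = m div 2\<close> sources, and in all but \<open>\<delta> n ^ k\<close> of those every sink has linear degree,
  i.e. lies in a set of bounded size. Enlarging this set a bounded number of times (and using a
  pigeonhole argument to choose the right stage) gives a bounded set \<open>H\<close> of hubs such that, up to
  \<open>\<delta> n ^ k\<close> exceptions, the cycles live on \<open>H\<close> and a set \<open>R\<close> of further vertices, pass \<open>k\<close> times
  from \<open>H\<close> to \<open>R\<close>, and every short path through \<open>R\<close> linking two hubs can be rerouted around any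
  small set of vertices.

  This has two consequences. Gluing \<open>q\<close> disjoint copies of \<open>R\<close> along \<open>H\<close> does not create a cycle
  longer than \<open>l\<close> and multiplies the number of these cycles by \<open>q ^ k\<close>; so the ratio at \<open>q n\<close> is
  almost that at \<open>n\<close>, and the inner limit exists. Moreover a vertex of \<open>R\<close> has at most
  \<open>s = l div 2\<close> neighbours in \<open>H\<close>, since otherwise links of length two would close up to a cycle of
  length \<open>2 (s + 1) > l\<close>. Choosing the \<open>k\<close> vertices in \<open>R\<close> and then their neighbours in \<open>H\<close> bounds
  the number of cycles from above. For odd \<open>m\<close> there is also the case of two adjacent vertices of
  \<open>R\<close>; it is of lower order in \<open>s\<close>, since vertices of \<open>R\<close> with many neighbours in \<open>H\<close> span no path
  of a certain length. The join of a clique on \<open>s\<close> vertices with an independent set gives the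
  matching lower bound.\<close>

text \<open>All counting is done with labelled cycles, \<open>2 * m\<close> for each copy. A good
  cycle is brought to normal form by one of 2 rotations if m is even and one of m if m is odd; the
  quotients \<open>2 / (2 * m)\<close> and \<open>m / (2 * m)\<close> are the two limits.

  A low-degree sink is affordable although it is not a source: one source is among its few
  neighbours, another ascends to it in at most two steps, and there are only O(n) pairs of a sink
  and such a source.

  The obstacle in choosing hubs: a set X that meets all non-robust links has to be discarded from R,
  but turning X into hubs creates new links that may again fail to be robust. The sets X of
  successive stages are disjoint and a cycle has m vertices, so among M stages one has an X met by
  at most a fraction m / M of all cycles.

  For odd m, an adjacent pair in R seems to cost as much as the main term: about l n pairs against
  one hub choice out of s. A threshold g on hub degrees repairs this: pairs with a poor vertex have
  few hubs, with relative error O(g / s), and pairs of rich vertices are few, with relative error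
  O(1 / g + 1 / s).\<close>

definition graph_on :: "'v set \<Rightarrow> ('v \<Rightarrow> 'v \<Rightarrow> bool) \<Rightarrow> bool" where
  "graph_on V E \<longleftrightarrow> finite V \<and> (\<forall>x y. E x y \<longrightarrow> x \<in> V \<and> y \<in> V \<and> x \<noteq> y \<and> E y x)"

text \<open>A labelled \<open>m\<close>-cycle is an \<open>m\<close>-periodic map on the integers, so that rotations are
  translations of the argument.\<close>

definition cyc :: "nat \<Rightarrow> ('v \<Rightarrow> 'v \<Rightarrow> bool) \<Rightarrow> (int \<Rightarrow> 'v) set" where
  "cyc m E = {c. (\<forall>i. c (i + int m) = c i) \<and> inj_on c {0..<int m} \<and> (\<forall>i. E (c i) (c (i + 1)))}"

definition cycle_list :: "('v \<Rightarrow> 'v \<Rightarrow> bool) \<Rightarrow> 'v list \<Rightarrow> bool" where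
  "cycle_list E ws \<longleftrightarrow> length ws \<ge> 3 \<and> distinct ws \<and> successively E ws \<and> E (last ws) (hd ws)"

definition circ_le :: "nat \<Rightarrow> ('v \<Rightarrow> 'v \<Rightarrow> bool) \<Rightarrow> bool" where
  "circ_le l E \<longleftrightarrow> (\<forall>ws. cycle_list E ws \<longrightarrow> length ws \<le> l)"

lemma graph_on_sym: "graph_on V E \<Longrightarrow> E x y \<Longrightarrow> E y x"
  by (simp add: graph_on_def)

lemma graph_onD: "graph_on V E \<Longrightarrow> E x y \<Longrightarrow> x \<in> V \<and> y \<in> V \<and> x \<noteq> y"
  by (simp add: graph_on_def)

lemma graph_on_finite: "graph_on V E \<Longrightarrow> finite V"
  by (simp add: graph_on_def)

section \<open>Periodic maps and labelled cycles\<close>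

lemma periodic_mult:
  assumes "\<forall>i. c (i + int m) = c i"
  shows "c (i + int m * t) = c i"
proof (induction t rule: int_induct[where k = 0])
  case (step1 t)
  have "c (i + int m * (t + 1)) = c ((i + int m * t) + int m)"
    by (simp add: algebra_simps)
  then show ?case using assms step1 by metis
next
  case (step2 t)
  have "c (i + int m * t) = c ((i + int m * (t - 1)) + int m)"
    by (simp add: algebra_simps)
  then show ?case using assms step2 by metis
qed simp

lemma periodic_mod:
  assumes "\<forall>i. c (i + int m) = c i"
  shows "c (i mod int m) = c i"
  using periodic_mult[OF assms, of "i mod int m" "i div int m"]
  by (simp add: mult.commute)

lemma cyc_mod: "c \<in> cyc m E \<Longrightarrow> c (i mod int m) = c i"
  by (rule periodic_mod) (simp add: cyc_def)

lemma cyc_adj: "c \<in> cyc m E \<Longrightarrow> E (c i) (c (i + 1))"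
  by (simp add: cyc_def)

lemma cyc_eq_iff:
  assumes "c \<in> cyc m E" "m > 0"
  shows "c i = c j \<longleftrightarrow> i mod int m = j mod int m"
proof
  assume "c i = c j"
  then have "c (i mod int m) = c (j mod int m)" using assms by (simp add: cyc_mod)
  moreover have "inj_on c {0..<int m}" using assms by (simp add: cyc_def)
  moreover have "i mod int m \<in> {0..<int m}" "j mod int m \<in> {0..<int m}" using assms(2) by auto
  ultimately show "i mod int m = j mod int m" by (meson inj_onD)
next
  assume "i mod int m = j mod int m"
  then show "c i = c j" using cyc_mod[OF assms(1)] by metis
qed

lemma cyc_shift:
  assumes "c \<in> cyc m E" "m > 0"
  shows "(\<lambda>i. c (i + r)) \<in> cyc m E"
proof -
  have "inj_on (\<lambda>i. c (i + r)) {0..<int m}"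
  proof (rule inj_onI)
    fix i j assume ij: "i \<in> {0..<int m}" "j \<in> {0..<int m}" and "c (i + r) = c (j + r)"
    then have "(i + r) mod int m = (j + r) mod int m" using cyc_eq_iff[OF assms] by blast
    then have "(i + r - r) mod int m = (j + r - r) mod int m" by (metis mod_diff_left_eq)
    then show "i = j" using ij by simp
  qed
  moreover have "c (i + int m + r) = c (i + r)" for i
  proof -
    have "c (i + r + int m) = c (i + r)" using assms(1) by (simp add: cyc_def)
    then show ?thesis by (simp add: algebra_simps)
  qed
  moreover have "E (c (i + r)) (c (i + 1 + r))" for i
    using cyc_adj[OF assms(1), of "i + r"] by (simp add: algebra_simps)
  ultimately show ?thesis by (simp add: cyc_def)
qed

lemma cyc_ext:
  assumes "c \<in> cyc m E" "c' \<in> cyc m E" "m > 0" "\<forall>i\<in>{0..<int m}. c i = c' i"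
  shows "c = c'"
proof
  fix i
  have "i mod int m \<in> {0..<int m}" using assms(3) by auto
  then show "c i = c' i" using assms cyc_mod by metis
qed

lemma cyc_range: "c \<in> cyc m E \<Longrightarrow> m > 0 \<Longrightarrow> range c = c ` {0..<int m}"
proof -
  assume c: "c \<in> cyc m E" "m > 0"
  have "c i \<in> c ` {0..<int m}" for i
    using cyc_mod[OF c(1), of i] c(2) by (metis atLeastLessThan_iff image_eqI of_nat_0_less_iff pos_mod_bound pos_mod_sign)
  then show ?thesis by auto
qed

lemma cyc_in_V: "graph_on V E \<Longrightarrow> c \<in> cyc m E \<Longrightarrow> c i \<in> V"
  using cyc_adj graph_onD by metis

lemma finite_cyc:
  assumes "graph_on V E" "m > 0"
  shows "finite (cyc m E)"
proof -
  have "inj_on (\<lambda>c. restrict c {0..<int m}) (cyc m E)"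
  proof (rule inj_onI)
    fix c c' assume c: "c \<in> cyc m E" "c' \<in> cyc m E"
      and eq: "restrict c {0..<int m} = restrict c' {0..<int m}"
    have "\<forall>i\<in>{0..<int m}. c i = c' i" using eq by (metis restrict_apply')
    then show "c = c'" using cyc_ext[OF c assms(2)] by blast
  qed
  moreover have "(\<lambda>c. restrict c {0..<int m}) ` cyc m E \<subseteq> PiE {0..<int m} (\<lambda>_. V)"
    using cyc_in_V[OF assms(1)] by auto
  moreover have "finite (PiE {0..<int m} (\<lambda>_. V))"
    using assms by (intro finite_PiE) (auto simp: graph_on_def)
  ultimately show ?thesis by (meson finite_imageD finite_subset)
qed

text \<open>Lists suit the assembly of cycles from paths, periodic maps suit counting; this and
  \<open>cyc_cycle_list\<close> translate between them.\<close>

lemma cycle_list_cyc: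
  assumes "cycle_list E ws"
  shows "(\<lambda>i. ws ! nat (i mod int (length ws))) \<in> cyc (length ws) E"
proof -
  let ?m = "length ws"
  have m: "?m \<ge> 3" "distinct ws" and su: "successively E ws" and la: "E (last ws) (hd ws)"
    using assms by (auto simp: cycle_list_def)
  have "E (ws ! nat (i mod int ?m)) (ws ! nat ((i + 1) mod int ?m))" for i
  proof (cases "i mod int ?m = int ?m - 1")
    case True
    then have "(i + 1) mod int ?m = 0" using m by (metis add.commute add_diff_cancel_left' diff_add_cancel mod_add_left_eq mod_self)
    moreover have "nat (i mod int ?m) = ?m - 1" using True m by simp
    ultimately show ?thesis using la m
      by (metis hd_conv_nth last_conv_nth list.size(3) nat_0 not_numeral_le_zero)
  next
    case False
    have lt: "i mod int ?m < int ?m" using m by (intro pos_mod_bound) linarith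
    moreover have nn: "0 \<le> i mod int ?m" using m by (intro pos_mod_sign) linarith
    ultimately have "(i mod int ?m + 1) mod int ?m = i mod int ?m + 1"
      using False by (intro mod_pos_pos_trivial) linarith+
    then have "(i + 1) mod int ?m = i mod int ?m + 1" by (simp add: mod_add_left_eq)
    moreover have "nat (i mod int ?m + 1) = Suc (nat (i mod int ?m))"
      using nn by (simp add: nat_add_distrib)
    moreover have "Suc (nat (i mod int ?m)) < ?m" using lt False nn by linarith
    ultimately show ?thesis using su by (simp add: successively_conv_nth)
  qed
  moreover have "inj_on (\<lambda>i. ws ! nat (i mod int ?m)) {0..<int ?m}"
    using m by (auto simp: inj_on_def nth_eq_iff_index_eq)
  ultimately show ?thesis by (simp add: cyc_def)
qed

lemma cyc_cycle_list:
  assumes "c \<in> cyc m E" "m \<ge> 3"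
  shows "cycle_list E (map (\<lambda>i. c (int i)) [0..<m])"
proof -
  have "inj_on c {0..<int m}" using assms by (simp add: cyc_def)
  then have "distinct (map (\<lambda>i. c (int i)) [0..<m])"
    unfolding distinct_map inj_on_def by (metis atLeastLessThan_iff distinct_upt of_nat_0_le_iff of_nat_eq_iff of_nat_less_iff set_upt)
  moreover have "successively E (map (\<lambda>i. c (int i)) [0..<m])"
    using cyc_adj[OF assms(1)] by (auto simp: successively_conv_nth) (metis add.commute)
  moreover have "E (c (int m - 1)) (c 0)"
    using cyc_adj[OF assms(1), of "int m - 1"] cyc_mod[OF assms(1), of "int m"] by simp
  ultimately show ?thesis using assms(2)
    by (auto simp: cycle_list_def last_map hd_map of_nat_diff)
qed

lemma circ_le_iff_cyc: "circ_le l E \<longleftrightarrow> (\<forall>j\<ge>3. j > l \<longrightarrow> cyc j E = {})"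
proof
  assume l: "circ_le l E"
  show "\<forall>j\<ge>3. j > l \<longrightarrow> cyc j E = {}"
  proof (intro allI impI)
    fix j assume "j \<ge> 3" "j > l"
    then show "cyc j E = {}"
      using l cyc_cycle_list[of _ j E] by (force simp: circ_le_def)
  qed
next
  assume r: "\<forall>j\<ge>3. j > l \<longrightarrow> cyc j E = {}"
  show "circ_le l E" unfolding circ_le_def
  proof (intro allI impI)
    fix ws assume ws: "cycle_list E ws"
    then have "cyc (length ws) E \<noteq> {}" "length ws \<ge> 3"
      using cycle_list_cyc by (auto simp: cycle_list_def)
    then show "length ws \<le> l" using r not_le by blast
  qed
qed

lemma cycle_list_rotate:
  assumes "cycle_list E (us @ h # vs)"
  shows "cycle_list E (h # vs @ us)"
  using assms
  by (cases us; cases vs rule: rev_cases)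
     (auto simp: cycle_list_def successively_append_iff successively_Cons hd_append split: if_splits)

subsection \<open>Counting functions whose values are determined coordinate by coordinate\<close>

text \<open>Each function is encoded by the numbers of its values in enumerations of their candidate
  sets: a fixed set \<open>Y i\<close> at a root coordinate, a set depending on the value at the
  parent \<open>p i\<close> elsewhere. Decoding is an induction along \<open>\<mu>\<close>. This
  measure may differ from one function to another; only the parent map and the candidate sets are
  common to all of \<open>W\<close>.\<close>

lemma det_count:
  fixes W :: "(int \<Rightarrow> 'v) set" and d :: "int \<Rightarrow> nat"
  assumes fin: "finite I"
    and ext: "\<And>c c'. c \<in> W \<Longrightarrow> c' \<in> W \<Longrightarrow> \<forall>i\<in>I. c i = c' i \<Longrightarrow> c = c'"
    and root: "\<And>i. i \<in> I \<inter> A \<Longrightarrow> finite (Y i) \<and> card (Y i) \<le> d i"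
    and rootW: "\<And>c i. c \<in> W \<Longrightarrow> i \<in> I \<inter> A \<Longrightarrow> c i \<in> Y i"
    and par: "\<And>i. i \<in> I - A \<Longrightarrow> p i \<in> I"
    and step: "\<And>c i. c \<in> W \<Longrightarrow> i \<in> I - A \<Longrightarrow>
        c i \<in> N i (c (p i)) \<and> finite (N i (c (p i))) \<and> card (N i (c (p i))) \<le> d i"
    and wf: "\<And>c. c \<in> W \<Longrightarrow> \<exists>\<mu> :: int \<Rightarrow> nat. \<forall>i\<in>I - A. \<mu> (p i) < \<mu> i"
  shows "card W \<le> (\<Prod>i\<in>I. d i)"
proof -
  have enum: "\<exists>e. inj_on e S \<and> e ` S \<subseteq> {..<n}" if "finite S" "card S \<le> n" for S :: "'v set" and n :: nat
    using that finite_imp_inj_to_nat_seg[of S] by (metis bij_betw_def card_Collect_less_nat card_image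
      inj_on_iff_card_le lessThan_def card_lessThan card_le_inj finite_lessThan)
  define e0 where "e0 i = (SOME e. inj_on e (Y i) \<and> e ` Y i \<subseteq> {..<d i})" for i
  define e where "e i x = (SOME e. inj_on e (N i x) \<and> e ` N i x \<subseteq> {..<d i})" for i x
  have e0: "inj_on (e0 i) (Y i) \<and> e0 i ` Y i \<subseteq> {..<d i}" if "i \<in> I \<inter> A" for i
    unfolding e0_def by (rule someI_ex[of "\<lambda>e. inj_on e (Y i) \<and> e ` Y i \<subseteq> {..<d i}"], rule enum)
      (use root[OF that] in auto)
  have e: "inj_on (e i x) (N i x) \<and> e i x ` N i x \<subseteq> {..<d i}"
    if "finite (N i x) \<and> card (N i x) \<le> d i" for i x
    unfolding e_def by (rule someI_ex[of "\<lambda>e. inj_on e (N i x) \<and> e ` N i x \<subseteq> {..<d i}"], rule enum)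
      (use that in auto)
  define code where
    "code c = restrict (\<lambda>i. if i \<in> A then e0 i (c i) else e i (c (p i)) (c i)) I" for c
  have "inj_on code W"
  proof (rule inj_onI)
    fix c c' assume c: "c \<in> W" "c' \<in> W" and eq: "code c = code c'"
    obtain \<mu> :: "int \<Rightarrow> nat" where \<mu>: "\<forall>i\<in>I - A. \<mu> (p i) < \<mu> i" using wf[OF c(1)] by blast
    have code_eq: "code c i = code c' i" for i using eq by simp
    have "i \<in> I \<longrightarrow> c i = c' i" for i
    proof (induction "\<mu> i" arbitrary: i rule: less_induct)
      case less
      show ?case
      proof
        assume i: "i \<in> I"
        show "c i = c' i"
        proof (cases "i \<in> A")
          case True
          then have "e0 i (c i) = e0 i (c' i)" using code_eq[of i] i by (simp add: code_def)
          then show ?thesis using e0[of i] rootW[OF c(1), of i] rootW[OF c(2), of i] True i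
            by (auto dest: inj_onD)
        next
          case False
          then have pi: "c (p i) = c' (p i)" using less \<mu> par i by auto
          have "e i (c (p i)) (c i) = e i (c (p i)) (c' i)"
            using code_eq[of i] i False pi by (simp add: code_def)
          moreover have "inj_on (e i (c (p i))) (N i (c (p i)))"
            using e step[OF c(1), of i] i False by blast
          moreover have "c i \<in> N i (c (p i))" using step[OF c(1), of i] i False by blast
          moreover have "c' i \<in> N i (c (p i))" using step[OF c(2), of i] i False pi by simp
          ultimately show ?thesis by (meson inj_onD)
        qed
      qed
    qed
    then show "c = c'" using ext[OF c] by blast
  qed
  moreover have "code ` W \<subseteq> PiE I (\<lambda>i. {..<d i})"
  proof
    fix z assume "z \<in> code ` W"
    then obtain c where c: "c \<in> W" "z = code c" by blast
    show "z \<in> PiE I (\<lambda>i. {..<d i})"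
    proof (rule PiE_I)
      fix i assume i: "i \<in> I"
      show "z i \<in> {..<d i}"
      proof (cases "i \<in> A")
        case True
        then show ?thesis using e0[of i] rootW[OF c(1), of i] i c(2) by (auto simp: code_def)
      next
        case False
        then show ?thesis using e[of i "c (p i)"] step[OF c(1), of i] i c(2)
          by (auto simp: code_def)
      qed
    qed (simp add: c code_def)
  qed
  moreover have "finite (PiE I (\<lambda>i. {..<d i}))" using fin by (intro finite_PiE) auto
  ultimately have "card W \<le> card (PiE I (\<lambda>i. {..<d i}))" by (meson card_inj_on_le)
  then show ?thesis using fin by (simp add: card_PiE)
qed

subsection \<open>Degeneracy\<close>

text \<open>A longest path works: a neighbour of its first vertex that is not on it could be put in
  front.\<close>

lemma maximal_path:
  assumes "finite U" "U \<noteq> {}"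
  shows "\<exists>p. p \<noteq> [] \<and> distinct p \<and> set p \<subseteq> U \<and> successively E p \<and> (\<forall>w\<in>U. E w (hd p) \<longrightarrow> w \<in> set p)"
proof -
  define P where "P p \<longleftrightarrow> p \<noteq> [] \<and> distinct p \<and> set p \<subseteq> U \<and> successively E p" for p
  obtain u where "u \<in> U" using assms by blast
  then have P0: "P [u]" by (simp add: P_def)
  have bd: "\<forall>p. P p \<longrightarrow> length p < Suc (card U)"
    using assms(1) by (auto simp: P_def less_Suc_eq_le) (metis card_mono distinct_card)
  obtain p where p: "P p" "\<And>q. P q \<Longrightarrow> length q \<le> length p"
    using ex_has_greatest_nat[of P "[u]" length "Suc (card U)"] P0 bd by blast
  have "w \<in> set p" if "w \<in> U" "E w (hd p)" for w
  proof (rule ccontr)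
    assume "w \<notin> set p"
    then have "P (w # p)" using p(1) that by (auto simp: P_def successively_Cons)
    then show False using p(2) by fastforce
  qed
  then show ?thesis using p(1) unfolding P_def by blast
qed

lemma card_nth_inter:
  assumes "distinct p" "S \<subseteq> set p"
  shows "card S = card {i. i < length p \<and> p ! i \<in> S}"
proof -
  have "bij_betw (\<lambda>i. p ! i) {i. i < length p \<and> p ! i \<in> S} S"
    using assms by (auto simp: bij_betw_def inj_on_def nth_eq_iff_index_eq in_set_conv_nth image_iff)
      (metis in_set_conv_nth subsetD)
  then show ?thesis by (metis bij_betw_same_card)
qed

text \<open>The first vertex of a maximal path in \<open>U\<close> has all its neighbours in
  \<open>U\<close> on the path. More than \<open>l\<close> of them would include one at index at
  least \<open>l\<close>, and the initial segment up to it would close to a cycle with more than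
  \<open>l\<close> vertices.\<close>

lemma circ_low_degree:
  assumes g: "graph_on V E" and l: "circ_le l E" "l \<ge> 2" and U: "U \<subseteq> V" "U \<noteq> {}"
  shows "\<exists>v\<in>U. card {w\<in>U. E v w} \<le> l"
proof -
  have finU: "finite U" using g U(1) by (auto simp: graph_on_def intro: finite_subset)
  obtain p where p: "p \<noteq> []" "distinct p" "set p \<subseteq> U" "successively E p"
    "\<forall>w\<in>U. E w (hd p) \<longrightarrow> w \<in> set p"
    using maximal_path[OF finU U(2), of E] by blast
  let ?S = "{w\<in>U. E (hd p) w}"
  have "card ?S \<le> l"
  proof (rule ccontr)
    assume "\<not> card ?S \<le> l"
    moreover have "?S \<subseteq> set p" using p(5) graph_on_sym[OF g] by blast
    ultimately have "card {i. i < length p \<and> p ! i \<in> ?S} > l"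
      using card_nth_inter[OF p(2)] by simp
    moreover have "card {..<l} = l" by simp
    ultimately have "\<not> {i. i < length p \<and> p ! i \<in> ?S} \<subseteq> {..<l}"
      by (metis (no_types, lifting) card_mono finite_lessThan leD)
    then obtain i where i: "i < length p" "E (hd p) (p ! i)" "i \<ge> l" by force
    have tk: "take (Suc i) p = take i p @ [p ! i]" using i(1) by (simp add: take_Suc_conv_app_nth)
    have "successively E (take (Suc i) p @ drop (Suc i) p)" using p(4) by simp
    then have "successively E (take (Suc i) p)" by (metis successively_append_iff)
    moreover have "hd (take (Suc i) p) = hd p" by simp
    moreover have "last (take (Suc i) p) = p ! i" by (simp add: tk)
    moreover have "E (p ! i) (hd p)" using i(2) graph_on_sym[OF g] by blast
    ultimately have "cycle_list E (take (Suc i) p)"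
      using i l(2) p(2) by (auto simp: cycle_list_def)
    then have "length (take (Suc i) p) \<le> l" using l(1) unfolding circ_le_def by blast
    then have "min (length p) (Suc i) \<le> l" by (simp only: length_take)
    then show False using i by simp
  qed
  moreover have "hd p \<in> U" using p by auto
  ultimately show ?thesis by blast
qed

text \<open>A vertex of small degree is ranked lowest and the others are ranked recursively.
  Directing edges towards the larger rank gives the acyclic orientation with bounded
  out-degree.\<close>

lemma degenerate_rank:
  assumes "finite V" "\<And>U. U \<subseteq> V \<Longrightarrow> U \<noteq> {} \<Longrightarrow> \<exists>v\<in>U. card {w\<in>U. E v w} \<le> d"
  shows "\<exists>r :: 'v \<Rightarrow> nat. inj_on r V \<and> (\<forall>x\<in>V. card {y\<in>V. E x y \<and> r x < r y} \<le> d)"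
  using assms
proof (induction V rule: finite_psubset_induct)
  case (psubset V)
  show ?case
  proof (cases "V = {}")
    case False
    then obtain v where v: "v \<in> V" "card {w\<in>V. E v w} \<le> d" using psubset(3) by blast
    have sub: "V - {v} \<subset> V" using v by blast
    have "\<exists>r :: 'v \<Rightarrow> nat. inj_on r (V - {v}) \<and>
        (\<forall>x\<in>V - {v}. card {y\<in>V - {v}. E x y \<and> r x < r y} \<le> d)"
      by (rule psubset(2)[OF sub], rule psubset(3)) (use sub in auto)
    then obtain r :: "'v \<Rightarrow> nat" where r: "inj_on r (V - {v})"
      "\<forall>x\<in>V - {v}. card {y\<in>V - {v}. E x y \<and> r x < r y} \<le> d"
      by blast
    define r' where "r' x = (if x = v then 0 else Suc (r x))" for x
    have "inj_on r' V" using r(1) by (auto simp: inj_on_def r'_def)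
    moreover have "card {y\<in>V. E x y \<and> r' x < r' y} \<le> d" if x: "x \<in> V" for x
    proof (cases "x = v")
      case True
      have "card {y\<in>V. E x y \<and> r' x < r' y} \<le> card {w\<in>V. E v w}"
        using psubset(1) True by (intro card_mono) auto
      then show ?thesis using v by simp
    next
      case False
      have "{y\<in>V. E x y \<and> r' x < r' y} = {y\<in>V - {v}. E x y \<and> r x < r y}"
        using False by (auto simp: r'_def)
      then show ?thesis using r(2) x False by simp
    qed
    ultimately show ?thesis by blast
  qed simp
qed

subsection \<open>Sparse periodic sets of integers\<close>

lemma card_periodic_shift:
  fixes f :: "int \<Rightarrow> bool"
  assumes per: "\<forall>i. f (i + int m) = f i"
  shows "card {i\<in>{0..<int m}. f (i + 1)} = card {i\<in>{0..<int m}. f i}"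
proof -
  have fm: "f (i mod int m) = f i" for i using periodic_mod[OF per] .
  have "bij_betw (\<lambda>i. (i + 1) mod int m) {i\<in>{0..<int m}. f (i + 1)} {i\<in>{0..<int m}. f i}"
  proof (rule bij_betw_byWitness[where f' = "\<lambda>i. (i - 1) mod int m"])
    show "\<forall>a\<in>{i\<in>{0..<int m}. f (i + 1)}. ((a + 1) mod int m - 1) mod int m = a"
      by (auto simp: mod_diff_left_eq)
    show "\<forall>a\<in>{i\<in>{0..<int m}. f i}. ((a - 1) mod int m + 1) mod int m = a"
      by (auto simp: mod_add_left_eq)
    show "(\<lambda>i. (i + 1) mod int m) ` {i\<in>{0..<int m}. f (i + 1)} \<subseteq> {i\<in>{0..<int m}. f i}"
      using fm by auto
    have "f ((i - 1) mod int m + 1) = f i" for i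
      using fm[of "(i - 1) mod int m + 1"] fm[of i] by (simp add: mod_add_left_eq)
    then show "(\<lambda>i. (i - 1) mod int m) ` {i\<in>{0..<int m}. f i} \<subseteq> {i\<in>{0..<int m}. f (i + 1)}"
      by auto
  qed
  then show ?thesis by (rule bij_betw_same_card)
qed

context
  fixes f :: "int \<Rightarrow> bool" and m :: nat
  assumes per: "\<forall>i. f (i + int m) = f i" and sparse: "\<forall>i. \<not> (f i \<and> f (i + 1))"
begin

text \<open>Every position satisfies \<open>f i\<close>, or \<open>f (i + 1)\<close>, or is a gap
  with neither. Sparseness makes the first two exclusive, and translation makes them equally
  numerous.\<close>

lemma sparse_partition:
  "2 * card {i\<in>{0..<int m}. f i} + card {i\<in>{0..<int m}. \<not> f i \<and> \<not> f (i + 1)} = m"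
proof -
  let ?A = "{i\<in>{0..<int m}. f i}" and ?B = "{i\<in>{0..<int m}. f (i + 1)}"
    and ?C = "{i\<in>{0..<int m}. \<not> f i \<and> \<not> f (i + 1)}"
  have fin: "finite ?A" "finite ?B" "finite ?C" by (auto intro: finite_subset[of _ "{0..<int m}"])
  have "?A \<union> ?B \<union> ?C = {0..<int m}" "?A \<inter> ?B = {}" "(?A \<union> ?B) \<inter> ?C = {}" using sparse by auto
  then have "card ?A + card ?B + card ?C = card {0..<int m}"
    using card_Un_disjoint[of ?A ?B] card_Un_disjoint[of "?A \<union> ?B" ?C] fin by (simp del: Un_iff)
  then show ?thesis using card_periodic_shift[of f, OF per] by simp
qed

lemma sparse_card: "2 * card {i\<in>{0..<int m}. f i} \<le> m"
  using sparse_partition by linarith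

text \<open>By \<open>sparse_partition\<close> a set with at least \<open>m div 2\<close> elements
  per period leaves room for at most \<open>m mod 2\<close> gaps.\<close>

lemma sparse_gap_unique:
  assumes "m div 2 \<le> card {i\<in>{0..<int m}. f i}" "m > 0"
    and z: "\<not> f z \<and> \<not> f (z + 1)" "\<not> f z' \<and> \<not> f (z' + 1)"
  shows "z mod int m = z' mod int m" "odd m"
proof -
  let ?C = "{i\<in>{0..<int m}. \<not> f i \<and> \<not> f (i + 1)}"
  have fm: "f (i mod int m) = f i" for i using periodic_mod[OF per] .
  have fm1: "f (i mod int m + 1) = f (i + 1)" for i
    using fm[of "i mod int m + 1"] fm[of "i + 1"] by (simp add: mod_add_left_eq)
  have C: "z mod int m \<in> ?C" "z' mod int m \<in> ?C" using z fm fm1 assms(2) by auto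
  have finC: "finite ?C" by (auto intro: finite_subset[of _ "{0..<int m}"])
  have "card ?C \<le> 1" using sparse_partition assms(1) by linarith
  then show "z mod int m = z' mod int m" using C finC by (metis (no_types, lifting) card_le_Suc0_iff_eq One_nat_def)
  have "card ?C \<noteq> 0" using C finC by auto
  then show "odd m" using sparse_partition assms(1) by presburger
qed

text \<open>Without a gap, members and non-members alternate. With the single gap at
  \<open>z\<close>, steps of two from \<open>z + 2\<close> meet only members until the gap is
  reached again. The number of values allowed for \<open>r\<close>, 2 or m, becomes the leading
  factor of the final count.\<close>

lemma sparse_canonical:
  assumes k: "m div 2 \<le> card {i\<in>{0..<int m}. f i}" and m: "m \<ge> 3"
  shows "\<exists>r\<in>{0..<(if even m then 2 else int m)}. \<forall>j. int j < int (m div 2) \<longrightarrow> f (r + 2 * int j)"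
proof (cases "even m")
  case True
  have gap: "f i \<or> f (i + 1)" for i using sparse_gap_unique(2)[OF k, of i i] True m by auto
  have "\<exists>r\<in>{0..<2::int}. f r"
    using gap[of 0] by (auto intro: bexI[of _ 0] bexI[of _ 1])
  then obtain r :: int where r: "r \<in> {0..<2}" "f r" by blast
  have "f (r + 2 * int j)" for j
  proof (induction j)
    case (Suc j)
    then have "\<not> f (r + 2 * int j + 1)" using sparse by blast
    then have "f (r + 2 * int j + 1 + 1)" using gap by blast
    then show ?case by (simp add: algebra_simps)
  qed (use r in simp)
  then have "\<forall>j. int j < int (m div 2) \<longrightarrow> f (r + 2 * int j)" by blast
  moreover have "r \<in> {0..<(if even m then 2 else int m)}" using r True by simp
  ultimately show ?thesis by blast
next
  case False
  have "card {i\<in>{0..<int m}. \<not> f i \<and> \<not> f (i + 1)} \<noteq> 0"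
    using sparse_partition False by presburger
  then have "{i\<in>{0..<int m}. \<not> f i \<and> \<not> f (i + 1)} \<noteq> {}" by (metis card.empty)
  then obtain z where z: "\<not> f z \<and> \<not> f (z + 1)" by blast
  note uniq = sparse_gap_unique(1)[OF k _ z]
  have f: "f (z + 2 + 2 * int j)" if "j < m div 2" for j
    using that
  proof (induction j)
    case 0
    show ?case
    proof (rule ccontr)
      assume "\<not> ?case"
      then have "z mod int m = (z + 1) mod int m" using uniq[of "z + 1"] z m by (auto simp: algebra_simps)
      then have "(z - z) mod int m = (z + 1 - z) mod int m" by (metis mod_diff_left_eq)
      then show False using m by simp
    qed
  next
    case (Suc j)
    then have "\<not> f (z + 2 + 2 * int j + 1)" using sparse by auto
    show ?case
    proof (rule ccontr)
      assume "\<not> ?case"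
      then have "z mod int m = (z + 3 + 2 * int j) mod int m"
        using uniq[of "z + 3 + 2 * int j"] \<open>\<not> f (z + 2 + 2 * int j + 1)\<close> m by (auto simp: algebra_simps)
      then have "(z - z) mod int m = (z + 3 + 2 * int j - z) mod int m" by (metis mod_diff_left_eq)
      moreover have "3 + 2 * int j < int m" using Suc.prems False by presburger
      ultimately show False by (simp add: mod_pos_pos_trivial)
    qed
  qed
  have "f ((z + 2) mod int m + 2 * int j)" if "j < m div 2" for j
  proof -
    have "f (((z + 2) mod int m + 2 * int j) mod int m) = f ((z + 2 + 2 * int j) mod int m)"
      by (simp add: mod_add_left_eq)
    then show ?thesis using f[OF that] periodic_mod[OF per] by metis
  qed
  moreover have "(z + 2) mod int m \<in> {0..<int m}" using m by auto
  ultimately show ?thesis using False by (metis of_nat_less_iff)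
qed

end

subsection \<open>Copies of cycles and labelled cycles\<close>

definition adj :: "'v graph \<Rightarrow> 'v \<Rightarrow> 'v \<Rightarrow> bool" where
  "adj G x y \<longleftrightarrow> {x, y} \<in> edges G"

definition cyc_image :: "(int \<Rightarrow> 'v) \<Rightarrow> 'v graph" where
  "cyc_image c = (range c, range (\<lambda>i. {c i, c (i + 1)}))"

lemma graph_on_adj: "simple_graph G \<Longrightarrow> graph_on (verts G) (adj G)"
  by (auto simp: graph_on_def simple_graph_def adj_def insert_commute card_insert_if split: if_splits)

lemma range_eqI_mutual: "(\<And>i. \<exists>j. f i = g j) \<Longrightarrow> (\<And>i. \<exists>j. g i = f j) \<Longrightarrow> range f = range g"
  by (metis (no_types, lifting) image_subset_iff rangeI subset_antisym)

lemma nat_mod_less: "m > 0 \<Longrightarrow> nat (i mod int m) < m"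
  by (metis nat_less_iff of_nat_0_less_iff pos_mod_bound pos_mod_sign)

lemma cyc_image_iso:
  assumes c: "c \<in> cyc m E" and m: "m > 0"
  shows "graph_iso (cycle_graph m) (cyc_image c)"
proof -
  let ?f = "\<lambda>i. c (int i)"
  have mm: "c (int (Suc i mod m)) = c (int i + 1)" for i
    using cyc_mod[OF c, of "int i + 1"] by (simp add: zmod_int add.commute)
  have "c i = c (int (nat (i mod int m)))" for i using cyc_mod[OF c, of i] m by simp
  moreover have "nat (i mod int m) < m" for i using m nat_mod_less by auto
  ultimately have rep: "\<exists>n<m. c i = c (int n)" for i by metis
  have "bij_betw ?f {..<m} (range c)"
    unfolding bij_betw_def
  proof
    show "inj_on ?f {..<m}" using cyc_eq_iff[OF c m] by (auto simp: inj_on_def)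
    show "?f ` {..<m} = range c" using rep by fastforce
  qed
  moreover have "range (\<lambda>i. {c i, c (i + 1)}) = (\<lambda>e. ?f ` e) ` {{i, Suc i mod m} | i. i < m}"
  proof -
    have "{c i, c (i + 1)} \<in> (\<lambda>e. ?f ` e) ` {{i, Suc i mod m} | i. i < m}" for i
    proof -
      let ?n = "nat (i mod int m)"
      have n: "?n < m" "int ?n = i mod int m" using m nat_mod_less by auto
      have "c (int ?n) = c i" using cyc_mod[OF c] n by simp
      moreover have "c (int ?n + 1) = c (i + 1)"
        using cyc_eq_iff[OF c m, of "int ?n + 1" "i + 1"] n by (simp add: mod_add_left_eq)
      ultimately have "{c i, c (i + 1)} = ?f ` {?n, Suc ?n mod m}" using mm[of ?n] by auto
      then show ?thesis using n by blast
    qed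
    moreover have "?f ` {i, Suc i mod m} = {c (int i), c (int i + 1)}" for i using mm[of i] by auto
    ultimately show ?thesis by auto
  qed
  ultimately show ?thesis by (auto simp: graph_iso_def cyc_image_def cycle_graph_def)
qed

lemma cyc_image_copies:
  assumes G: "simple_graph G" and m: "m \<ge> 3"
  shows "cyc_image ` cyc m (adj G) = copies (cycle_graph m) G"
proof
  show "cyc_image ` cyc m (adj G) \<subseteq> copies (cycle_graph m) G"
  proof
    fix K assume "K \<in> cyc_image ` cyc m (adj G)"
    then obtain c where c: "c \<in> cyc m (adj G)" "K = cyc_image c" by blast
    note g = graph_on_adj[OF G]
    have ran: "range c \<subseteq> verts G" using cyc_in_V[OF g c(1)] by blast
    then have "finite (range c)" using g by (auto simp: graph_on_def intro: finite_subset)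
    moreover have "card {c i, c (i + 1)} = 2" for i
      using cyc_adj[OF c(1), of i] graph_onD[OF g] by (simp add: card_insert_if)
    ultimately have "simple_graph K" by (auto simp: c(2) simple_graph_def cyc_image_def)
    moreover have "edges K \<subseteq> edges G"
      using cyc_adj[OF c(1)] by (auto simp: c(2) cyc_image_def adj_def)
    ultimately have "subgraph K G" using ran by (auto simp: subgraph_def c(2) cyc_image_def)
    then show "K \<in> copies (cycle_graph m) G"
      using cyc_image_iso[OF c(1)] m by (simp add: copies_def c(2))
  qed
  show "copies (cycle_graph m) G \<subseteq> cyc_image ` cyc m (adj G)"
  proof
    fix K assume "K \<in> copies (cycle_graph m) G"
    then obtain f where sub: "subgraph K G" and f: "bij_betw f {..<m} (verts K)"
      "edges K = (\<lambda>e. f ` e) ` {{i, Suc i mod m} | i. i < m}"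
      by (auto simp: copies_def graph_iso_def cycle_graph_def)
    define c where "c i = f (nat (i mod int m))" for i
    have nx: "nat ((i + 1) mod int m) = Suc (nat (i mod int m)) mod m" for i
    proof -
      have "int (Suc (nat (i mod int m)) mod m) = (i mod int m + 1) mod int m"
        using m by (simp add: zmod_int add.commute)
      then show ?thesis by (metis mod_add_left_eq nat_int)
    qed
    have lt: "nat (i mod int m) < m" for i using m nat_mod_less by auto
    have ed: "{c i, c (i + 1)} = f ` {nat (i mod int m), Suc (nat (i mod int m)) mod m}" for i
      by (simp add: c_def nx)
    have edK: "edges K = range (\<lambda>i. {c i, c (i + 1)})"
    proof
      show "range (\<lambda>i. {c i, c (i + 1)}) \<subseteq> edges K" unfolding ed f(2) using lt by blast
      show "edges K \<subseteq> range (\<lambda>i. {c i, c (i + 1)})"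
      proof
        fix e assume "e \<in> edges K"
        then obtain i where i: "i < m" "e = f ` {i, Suc i mod m}" unfolding f(2) by blast
        then have "e = {c (int i), c (int i + 1)}" using ed[of "int i"] by simp
        then show "e \<in> range (\<lambda>i. {c i, c (i + 1)})" by blast
      qed
    qed
    have "range c = f ` {..<m}"
    proof
      show "range c \<subseteq> f ` {..<m}" using lt by (auto simp: c_def)
      show "f ` {..<m} \<subseteq> range c"
      proof
        fix x assume "x \<in> f ` {..<m}"
        then obtain i where "i < m" "x = c (int i)" by (auto simp: c_def)
        then show "x \<in> range c" by blast
      qed
    qed
    then have "K = cyc_image c" using edK f(1) by (cases K) (auto simp: cyc_image_def bij_betw_def)
    moreover have "c \<in> cyc m (adj G)"
    proof -
      have "inj_on c {0..<int m}"
        using f(1) by (auto simp: c_def bij_betw_def inj_on_def nat_less_iff) (metis lessThan_iff nat_eq_iff2 nat_less_iff)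
      moreover have "adj G (c i) (c (i + 1))" for i
        using sub edK by (auto simp: subgraph_def adj_def)
      ultimately show ?thesis by (simp add: cyc_def c_def)
    qed
    ultimately show "K \<in> cyc_image ` cyc m (adj G)" by blast
  qed
qed

lemma cyc_image_eq_nbr:
  assumes c: "c \<in> cyc m E" "c0 \<in> cyc m E" "m \<ge> 3" and eq: "cyc_image c = cyc_image c0"
    and i: "c i = c0 j"
  shows "c (i + 1) = c0 (j + 1) \<or> c (i + 1) = c0 (j - 1)"
proof -
  have "snd (cyc_image c) = snd (cyc_image c0)" using eq by simp
  then have "range (\<lambda>i. {c i, c (i + 1)}) = range (\<lambda>i. {c0 i, c0 (i + 1)})"
    by (simp only: cyc_image_def snd_conv)
  then have "{c i, c (i + 1)} \<in> range (\<lambda>i. {c0 i, c0 (i + 1)})" by blast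
  then obtain t where t: "{c i, c (i + 1)} = {c0 t, c0 (t + 1)}" by blast
  have m0: "m > 0" using c by simp
  note e0 = cyc_eq_iff[OF c(2) m0]
  have "c i = c0 t \<and> c (i + 1) = c0 (t + 1) \<or> c i = c0 (t + 1) \<and> c (i + 1) = c0 t"
    using t by (auto simp: doubleton_eq_iff)
  then show ?thesis
  proof
    assume a: "c i = c0 t \<and> c (i + 1) = c0 (t + 1)"
    then have "c0 (t + 1) = c0 (j + 1)" using i e0 by (metis mod_add_left_eq)
    then show ?thesis using a by simp
  next
    assume a: "c i = c0 (t + 1) \<and> c (i + 1) = c0 t"
    then have "(t + 1) mod int m = j mod int m" using i e0 by simp
    then have "(t + 1 - 1) mod int m = (j - 1) mod int m" by (metis mod_diff_left_eq)
    then have "c0 t = c0 (j - 1)" using e0 by simp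
    then show ?thesis using a by simp
  qed
qed

text \<open>A labelling of a given image is fixed by its values at 0 and 1: each later value is one
  of the two neighbours of the previous one, and injectivity forbids turning back. The offset
  \<open>j\<close> and the sign \<open>e\<close> therefore account for all labellings.\<close>

lemma cyc_image_fibre:
  assumes c0: "c0 \<in> cyc m E" and m: "m \<ge> 3" and sym: "\<And>x y. E x y \<Longrightarrow> E y x"
  shows "{c \<in> cyc m E. cyc_image c = cyc_image c0}
    = (\<lambda>(e, j) i. c0 (j + e * i)) ` ({1, -1} \<times> {0..<int m})" (is "?L = ?R")
proof
  have m0: "m > 0" using m by simp
  note e0 = cyc_eq_iff[OF c0 m0]
  show "?L \<subseteq> ?R"
  proof
    fix c assume "c \<in> ?L"
    then have c: "c \<in> cyc m E" and eq: "cyc_image c = cyc_image c0" by auto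
    note e = cyc_eq_iff[OF c m0]
    have "c 0 \<in> range c0" using eq by (auto simp: cyc_image_def)
    then obtain j where j: "j \<in> {0..<int m}" "c 0 = c0 j" using cyc_range[OF c0 m0] by auto
    from cyc_image_eq_nbr[OF c c0 m eq j(2)]
    obtain s :: int where s: "s \<in> {1, -1}" "c 1 = c0 (j + s)" by force
    have "c (int i) = c0 (j + s * int i) \<and> c (int i + 1) = c0 (j + s * (int i + 1))" for i
    proof (induction i)
      case (Suc i)
      let ?t = "j + s * (int i + 1)"
      have "c (int i + 2) = c0 (?t + 1) \<or> c (int i + 2) = c0 (?t - 1)"
        using cyc_image_eq_nbr[OF c c0 m eq, of "int i + 1" ?t] Suc by (simp add: add.assoc)
      moreover have "c (int i + 2) \<noteq> c (int i)"
      proof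
        assume "c (int i + 2) = c (int i)"
        then have "(int i + 2 - int i) mod int m = (int i - int i) mod int m"
          using e by (metis mod_diff_left_eq)
        then show False using m by simp
      qed
      ultimately have "c (int i + 2) = c0 (j + s * (int i + 2))"
        using s(1) Suc by (auto simp: algebra_simps)
      then show ?case using Suc by (simp add: algebra_simps)
    qed (use j s in auto)
    then have nn: "c (int i) = c0 (j + s * int i)" for i by blast
    have "c i = c0 (j + s * i)" for i
    proof -
      have "i mod int m = int (nat (i mod int m))" using m by simp
      then have "c i = c0 (j + s * (i mod int m))" using nn cyc_mod[OF c, of i] by metis
      also have "\<dots> = c0 (j + s * i)" using e0 by (metis mod_add_right_eq mod_mult_right_eq)
      finally show ?thesis .
    qed
    then have "c = (\<lambda>(e, j) i. c0 (j + e * i)) (s, j)" by auto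
    then show "c \<in> ?R" using s j by blast
  qed
  show "?R \<subseteq> ?L"
  proof
    fix c assume "c \<in> ?R"
    then obtain sj where "sj \<in> {1, -1} \<times> {0..<int m}" "c = (\<lambda>(e, j) i. c0 (j + e * i)) sj" by blast
    then obtain s j where sj: "s \<in> {1, -1::int}" "j \<in> {0..<int m}" "c = (\<lambda>i. c0 (j + s * i))"
      by (cases sj) auto
    have ss: "s * s = 1" using sj(1) by auto
    have "c (i + int m) = c i" for i
    proof -
      have "j + s * (i + int m) = j + s * i + int m * s" by (simp add: algebra_simps)
      moreover have "(j + s * i + int m * s) mod int m = (j + s * i) mod int m" by (rule mod_mult_self2)
      ultimately show ?thesis using e0[of "j + s * (i + int m)" "j + s * i"] unfolding sj(3) by metis
    qed
    moreover have "inj_on c {0..<int m}"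
    proof (rule inj_onI)
      fix a b assume ab: "a \<in> {0..<int m}" "b \<in> {0..<int m}" "c a = c b"
      then have "(j + s * a) mod int m = (j + s * b) mod int m" using e0 by (simp add: sj(3))
      then have "(s * (j + s * a - j)) mod int m = (s * (j + s * b - j)) mod int m"
        by (metis mod_diff_left_eq mod_mult_right_eq)
      then have "a mod int m = b mod int m" using ss by (simp add: mult.assoc[symmetric])
      then show "a = b" using ab by simp
    qed
    moreover have "E (c i) (c (i + 1))" for i
      using sj(1) cyc_adj[OF c0, of "j + i"] sym[OF cyc_adj[OF c0, of "j - i - 1"]]
      by (auto simp: sj(3) algebra_simps)
    ultimately have "c \<in> cyc m E" by (simp add: cyc_def)
    moreover have "range c = range c0"
    proof -
      have "c0 i = c (s * (i - j))" for i using ss by (simp add: sj(3) mult.assoc[symmetric])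
      then show ?thesis by (auto simp: sj(3))
    qed
    moreover have "range (\<lambda>i. {c i, c (i + 1)}) = range (\<lambda>i. {c0 i, c0 (i + 1)})"
    proof (cases "s = 1")
      case True
      have "{c0 i, c0 (i + 1)} = {c (i - j), c (i - j + 1)}" for i
        by (simp add: sj(3) True algebra_simps)
      moreover have "{c i, c (i + 1)} = {c0 (j + i), c0 (j + i + 1)}" for i
        by (simp add: sj(3) True algebra_simps)
      ultimately show ?thesis by (intro range_eqI_mutual) blast+
    next
      case False
      then have s: "s = -1" using sj by simp
      have "{c0 i, c0 (i + 1)} = {c (j - i - 1), c (j - i - 1 + 1)}" for i
        by (auto simp: sj(3) s algebra_simps)
      moreover have "{c i, c (i + 1)} = {c0 (j - i - 1), c0 (j - i - 1 + 1)}" for i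
        by (auto simp: sj(3) s algebra_simps)
      ultimately show ?thesis by (intro range_eqI_mutual) blast+
    qed
    ultimately show "c \<in> ?L" by (simp add: cyc_image_def)
  qed
qed

text \<open>The two directions give different labellings because 1 and -1 are not congruent modulo
  \<open>m \<ge> 3\<close>.\<close>

lemma card_cyc_image_fibre:
  assumes c0: "c0 \<in> cyc m E" and m: "m \<ge> 3" and sym: "\<And>x y. E x y \<Longrightarrow> E y x"
  shows "card {c \<in> cyc m E. cyc_image c = cyc_image c0} = 2 * m"
proof -
  have m0: "m > 0" using m by simp
  note e0 = cyc_eq_iff[OF c0 m0]
  have "inj_on (\<lambda>(e, j) i. c0 (j + e * i)) ({1, -1 :: int} \<times> {0..<int m})"
  proof (rule inj_onI, clarify)
    fix e j e' j' :: int
    assume e: "e \<in> {1, -1}" "e' \<in> {1, -1}" and j: "j \<in> {0..<int m}" "j' \<in> {0..<int m}"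
      and eq: "(\<lambda>i. c0 (j + e * i)) = (\<lambda>i. c0 (j' + e' * i))"
    have "c0 j = c0 j'" using fun_cong[OF eq, of 0] by simp
    then have jj: "j = j'" using e0 j by simp
    have "(j + e) mod int m = (j + e') mod int m" using fun_cong[OF eq, of 1] e0 jj by simp
    then have "(j + e - (j - 1)) mod int m = (j + e' - (j - 1)) mod int m" by (metis mod_diff_left_eq)
    then have "(e + 1) mod int m = (e' + 1) mod int m" by (simp add: algebra_simps)
    then have "e = e'" using e m by auto
    then show "e = e' \<and> j = j'" using jj by simp
  qed
  from card_image[OF this]
  have "card ((\<lambda>(e, j) i. c0 (j + e * i)) ` ({1, -1 :: int} \<times> {0..<int m})) = 2 * m"
    by (simp add: card_cartesian_product)
  then show ?thesis using cyc_image_fibre[OF c0 m sym] by simp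
qed

lemma card_copies_cycle:
  assumes G: "simple_graph G" and m: "m \<ge> 3"
  shows "card (cyc m (adj G)) = 2 * m * card (copies (cycle_graph m) G)"
proof -
  note g = graph_on_adj[OF G]
  have fin: "finite (cyc m (adj G))" using finite_cyc[OF g] m by simp
  have "card (cyc m (adj G)) = (\<Sum>K\<in>cyc_image ` cyc m (adj G). card {c \<in> cyc m (adj G). cyc_image c = K})"
    using sum.group[OF fin finite_imageI[OF fin, of cyc_image], where g = cyc_image and h = "\<lambda>_. 1 :: nat"] by simp
  also have "\<dots> = (\<Sum>K\<in>cyc_image ` cyc m (adj G). 2 * m)"
    using card_cyc_image_fibre[OF _ m, of _ "adj G"] graph_on_sym[OF g] by (intro sum.cong) blast+
  finally show ?thesis by (simp add: cyc_image_copies[OF assms] mult.commute)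
qed

lemma free_of_cycles_ge:
  assumes "simple_graph G"
  shows "free_of (cycles_ge (l + 1)) G \<longleftrightarrow> circ_le l (adj G)"
proof -
  have "copies (cycle_graph j) G = {} \<longleftrightarrow> cyc j (adj G) = {}" if "j \<ge> 3" for j
    using cyc_image_copies[OF assms that] by auto
  then have "(\<forall>j\<ge>3. j > l \<longrightarrow> copies (cycle_graph j) G = {}) \<longleftrightarrow> (\<forall>j\<ge>3. j > l \<longrightarrow> cyc j (adj G) = {})"
    by blast
  moreover have "free_of (cycles_ge (l + 1)) G \<longleftrightarrow> (\<forall>j\<ge>3. j > l \<longrightarrow> copies (cycle_graph j) G = {})"
    unfolding free_of_def cycles_ge_def by (auto simp: Suc_le_eq) (metis Suc_leI equals0D prod.collapse)
  ultimately show ?thesis unfolding circ_le_iff_cyc by blast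
qed

text \<open>The factor \<open>2 * m\<close> turns copies into labelled cycles, by
  \<open>card_copies_cycle\<close>.\<close>

definition exc :: "nat \<Rightarrow> nat \<Rightarrow> nat \<Rightarrow> nat" where
  "exc l m n = 2 * m * gen_turan n (cycle_graph m) (cycles_ge (l + 1))"

lemma exc_attained:
  assumes "m \<ge> 3"
  shows "\<exists>(V :: nat set) E. graph_on V E \<and> card V = n \<and> circ_le l E \<and> card (cyc m E) = exc l m n"
proof -
  have "gen_turan n (cycle_graph m) (cycles_ge (l + 1)) \<in> copy_counts n (cycle_graph m) (cycles_ge (l + 1))"
    unfolding gen_turan_def by (intro Max_in finite_copy_counts copy_counts_cycles_ge_nonempty)
  then obtain G :: "nat graph" where G: "simple_graph G" "card (verts G) = n"
    "free_of (cycles_ge (l + 1)) G" "gen_turan n (cycle_graph m) (cycles_ge (l + 1)) = card (copies (cycle_graph m) G)"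
    unfolding copy_counts_def by auto
  then show ?thesis
    using graph_on_adj[OF G(1)] card_copies_cycle[OF G(1) assms] free_of_cycles_ge[OF G(1)]
    unfolding exc_def by metis
qed

text \<open>The vertex type is arbitrary and fewer than \<open>n\<close> vertices are allowed, since
  glued graphs live on tagged pairs and need not have exactly \<open>n\<close> vertices. The
  vertices are renamed to an initial segment of the naturals, and isolated vertices fill up the
  rest.\<close>

lemma exc_ge:
  fixes V :: "'v set"
  assumes g: "graph_on V E" and l: "circ_le l E" and n: "card V \<le> n" and m: "m \<ge> 3"
  shows "card (cyc m E) \<le> exc l m n"
proof -
  have finV: "finite V" using g by (simp add: graph_on_def)
  obtain h :: "'v \<Rightarrow> nat" where h: "inj_on h V" "h ` V = {..<card V}"
    using ex_bij_betw_finite_nat[OF finV] by (metis bij_betw_def atLeast0LessThan)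
  define G :: "nat graph" where "G = ({..<n}, {{h x, h y} | x y. E x y})"
  have hlt: "h x < n" if "x \<in> V" for x using h n that by (metis imageI lessThan_iff less_le_trans)
  have G: "simple_graph G"
    unfolding simple_graph_def G_def
  proof (intro conjI ballI)
    fix e assume "e \<in> edges ({..<n}, {{h x, h y} | x y. E x y})"
    then obtain x y where e: "e = {h x, h y}" "E x y" by auto
    then have xy: "x \<in> V" "y \<in> V" "x \<noteq> y" using graph_onD[OF g] by auto
    then have "h x \<noteq> h y" using h(1) by (auto dest: inj_onD)
    then show "card e = 2" by (simp add: e)
    show "e \<subseteq> verts ({..<n}, {{h x, h y} | x y. E x y})" using hlt xy by (simp add: e)
  qed simp
  have adjG: "adj G x y \<longleftrightarrow> (\<exists>x' y'. x = h x' \<and> y = h y' \<and> E x' y')" for x y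
    using graph_on_sym[OF g] by (auto simp: adj_def G_def doubleton_eq_iff)
  have adjh: "adj G (h x) (h y) \<longleftrightarrow> E x y" if "x \<in> V" "y \<in> V" for x y
    using adjG graph_onD[OF g] h(1) that by (metis inj_onD)
  define g' where "g' = inv_into V h"
  have g': "g' (h x) = x" if "x \<in> V" for x using h(1) that by (simp add: g'_def)
  have push: "(h \<circ> c) \<in> cyc j (adj G)" if c: "c \<in> cyc j E" for c j
  proof -
    have "inj_on (h \<circ> c) {0..<int j}"
      using c h(1) cyc_in_V[OF g c] by (intro comp_inj_on) (auto simp: cyc_def intro: inj_on_subset)
    then show ?thesis using c adjh cyc_in_V[OF g c] by (auto simp: cyc_def)
  qed
  have pull: "(g' \<circ> c) \<in> cyc j E" if c: "c \<in> cyc j (adj G)" for c j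
  proof -
    have "\<exists>x\<in>V. c i = h x" for i using cyc_adj[OF c, of i] adjG graph_onD[OF g] by metis
    then have hg: "h (g' (c i)) = c i \<and> g' (c i) \<in> V" for i using g' by metis
    have "inj_on (g' \<circ> c) {0..<int j}"
    proof (rule inj_onI)
      fix a b assume ab: "a \<in> {0..<int j}" "b \<in> {0..<int j}" "(g' \<circ> c) a = (g' \<circ> c) b"
      then have "c a = c b" using hg by (metis comp_apply)
      moreover have "inj_on c {0..<int j}" using c by (simp add: cyc_def)
      ultimately show "a = b" using ab by (meson inj_onD)
    qed
    moreover have "E (g' (c i)) (g' (c (i + 1)))" for i
      using cyc_adj[OF c, of i] adjh hg by metis
    ultimately show ?thesis using c by (simp add: cyc_def)
  qed
  have "circ_le l (adj G)" using l pull unfolding circ_le_iff_cyc by blast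
  then have "free_of (cycles_ge (l + 1)) G" using free_of_cycles_ge[OF G] by blast
  moreover have "card (verts G) = n" by (simp add: G_def)
  ultimately have "card (copies (cycle_graph m) G) \<in> copy_counts n (cycle_graph m) (cycles_ge (l + 1))"
    using G unfolding copy_counts_def by blast
  then have "card (copies (cycle_graph m) G) \<le> gen_turan n (cycle_graph m) (cycles_ge (l + 1))"
    unfolding gen_turan_def using finite_copy_counts by (intro Max_ge)
  moreover have "card (cyc m E) \<le> card (cyc m (adj G))"
  proof (rule card_inj_on_le[where f = "\<lambda>c. h \<circ> c"])
    show "inj_on (\<lambda>c. h \<circ> c) (cyc m E)"
    proof (rule inj_onI)
      fix c c' assume c: "c \<in> cyc m E" "c' \<in> cyc m E" "h \<circ> c = h \<circ> c'"
      then show "c = c'" using cyc_in_V[OF g] h(1) by (metis comp_apply ext inj_onD)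
    qed
    show "finite (cyc m (adj G))" using finite_cyc[OF graph_on_adj[OF G]] m by simp
  qed (use push in blast)
  ultimately show ?thesis unfolding card_copies_cycle[OF G m] exc_def
    by (meson le_trans mult_le_mono2)
qed

lemma exc_mono:
  assumes "n \<le> n'" "m \<ge> 3"
  shows "exc l m n \<le> exc l m n'"
  using exc_attained[OF assms(2), of n l] exc_ge[OF _ _ _ assms(2), of _ _ l n'] assms(1) by metis

section \<open>Edge counts from degeneracy\<close>

text \<open>Each ordered adjacent pair either ascends or descends in a degenerate ranking, whence
  the factor 2. The degree condition is abstract because it is applied both to the whole graph and,
  with another bound, in \<open>card_rich_edges\<close>.\<close>

lemma card_edges_le:
  assumes fin: "finite V" and sym: "\<And>x y. E x y \<Longrightarrow> E y x \<and> x \<noteq> y"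
    and deg: "\<And>U. U \<subseteq> V \<Longrightarrow> U \<noteq> {} \<Longrightarrow> \<exists>v\<in>U. card {w\<in>U. E v w} \<le> d"
  shows "card {(x, y). x \<in> V \<and> y \<in> V \<and> E x y} \<le> 2 * d * card V"
proof -
  obtain r :: "'a \<Rightarrow> nat" where r: "inj_on r V" "\<forall>x\<in>V. card {y\<in>V. E x y \<and> r x < r y} \<le> d"
    using degenerate_rank[OF fin deg] by blast
  let ?O = "SIGMA x:V. {y\<in>V. E x y \<and> r x < r y}"
  have finO: "finite ?O" using fin by auto
  have "z \<in> ?O \<union> prod.swap ` ?O" if z: "z \<in> {(x, y). x \<in> V \<and> y \<in> V \<and> E x y}" for z
  proof (rule ccontr)
    assume no: "z \<notin> ?O \<union> prod.swap ` ?O"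
    obtain x y where zxy: "z = (x, y)" by (cases z)
    then have xy: "x \<in> V" "y \<in> V" "E x y" "(x, y) \<notin> prod.swap ` ?O" using z no by auto
    have "r x \<noteq> r y" using r(1) xy sym by (auto dest: inj_onD)
    moreover have "\<not> r y < r x"
    proof
      assume "r y < r x"
      then have "(y, x) \<in> ?O" using xy sym by auto
      then have "prod.swap (y, x) \<in> prod.swap ` ?O" by (rule imageI)
      then show False using xy by simp
    qed
    ultimately show False using xy zxy no by auto
  qed
  then have "{(x, y). x \<in> V \<and> y \<in> V \<and> E x y} \<subseteq> ?O \<union> prod.swap ` ?O" by blast
  then have "card {(x, y). x \<in> V \<and> y \<in> V \<and> E x y} \<le> card (?O \<union> prod.swap ` ?O)"
    using finO by (intro card_mono) auto
  also have "\<dots> \<le> card ?O + card (prod.swap ` ?O)" by (rule card_Un_le)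
  also have "\<dots> \<le> card ?O + card ?O" using card_image_le[OF finO] by simp
  also have "card ?O = (\<Sum>x\<in>V. card {y\<in>V. E x y \<and> r x < r y})" using fin by (intro card_SigmaI) auto
  also have "\<dots> \<le> (\<Sum>x\<in>V. d)" using r(2) by (intro sum_mono) auto
  finally show ?thesis by (simp add: algebra_simps)
qed

lemma card_edges_circ:
  assumes g: "graph_on V E" and l: "circ_le l E" "l \<ge> 2"
  shows "card {(x, y). x \<in> V \<and> y \<in> V \<and> E x y} \<le> 2 * l * card V"
  using g circ_low_degree[OF g l] by (intro card_edges_le) (auto simp: graph_on_def)

subsection \<open>Links between hub vertices\<close>

text \<open>\<open>p\<close> lists the interior vertices only; if it is empty, the link is an edge.
  The ends need not lie in \<open>S\<close>.\<close>

definition link :: "('v \<Rightarrow> 'v \<Rightarrow> bool) \<Rightarrow> 'v set \<Rightarrow> 'v \<Rightarrow> 'v list \<Rightarrow> 'v \<Rightarrow> bool" where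
  "link E S b p b' \<longleftrightarrow> distinct p \<and> set p \<subseteq> S \<and> successively E (b # p @ [b'])"

text \<open>A cycle made of at most \<open>card H\<close> links with at most \<open>l\<close>
  interior vertices each has at most \<open>l * card H\<close> interior vertices. So links can be
  chosen one after another, each avoiding all earlier ones.\<close>

definition abundant ::
    "'v set \<Rightarrow> ('v \<Rightarrow> 'v \<Rightarrow> bool) \<Rightarrow> nat \<Rightarrow> 'v set \<Rightarrow> nat \<Rightarrow> 'v \<Rightarrow> 'v \<Rightarrow> bool" where
  "abundant V E l H j b b' \<longleftrightarrow>
    (\<forall>Z. finite Z \<and> card Z \<le> l * card H \<longrightarrow> (\<exists>p. length p = j \<and> link E (V - H - Z) b p b'))"

lemma link_rev:
  assumes "\<And>x y. E x y \<Longrightarrow> E y x" "link E S b p b'"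
  shows "link E S b' (rev p) b"
proof -
  have "successively E (rev (b # p @ [b']))"
    unfolding successively_rev using assms by (auto simp: link_def intro: successively_mono[of E])
  then show ?thesis using assms(2) by (simp add: link_def)
qed

lemma successively_all:
  assumes "distinct bs" "\<And>b b'. b \<in> set bs \<Longrightarrow> b' \<in> set bs \<Longrightarrow> b \<noteq> b' \<Longrightarrow> P b b'"
  shows "successively P bs"
  using assms by (auto simp: successively_conv_nth nth_eq_iff_index_eq)

text \<open>Every link through \<open>R\<close> between two hubs is robust: it can be rerouted around any small
  set of vertices. This is what allows a cycle to be built from prescribed links, and copies
  of \<open>R\<close> to be added without creating a long cycle.\<close>

locale frame =
  fixes V :: "'v set" and E :: "'v \<Rightarrow> 'v \<Rightarrow> bool" and l :: nat and H R :: "'v set"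
  assumes graph: "graph_on V E" and circ: "circ_le l E" and l2: "l \<ge> 2"
    and HV: "H \<subseteq> V" and RV: "R \<subseteq> V - H" and hub: "\<And>x. x \<in> R \<Longrightarrow> \<exists>b\<in>H. E x b"
    and links: "\<And>b b' p. 1 \<le> length p \<Longrightarrow> length p \<le> l \<Longrightarrow> b \<in> H \<Longrightarrow> b' \<in> H \<Longrightarrow> b \<noteq> b' \<Longrightarrow>
      link E R b p b' \<Longrightarrow> abundant V E l H (length p) b b'"
begin

lemma finH: "finite H" and finR: "finite R"
  using graph HV RV by (auto simp: graph_on_def intro: finite_subset)

lemma sym: "E x y \<Longrightarrow> E y x"
  using graph by (rule graph_on_sym)

abbreviation ab :: "nat \<Rightarrow> 'v \<Rightarrow> 'v \<Rightarrow> bool" where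
  "ab \<equiv> abundant V E l H"

text \<open>An edge between hubs is a link with empty interior, which no set can block; such edges
  need no separate treatment below.\<close>

lemma ab_zero: "E b b' \<Longrightarrow> ab 0 b b'"
  by (simp add: abundant_def link_def)

text \<open>Greedy choice. An entry \<open>(b, j)\<close> of \<open>bj\<close> is a hub together
  with the number of interior vertices of the link leaving it, and the last link leads to
  \<open>e\<close>. \<open>Z\<close> collects the interiors used so far; the last hypothesis keeps
  it within the size that abundance tolerates throughout the recursion.\<close>

lemma realize:
  assumes "bj \<noteq> []" "set (map fst bj) \<subseteq> H" "distinct (map fst bj)"
    "successively (\<lambda>x y. ab (snd x) (fst x) (fst y)) bj" "ab (snd (last bj)) (fst (last bj)) e"
    "finite Z" "card Z + sum_list (map snd bj) \<le> l * card H"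
  shows "\<exists>ws. length ws = sum_list (map (\<lambda>x. Suc (snd x)) bj) \<and> distinct ws \<and> ws \<noteq> [] \<and>
    successively E ws \<and> E (last ws) e \<and> hd ws = fst (hd bj) \<and>
    set ws \<inter> H = set (map fst bj) \<and> set ws \<inter> Z \<subseteq> H"
  using assms
proof (induction bj arbitrary: Z)
  case (Cons x bj)
  obtain b j where x: "x = (b, j)" by (cases x)
  show ?case
  proof (cases "bj = []")
    case True
    obtain p where p: "length p = j" "link E (V - H - Z) b p e"
      using Cons.prems x True by (auto simp: abundant_def)
    have "E (last (b # p)) e"
      using p(2) successively_append_iff[of E "b # p" "[e]"] by (simp add: link_def)
    moreover have "successively E (b # p)"
      using p(2) successively_append_iff[of E "b # p" "[e]"] by (simp add: link_def)
    ultimately show ?thesis using p Cons.prems x True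
      by (intro exI[of _ "b # p"]) (auto simp: link_def)
  next
    case False
    let ?b' = "fst (hd bj)"
    have "ab j b ?b'" using Cons.prems x False by (cases bj) auto
    then obtain p where p: "length p = j" "link E (V - H - Z) b p ?b'"
    proof -
      have "finite Z \<and> card Z \<le> l * card H" using Cons.prems(6,7) by simp
      then show ?thesis using that \<open>ab j b ?b'\<close> unfolding abundant_def by blast
    qed
    have "card (Z \<union> set p) \<le> card Z + j"
      using card_Un_le[of Z "set p"] card_length[of p] p(1) by linarith
    moreover have "successively (\<lambda>x y. ab (snd x) (fst x) (fst y)) bj"
      using Cons.prems(4) by (cases bj) auto
    ultimately obtain ws where ws: "length ws = sum_list (map (\<lambda>x. Suc (snd x)) bj)" "distinct ws"
      "ws \<noteq> []" "successively E ws" "E (last ws) e" "hd ws = ?b'" "set ws \<inter> H = set (map fst bj)"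
      "set ws \<inter> (Z \<union> set p) \<subseteq> H"
      using Cons.IH[of "Z \<union> set p"] Cons.prems False x by auto
    have s1: "successively E ((b # p) @ [?b'])" and dp: "distinct p" "set p \<inter> (H \<union> Z) = {}"
      using p(2) by (auto simp: link_def)
    have "successively E ((b # p) @ ws)"
      using s1 ws(3,4,6) unfolding successively_append_iff by auto
    moreover have "b \<notin> set ws" "b \<in> H" using ws(7) Cons.prems x by auto
    ultimately show ?thesis
      using ws p(1) dp x by (intro exI[of _ "b # p @ ws"]) auto
  qed
qed simp

text \<open>The first hub serves as target of the last link. The hubs are distinct, hence at most
  \<open>card H\<close> in number, which keeps the interiors within the budget of
  \<open>realize\<close>.\<close>

lemma realize_cycle:
  assumes bj: "bj \<noteq> []" "set (map fst bj) \<subseteq> H" "distinct (map fst bj)"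
    "successively (\<lambda>x y. ab (snd x) (fst x) (fst y)) bj"
    "ab (snd (last bj)) (fst (last bj)) (fst (hd bj))"
    and j: "\<forall>x\<in>set bj. snd x \<le> l" and three: "sum_list (map (\<lambda>x. Suc (snd x)) bj) \<ge> 3"
  shows "sum_list (map (\<lambda>x. Suc (snd x)) bj) \<le> l"
proof -
  have "sum_list (map snd bj) \<le> sum_list (map (\<lambda>_. l) bj)"
    using j by (intro sum_list_mono) auto
  also have "\<dots> = l * length bj" by (simp add: sum_list_triv)
  also have "length bj = card (set (map fst bj))" using bj(3) by (metis distinct_card length_map)
  also have "\<dots> \<le> card H" using bj(2) finH by (rule card_mono[rotated])
  finally have "card {} + sum_list (map snd bj) \<le> l * card H" by simp
  from realize[OF bj finite.emptyI this] obtain ws where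
    "length ws = sum_list (map (\<lambda>x. Suc (snd x)) bj)" "distinct ws" "ws \<noteq> []"
    "successively E ws" "E (last ws) (fst (hd bj))" "hd ws = fst (hd bj)"
    by blast
  then have "cycle_list E ws \<and> length ws = sum_list (map (\<lambda>x. Suc (snd x)) bj)"
    using three by (simp add: cycle_list_def)
  then show ?thesis using circ unfolding circ_le_def by metis
qed

lemma realize_const:
  assumes "length bs \<ge> 2" "set bs \<subseteq> H" "distinct bs" "successively (ab j) bs" "ab j (last bs) (hd bs)"
    "1 \<le> j" "j \<le> l"
  shows "length bs * Suc j \<le> l"
proof -
  have ne: "bs \<noteq> []" using assms(1) by auto
  have "2 * 2 \<le> length bs * Suc j" using assms by (intro mult_le_mono) auto
  then have "sum_list (map (\<lambda>x. Suc (snd x)) (map (\<lambda>b. (b, j)) bs)) \<ge> 3"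
    by (simp add: o_def sum_list_triv)
  then have "sum_list (map (\<lambda>x. Suc (snd x)) (map (\<lambda>b. (b, j)) bs)) \<le> l"
    using assms ne
    by (intro realize_cycle) (auto simp: o_def successively_map last_map hd_map)
  then show ?thesis by (simp add: o_def sum_list_triv)
qed

section \<open>Hub neighbourhoods and paths through R\<close>

definition T :: "'v \<Rightarrow> 'v set" where
  "T x = {b \<in> H. E x b}"

lemma finT: "finite (T x)"
  using finH by (simp add: T_def)

text \<open>Although \<open>x\<close> is a single vertex, the link \<open>[x]\<close> makes each
  pair of its hub neighbours abundant, and abundance supplies distinct middle vertices. The star at
  \<open>x\<close> thus turns into a cycle.\<close>

lemma card_T:
  assumes x: "x \<in> R"
  shows "card (T x) \<le> l div 2"
proof (rule ccontr)
  assume "\<not> card (T x) \<le> l div 2"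
  then have "l div 2 + 1 \<le> card (T x)" by simp
  then obtain B where B: "B \<subseteq> T x" "card B = l div 2 + 1" "finite B"
    by (rule obtain_subset_with_card_n)
  obtain bs where bs: "set bs = B" "distinct bs" using finite_distinct_list[OF B(3)] by blast
  have len: "length bs = l div 2 + 1" using bs B distinct_card by fastforce
  have ab1: "ab 1 b b'" if "b \<in> set bs" "b' \<in> set bs" "b \<noteq> b'" for b b'
  proof -
    have "b \<in> H" "b' \<in> H" "E b x" "E x b'" using that B(1) bs sym by (auto simp: T_def)
    then show ?thesis using links[of "[x]" b b'] that(3) x l2 by (simp add: link_def)
  qed
  have "2 \<le> length bs" using len l2 by simp
  moreover have "last bs \<noteq> hd bs" using bs(2) calculation
    by (cases bs) (auto split: if_splits)
  moreover have "bs \<noteq> []" using calculation by auto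
  ultimately have "length bs * Suc 1 \<le> l"
    using successively_all[OF bs(2), of "ab 1"] ab1 B(1) bs l2
    by (intro realize_const) (auto simp: T_def)
  then show False using len by simp
qed

text \<open>If \<open>l\<close> vertices could follow the hub \<open>b\<close>, the last of them
  would have a hub neighbour \<open>c\<close>. For \<open>c = b\<close> this closes a cycle of
  length \<open>l + 1\<close>; otherwise it is a link with \<open>l\<close> interior vertices, and
  going there and back by abundance gives a cycle of length \<open>2 * (l + 1)\<close>.\<close>

lemma short_segment:
  assumes b: "b \<in> H" and p: "successively E (b # p)" "distinct p" "set p \<subseteq> R"
  shows "length p < l"
proof (rule ccontr)
  assume "\<not> length p < l"
  then have le: "l \<le> length p" by simp
  let ?p = "take l p"
  have len: "length ?p = l" "?p \<noteq> []" using le l2 by auto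
  have pR: "set ?p \<subseteq> R" using p(3) set_take_subset by fast
  have dp: "distinct ?p" using p(2) by simp
  have "successively E ((b # ?p) @ drop l p)" using p(1) by simp
  then have su: "successively E (b # ?p)" by (metis successively_append_iff)
  have "last ?p \<in> R" using pR len(2) by (meson last_in_set subsetD)
  then obtain c where c: "c \<in> H" "E (last ?p) c" using hub by blast
  show False
  proof (cases "c = b")
    case True
    have "b \<notin> set ?p" using pR RV b by auto
    then have "cycle_list E (b # ?p)" using su dp len l2 c True by (auto simp: cycle_list_def)
    then have "length (b # ?p) \<le> l" using circ unfolding circ_le_def by blast
    then show False using len by simp
  next
    case False
    have "successively E ((b # ?p) @ [c])"
      using su c(2) len(2) unfolding successively_append_iff by auto
    then have lk: "link E R b ?p c" using dp pR by (simp add: link_def)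
    have "ab l b c" using links[OF _ _ b c(1) _ lk] len l2 False by simp
    moreover have "ab l c b"
      using links[OF _ _ c(1) b _ link_rev[OF sym lk]] len l2 False by simp
    ultimately have "length [b, c] * Suc l \<le> l"
      using b c(1) False l2 by (intro realize_const) auto
    then show False by simp
  qed
qed

lemma alternating_list:
  assumes "finite A" "finite B" "n \<le> card A" "n \<le> card B"
  shows "\<exists>zs. length zs = n \<and> distinct zs \<and> (\<forall>i<n. zs ! i \<in> (if even i then A else B))"
  using assms(3,4)
proof (induction n)
  case (Suc n)
  then obtain zs where zs: "length zs = n" "distinct zs" "\<forall>i<n. zs ! i \<in> (if even i then A else B)"
    by auto
  have "card (set zs) < card (if even n then A else B)" using Suc.prems zs(1) card_length[of zs] by simp
  then obtain z where "z \<in> (if even n then A else B)" "z \<notin> set zs"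
    using assms(1,2) by (metis List.finite_set card_mono leD subsetI)
  then show ?case using zs
    by (intro exI[of _ "zs @ [z]"]) (auto simp: nth_append less_Suc_eq)
qed simp

text \<open>The path links every hub next to its first vertex with every other hub next to its last
  one, in both directions. Alternating between the two neighbourhoods, \<open>2 * g\<close> hubs
  close up to a cycle with \<open>2 * g * (M + 1)\<close> vertices.\<close>

lemma no_long_path:
  assumes p: "successively E p" "distinct p" "set p \<subseteq> R" "length p = M" and M: "1 \<le> M" "M \<le> l"
    and g: "g \<ge> 1" "2 * g * (M + 1) > l"
    and T: "2 * g \<le> card (T (hd p))" "2 * g \<le> card (T (last p))"
  shows False
proof -
  obtain zs where zs: "length zs = 2 * g" "distinct zs"
    "\<forall>i<2 * g. zs ! i \<in> (if even i then T (hd p) else T (last p))"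
    using alternating_list[OF finT finT T] by blast
  have pne: "p \<noteq> []" using p(4) M by auto
  have abM: "ab M b c \<and> ab M c b" if bc: "b \<in> T (hd p)" "c \<in> T (last p)" "b \<noteq> c" for b c
  proof -
    have H: "b \<in> H" "c \<in> H" and e: "E b (hd p)" "E (last p) c" using bc sym by (auto simp: T_def)
    have "successively E ((b # p) @ [c])"
      using p(1) e pne unfolding successively_append_iff by (auto simp: successively_Cons)
    then have lk: "link E R b p c" using p by (simp add: link_def)
    show ?thesis
      using links[OF _ _ H bc(3) lk] links[OF _ _ H(2,1) bc(3)[symmetric] link_rev[OF sym lk]] p(4) M
      by simp
  qed
  have zH: "zs ! i \<in> H" if "i < 2 * g" for i using zs(3) that by (auto simp: T_def split: if_splits)
  have "successively (ab M) zs"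
    unfolding successively_conv_nth
  proof (intro allI impI)
    fix i assume i: "Suc i < length zs"
    have "zs ! i \<noteq> zs ! Suc i" using zs(2) i by (simp add: nth_eq_iff_index_eq)
    then show "ab M (zs ! i) (zs ! Suc i)"
      using abM zs(3)[rule_format, of i] zs(3)[rule_format, of "Suc i"] i zs(1) by (cases "even i") auto
  qed
  moreover have "ab M (last zs) (hd zs)"
  proof -
    have ne: "zs \<noteq> []" using zs(1) g by auto
    have "zs ! (2 * g - 1) \<in> T (last p)" "zs ! 0 \<in> T (hd p)"
      using zs(3)[rule_format, of "2 * g - 1"] zs(3)[rule_format, of 0] g by auto
    moreover have "zs ! 0 \<noteq> zs ! (2 * g - 1)" using zs g by (simp add: nth_eq_iff_index_eq)
    ultimately show ?thesis using abM ne zs(1) by (simp add: last_conv_nth hd_conv_nth)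
  qed
  moreover have "set zs \<subseteq> H" using zH zs(1) by (auto simp: in_set_conv_nth)
  ultimately have "length zs * Suc M \<le> l"
    using zs g M by (intro realize_const) auto
  then show False using zs(1) g by simp
qed

text \<open>Since \<open>M\<close> exceeds \<open>l / (2 * g)\<close>, no path on \<open>M\<close>
  vertices runs through \<open>R'\<close>, so \<open>R'\<close> is \<open>M\<close>-degenerate.
  Compared with the general bound \<open>2 * l * card V\<close>, roughly a factor
  \<open>2 * g\<close> is gained.\<close>

lemma card_rich_edges:
  assumes g: "g \<ge> 1"
  defines "R' \<equiv> {x \<in> R. 2 * g \<le> card (T x)}" and "M \<equiv> l div (2 * g) + 1"
  shows "card {(x, y). x \<in> R' \<and> y \<in> R' \<and> E x y} \<le> 2 * M * card V"
proof -
  have M: "1 \<le> M" "M \<le> l"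
  proof -
    have "l div (2 * g) \<le> l div 2" using g by (intro div_le_mono2) auto
    then show "1 \<le> M" "M \<le> l" using l2 by (auto simp: M_def)
  qed
  have gM: "2 * g * (M + 1) > l"
  proof -
    have "l < 2 * g * (l div (2 * g)) + 2 * g" using g
      by (metis add.commute add_less_cancel_left div_mult_mod_eq mod_less_divisor mult.commute
          mult_pos_pos not_one_le_zero of_nat_0_less_iff zero_less_numeral zero_less_iff_neq_zero)
    then show ?thesis by (simp add: M_def algebra_simps)
  qed
  have R'V: "finite R'" "R' \<subseteq> V" using finR RV by (auto simp: R'_def)
  have "card {(x, y). x \<in> R' \<and> y \<in> R' \<and> E x y} \<le> 2 * M * card R'"
  proof (rule card_edges_le)
    fix U assume U: "U \<subseteq> R'" "U \<noteq> {}"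
    have finU: "finite U" using U R'V finite_subset by blast
    obtain p where p: "p \<noteq> []" "distinct p" "set p \<subseteq> U" "successively E p"
      "\<forall>w\<in>U. E w (hd p) \<longrightarrow> w \<in> set p"
      using maximal_path[OF finU U(2), of E] by blast
    have "length p < M"
    proof (rule ccontr)
      assume "\<not> length p < M"
      then have len: "length (take M p) = M" "take M p \<noteq> []" using M by auto
      have "set (take M p) \<subseteq> U" using p(3) set_take_subset by fast
      then have inR': "set (take M p) \<subseteq> R'" using U by blast
      have "hd (take M p) \<in> R'" "last (take M p) \<in> R'"
        using inR' len(2) by (meson hd_in_set last_in_set subsetD)+
      moreover have "successively E (take M p)"
        using p(4) by (metis append_take_drop_id successively_append_iff)
      moreover have "distinct (take M p)" using p(2) by simp
      moreover have "set (take M p) \<subseteq> R" using inR' by (auto simp: R'_def)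
      ultimately show False
        using no_long_path[of "take M p" M g] len M g gM by (auto simp: R'_def)
    qed
    moreover have "card {w\<in>U. E (hd p) w} \<le> card (set p)"
      using p(5) sym by (intro card_mono) auto
    moreover have "card (set p) \<le> length p" by (rule card_length)
    ultimately show "\<exists>v\<in>U. card {w\<in>U. E v w} \<le> M"
      using p(1,3) by (intro bexI[of _ "hd p"]) auto
  qed (use R'V graph in \<open>auto simp: graph_on_def\<close>)
  also have "\<dots> \<le> 2 * M * card V"
    using R'V graph by (intro mult_le_mono2 card_mono) (auto simp: graph_on_def)
  finally show ?thesis .
qed

subsection \<open>Gluing copies of the non-hub part along the hubs\<close>

definition glueV :: "nat \<Rightarrow> ('v \<times> nat) set" where
  "glueV q = (\<lambda>v. (v, 0)) ` H \<union> R \<times> {..<q}"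

definition glueE :: "nat \<Rightarrow> 'v \<times> nat \<Rightarrow> 'v \<times> nat \<Rightarrow> bool" where
  "glueE q x y \<longleftrightarrow> x \<in> glueV q \<and> y \<in> glueV q \<and> E (fst x) (fst y) \<and>
    (fst x \<in> H \<or> fst y \<in> H \<or> snd x = snd y)"

lemma glue_graph: "graph_on (glueV q) (glueE q)"
  using finH finR sym graph_onD[OF graph] by (auto simp: graph_on_def glueV_def glueE_def)

lemma glue_hub: "x \<in> glueV q \<Longrightarrow> fst x \<in> H \<Longrightarrow> snd x = 0"
  using RV by (auto simp: glueV_def)

lemma glue_nonhub: "x \<in> glueV q \<Longrightarrow> fst x \<notin> H \<Longrightarrow> fst x \<in> R"
  by (auto simp: glueV_def)

lemma card_glueV: "card (glueV q) \<le> card H + q * card R"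
proof -
  have "card (glueV q) \<le> card ((\<lambda>v. (v, 0 :: nat)) ` H) + card (R \<times> {..<q})"
    unfolding glueV_def by (rule card_Un_le)
  also have "\<dots> \<le> card H + q * card R"
    using card_image_le[OF finH, of "\<lambda>v. (v, 0 :: nat)"] by (simp add: card_cartesian_product mult.commute)
  finally show ?thesis .
qed

lemma glue_path_fst: "successively (glueE q) ws \<Longrightarrow> successively E (map fst ws)"
  unfolding successively_map by (erule successively_mono) (simp add: glueE_def)

lemma glue_path_vertices: "successively (glueE q) ws \<Longrightarrow> length ws \<ge> 2 \<Longrightarrow> set ws \<subseteq> glueV q"
proof (induction ws)
  case (Cons x ws)
  then obtain y ys where ws: "ws = y # ys" by (cases ws) auto
  then have "glueE q x y" using Cons.prems(1) by simp
  then show ?case using Cons ws by (cases ys) (auto simp: glueE_def)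
qed simp

lemma glue_path_copy:
  assumes "successively (glueE q) ws" "\<forall>x\<in>set ws. fst x \<notin> H"
  shows "\<forall>x\<in>set ws. snd x = snd (hd ws)"
  using assms
proof (induction ws)
  case (Cons x ws)
  show ?case
  proof (cases ws)
    case (Cons y ys)
    then have "snd x = snd y" using Cons.prems by (auto simp: glueE_def)
    then show ?thesis using Cons.IH Cons.prems Cons by auto
  qed simp
qed simp

text \<open>Between consecutive hubs a path stays in one copy, so forgetting the tags keeps it a
  path and makes it a link through \<open>R\<close>. The length bound that abundance requires comes
  from \<open>short_segment\<close>.\<close>

lemma glue_segment:
  assumes b: "b \<in> H" "t \<in> H" "b \<noteq> t"
    and p: "\<forall>x\<in>set p. fst x \<notin> H" "distinct p" "successively (glueE q) ((b, 0) # p @ [(t, 0)])"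
  shows "length p \<le> l \<and> ab (length p) b t"
proof (cases "p = []")
  case True
  then show ?thesis using p(3) ab_zero by (simp add: glueE_def)
next
  case False
  have s1: "successively (glueE q) p" using p(3) False
    by (metis successively_append_iff append_Cons append_Nil)
  have "set p \<subseteq> glueV q" using glue_path_vertices[OF p(3)] by simp
  have pR: "set (map fst p) \<subseteq> R"
  proof
    fix y assume "y \<in> set (map fst p)"
    then obtain x where x: "x \<in> set p" "y = fst x" by auto
    then show "y \<in> R" using \<open>set p \<subseteq> glueV q\<close> p(1) glue_nonhub by blast
  qed
  have dp: "distinct (map fst p)"
    using glue_path_copy[OF s1 p(1)] p(2) by (auto simp: distinct_map inj_on_def prod_eq_iff)
  have su: "successively E ((b # map fst p) @ [t])" using glue_path_fst[OF p(3)] by simp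
  then have "successively E (b # map fst p)" by (metis successively_append_iff)
  then have "length (map fst p) < l" using short_segment[OF b(1) _ dp pR] by blast
  moreover have "link E R b (map fst p) t" using su dp pR by (simp add: link_def)
  ultimately show ?thesis using links[OF _ _ b, of "map fst p"] False by (simp add: Suc_le_eq)
qed

text \<open>The cycle is cut in front of each hub; an entry of \<open>bj\<close> is a hub with the
  number of vertices before the next hub. The cycle is presented as a path from a hub plus a closing
  edge to \<open>(e, 0)\<close>, so that the recursion can drop the first segment. The last
  hypothesis makes the closing link join two different hubs.\<close>

lemma glue_decompose:
  assumes "ws \<noteq> []" "successively (glueE q) ws" "distinct ws" "hd ws \<in> glueV q" "fst (hd ws) \<in> H"
    "e \<in> H" "glueE q (last ws) (e, 0)" "fst (last (filter (\<lambda>x. fst x \<in> H) ws)) \<noteq> e"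
  shows "\<exists>bj. bj \<noteq> [] \<and> sum_list (map (\<lambda>x. Suc (snd x)) bj) = length ws \<and>
    map fst bj = map fst (filter (\<lambda>x. fst x \<in> H) ws) \<and>
    successively (\<lambda>x y. ab (snd x) (fst x) (fst y)) bj \<and> ab (snd (last bj)) (fst (last bj)) e \<and>
    (\<forall>x\<in>set bj. snd x \<le> l)"
  using assms
proof (induction "length ws" arbitrary: ws rule: less_induct)
  case less
  obtain w rest where ws: "ws = w # rest" using less.prems(1) by (cases ws) auto
  obtain b where w: "w = (b, 0)" "b \<in> H"
    using less.prems(4,5) glue_hub[of w q] ws by (cases w) auto
  define p where "p = takeWhile (\<lambda>x. fst x \<notin> H) rest"
  define ws2 where "ws2 = dropWhile (\<lambda>x. fst x \<notin> H) rest"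
  have rest: "rest = p @ ws2" by (simp add: p_def ws2_def)
  have pH: "\<forall>x\<in>set p. fst x \<notin> H" by (auto simp: p_def dest: set_takeWhileD)
  have fp: "filter (\<lambda>x. fst x \<in> H) p = []" using pH by (simp add: filter_empty_conv)
  have dp: "distinct p" using less.prems(3) ws rest by simp
  show ?case
  proof (cases "ws2 = []")
    case True
    have "b \<noteq> e" using less.prems(8) ws rest True fp w by simp
    moreover have "successively (glueE q) ((w # p) @ [(e, 0)])"
      using less.prems(2,7) ws rest True unfolding successively_append_iff by auto
    ultimately have "length p \<le> l \<and> ab (length p) b e"
      using glue_segment[OF w(2) less.prems(6) _ pH dp] w by simp
    then show ?thesis using ws rest True fp w by (intro exI[of _ "[(b, length p)]"]) auto
  next
    case False
    then have hd2: "fst (hd ws2) \<in> H" unfolding ws2_def by (rule hd_dropWhile[THEN notnotD])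
    have su: "successively (glueE q) ((w # p) @ ws2)" using less.prems(2) ws rest by simp
    then have su2: "successively (glueE q) ws2" and la: "glueE q (last (w # p)) (hd ws2)"
      and su1: "successively (glueE q) (w # p)"
      using False unfolding successively_append_iff by auto
    have in2: "hd ws2 \<in> glueV q" using la by (simp add: glueE_def)
    obtain t where t: "hd ws2 = (t, 0)" "t \<in> H"
      using glue_hub[OF in2 hd2] hd2 by (cases "hd ws2") auto
    have "w \<noteq> hd ws2" using less.prems(3) ws rest False by auto
    then have "b \<noteq> t" using w t by auto
    moreover have "successively (glueE q) ((w # p) @ [(t, 0)])"
      using su1 la t unfolding successively_append_iff by auto
    ultimately have seg: "length p \<le> l \<and> ab (length p) b t"
      using glue_segment[OF w(2) t(2) _ pH dp] w by simp
    have f2: "filter (\<lambda>x. fst x \<in> H) ws2 \<noteq> []"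
      using False hd2 by (cases ws2) auto
    then have "fst (last (filter (\<lambda>x. fst x \<in> H) ws2)) \<noteq> e"
      using less.prems(8) ws rest fp by (simp split: if_splits)
    moreover have "length ws2 < length ws" using ws rest by simp
    moreover have "distinct ws2" using less.prems(3) ws rest by simp
    moreover have "glueE q (last ws2) (e, 0)" using less.prems(7) ws rest False by simp
    ultimately obtain bj where bj: "bj \<noteq> []" "sum_list (map (\<lambda>x. Suc (snd x)) bj) = length ws2"
      "map fst bj = map fst (filter (\<lambda>x. fst x \<in> H) ws2)"
      "successively (\<lambda>x y. ab (snd x) (fst x) (fst y)) bj" "ab (snd (last bj)) (fst (last bj)) e"
      "\<forall>x\<in>set bj. snd x \<le> l"
      using less.hyps[of ws2] False su2 in2 hd2 less.prems(6) by blast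
    have "fst (hd bj) = t"
    proof -
      have "fst (hd bj) = hd (map fst bj)" using bj(1) by (simp add: hd_map)
      also have "\<dots> = fst (hd (filter (\<lambda>x. fst x \<in> H) ws2))" using bj(3) f2 by (simp add: hd_map)
      also have "\<dots> = t" using False hd2 t by (cases ws2) auto
      finally show ?thesis .
    qed
    then have "successively (\<lambda>x y. ab (snd x) (fst x) (fst y)) ((b, length p) # bj)"
      using bj(1,4) seg by (simp add: successively_Cons)
    then show ?thesis using bj seg ws rest fp w by (intro exI[of _ "(b, length p) # bj"]) auto
  qed
qed

text \<open>With no hub after its head, the cycle stays in one copy; dropping the tags is injective
  on it and gives a cycle of the original graph.\<close>

lemma glue_cycle_one_hub:
  assumes ws: "cycle_list (glueE q) ws" and tl: "\<forall>x\<in>set (tl ws). fst x \<notin> H"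
  shows "length ws \<le> l"
proof -
  have len: "length ws \<ge> 3" and d: "distinct ws" and su: "successively (glueE q) ws"
    and la: "glueE q (last ws) (hd ws)" using ws by (auto simp: cycle_list_def)
  obtain w rest where w: "ws = w # rest" using len by (cases ws) auto
  have "inj_on fst (set ws)"
  proof (cases "fst w \<in> H")
    case True
    have "successively (glueE q) rest" using su w by (cases rest) auto
    then have "\<forall>x\<in>set rest. snd x = snd (hd rest)" using glue_path_copy tl w by simp
    moreover have "\<forall>x\<in>set rest. fst x \<noteq> fst w" using tl w True by auto
    ultimately show ?thesis by (auto simp: inj_on_def w prod_eq_iff)
  next
    case False
    then have "\<forall>x\<in>set ws. snd x = snd (hd ws)" using glue_path_copy[OF su] tl w by simp
    then show ?thesis by (auto simp: inj_on_def prod_eq_iff)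
  qed
  then have "distinct (map fst ws)" using d by (simp add: distinct_map)
  moreover have "successively E (map fst ws)" using glue_path_fst[OF su] .
  moreover have "E (last (map fst ws)) (hd (map fst ws))"
    using la len last_map[of ws fst] hd_map[of ws fst] by (cases "ws = []") (auto simp: glueE_def)
  ultimately have "cycle_list E (map fst ws)" using len by (simp add: cycle_list_def)
  then show ?thesis using circ unfolding circ_le_def by (metis length_map)
qed

text \<open>A glued cycle may visit several copies, and then its projection can repeat vertices of
  \<open>R\<close>. Only the hubs and the link lengths are kept; \<open>realize_cycle\<close>
  rebuilds from them a cycle of the same length in the original graph.\<close>

lemma glue_circ: "circ_le l (glueE q)"
  unfolding circ_le_def
proof (intro allI impI)
  fix ws assume ws: "cycle_list (glueE q) ws"
  show "length ws \<le> l"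
  proof (cases "\<exists>x\<in>set ws. fst x \<in> H")
    case False
    then show ?thesis using glue_cycle_one_hub[OF ws] by (cases ws) auto
  next
    case True
    then obtain h where h: "h \<in> set ws" "fst h \<in> H" by blast
    then obtain us vs where "ws = us @ h # vs" by (meson split_list)
    define zs where "zs = h # vs @ us"
    have zs: "cycle_list (glueE q) zs" and len: "length zs = length ws"
      using cycle_list_rotate ws by (auto simp: zs_def \<open>ws = us @ h # vs\<close>)
    show ?thesis
    proof (cases "\<forall>x\<in>set (tl zs). fst x \<notin> H")
      case True
      then show ?thesis using glue_cycle_one_hub[OF zs] len by simp
    next
      case False
      have z: "distinct zs" "successively (glueE q) zs" "glueE q (last zs) (hd zs)" "length zs \<ge> 3"
        using zs by (auto simp: cycle_list_def)
      have hV: "h \<in> glueV q" using z(3) by (simp add: zs_def glueE_def)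
      then have h0: "h = (fst h, 0)" using glue_hub h(2) by (metis prod.collapse)
      let ?F = "filter (\<lambda>x. fst x \<in> H) zs"
      have F: "?F = h # filter (\<lambda>x. fst x \<in> H) (vs @ us)" using h by (simp add: zs_def)
      have zsV: "\<forall>x\<in>set zs. x \<in> glueV q" using glue_path_vertices[OF z(2)] z(4) by auto
      have ne: "filter (\<lambda>x. fst x \<in> H) (vs @ us) \<noteq> []"
        using False by (auto simp: zs_def filter_empty_conv)
      then have "last ?F \<in> set (filter (\<lambda>x. fst x \<in> H) (vs @ us))" 
        unfolding F using last_in_set[OF ne] by (simp del: filter_append)
      then have lF: "last ?F \<in> set (vs @ us)" "fst (last ?F) \<in> H" unfolding set_filter by blast+
      have "h \<notin> set (vs @ us)" "set (vs @ us) \<subseteq> glueV q" using z(1) zsV by (auto simp: zs_def)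
      then have "last ?F \<noteq> h" "last ?F \<in> glueV q" using lF(1) by blast+
      then have nh: "fst (last ?F) \<noteq> fst h" using lF glue_hub h(2) hV by (metis prod.expand)
      have hd: "hd zs = h" "zs \<noteq> []" by (auto simp: zs_def)
      have ge: "glueE q (last zs) (fst h, 0)" using z(3) hd h0 by metis
      have h1: "hd zs \<in> glueV q" "fst (hd zs) \<in> H" using hd(1) hV h(2) by auto
      obtain bj where bj: "bj \<noteq> []" "sum_list (map (\<lambda>x. Suc (snd x)) bj) = length zs"
        "map fst bj = map fst ?F" "successively (\<lambda>x y. ab (snd x) (fst x) (fst y)) bj"
        "ab (snd (last bj)) (fst (last bj)) (fst h)" "\<forall>x\<in>set bj. snd x \<le> l"
        using glue_decompose[OF hd(2) z(2,1) h1 h(2) ge nh] by blast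
      have "inj_on fst (set ?F)"
        using zsV glue_hub[of _ q] by (intro inj_onI) (simp add: prod_eq_iff)
      then have "distinct (map fst bj)" using z(1) bj(3) by (simp add: distinct_map)
      moreover have "set (map fst bj) \<subseteq> H" using bj(3) by auto
      moreover have "fst (hd bj) = fst h"
        using bj(1,3) F by (cases bj) auto
      ultimately show ?thesis using realize_cycle[of bj] bj z(4) len by simp
    qed
  qed
qed

end

section \<open>Cycles with the maximal number of runs in R\<close>

text \<open>The counted positions are the starts of runs in \<open>R\<close>. For disjoint
  \<open>H\<close> and \<open>R\<close> no two of them are adjacent, so \<open>m div 2\<close> is
  the largest possible number.\<close>

definition good_cycles :: "('v \<Rightarrow> 'v \<Rightarrow> bool) \<Rightarrow> 'v set \<Rightarrow> 'v set \<Rightarrow> nat \<Rightarrow> (int \<Rightarrow> 'v) set" where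
  "good_cycles E H R m = {c \<in> cyc m E. range c \<subseteq> H \<union> R \<and>
     m div 2 \<le> card {i \<in> {0..<int m}. c (i - 1) \<in> H \<and> c i \<in> R}}"

context frame
begin

lemma HR_disjoint: "x \<in> R \<Longrightarrow> x \<notin> H"
  using RV by blast

lemma start_periodic:
  assumes "c \<in> cyc m E"
  shows "\<forall>i. (c (i + int m - 1) \<in> H \<and> c (i + int m) \<in> R) = (c (i - 1) \<in> H \<and> c i \<in> R)"
proof
  fix i
  have "c (i - 1 + int m) = c (i - 1)" "c (i + int m) = c i" using assms by (simp_all add: cyc_def)
  then show "(c (i + int m - 1) \<in> H \<and> c (i + int m) \<in> R) = (c (i - 1) \<in> H \<and> c i \<in> R)"
    by (simp add: algebra_simps)
qed

lemma start_sparse: "\<forall>i :: int. \<not> ((c (i - 1) \<in> H \<and> c i \<in> R) \<and> (c (i + 1 - 1) \<in> H \<and> c (i + 1) \<in> R))"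
  using HR_disjoint by auto

text \<open>Otherwise none of \<open>i\<close>, \<open>i + 1\<close>, \<open>i + 2\<close> would
  start a run, which makes two gaps where at most one is possible. A run therefore has at most two
  vertices.\<close>

lemma good_no_three:
  assumes c: "c \<in> good_cycles E H R m" and m: "m \<ge> 3" and R: "c i \<in> R" "c (i + 1) \<in> R"
  shows "c (i - 1) \<in> H"
proof (rule ccontr)
  assume n: "c (i - 1) \<notin> H"
  have cc: "c \<in> cyc m E" and k: "m div 2 \<le> card {i \<in> {0..<int m}. c (i - 1) \<in> H \<and> c i \<in> R}"
    using c by (auto simp: good_cycles_def)
  have h: "c i \<notin> H" "c (i + 1) \<notin> H" using R HR_disjoint by auto
  have "i mod int m = (i + 1) mod int m"
    by (rule sparse_gap_unique(1)[OF start_periodic[OF cc] start_sparse k]) (use n h m in \<open>auto simp: add.commute\<close>)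
  then have "(i - i) mod int m = (i + 1 - i) mod int m" by (metis mod_diff_left_eq)
  then show False using m by simp
qed

text \<open>Each run of a good cycle can be moved to any of the \<open>q\<close> copies,
  independently of the other runs, and different choices give different cycles.\<close>

lemma glue_count:
  assumes m: "m \<ge> 3" and q: "q \<ge> 1"
  shows "q ^ (m div 2) * card (good_cycles E H R m) \<le> card (cyc m (glueE q))"
proof -
  define S where "S c = {i \<in> {0..<int m}. c (i - 1) \<in> H \<and> c i \<in> R}" for c :: "int \<Rightarrow> 'v"
  \<comment> \<open>A vertex of \<open>R\<close> gets the tag chosen for the start of its run; by
    \<open>good_no_three\<close> this start is \<open>i\<close> or \<open>i - 1\<close>.\<close>
  define lift where "lift c g i = (c i, if c i \<in> H then 0 else if c (i - 1) \<in> H then g (i mod int m)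
    else g ((i - 1) mod int m))" for c :: "int \<Rightarrow> 'v" and g :: "int \<Rightarrow> nat" and i
  let ?G = "good_cycles E H R m" and ?P = "\<lambda>c. PiE (S c) (\<lambda>_. {..<q})"
  have finS: "finite (S c)" for c by (auto simp: S_def intro: finite_subset[of _ "{0..<int m}"])
  have m0: "m > 0" using m by simp
  have finG: "finite ?G"
    using finite_cyc[OF graph m0] by (rule finite_subset[rotated]) (auto simp: good_cycles_def)
  have lift_in: "lift c g \<in> cyc m (glueE q)" if c: "c \<in> ?G" and g: "g \<in> ?P c" for c g
  proof -
    have cc: "c \<in> cyc m E" and ran: "c i \<in> H \<union> R" for i using c by (auto simp: good_cycles_def)
    have mem: "i mod int m \<in> S c" if "c (i - 1) \<in> H" "c i \<in> R" for i
    proof -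
      have "c (i mod int m - 1) = c (i - 1)"
        using cyc_eq_iff[OF cc m0, of "i mod int m - 1" "i - 1"] by (simp add: mod_diff_left_eq)
      then show ?thesis using that cyc_mod[OF cc] m0 by (simp add: S_def)
    qed
    have gq: "g i < q" if "i \<in> S c" for i using g that by auto
    have per: "lift c g (i + int m) = lift c g i" for i
    proof -
      have "c (i + int m) = c i" "c (i - 1 + int m) = c (i - 1)" using cc by (simp_all add: cyc_def)
      moreover have "i + int m - 1 = i - 1 + int m" by simp
      ultimately show ?thesis by (simp only: lift_def mod_add_self2)
    qed
    have inV: "lift c g i \<in> glueV q" for i
    proof (cases "c i \<in> H")
      case True
      then show ?thesis by (simp add: lift_def glueV_def)
    next
      case False
      then have iR: "c i \<in> R" using ran by blast
      show ?thesis
      proof (cases "c (i - 1) \<in> H")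
        case True
        then show ?thesis using gq[OF mem[OF True iR]] False iR by (simp add: lift_def glueV_def)
      next
        case F2: False
        then have i1: "c (i - 1) \<in> R" using ran by blast
        then have "c (i - 1 - 1) \<in> H" using good_no_three[OF c m, of "i - 1"] iR by simp
        then show ?thesis using gq[OF mem[OF _ i1]] False F2 iR by (simp add: lift_def glueV_def)
      qed
    qed
    have adj: "glueE q (lift c g i) (lift c g (i + 1))" for i
    proof -
      have "snd (lift c g i) = snd (lift c g (i + 1))" if h: "c i \<notin> H" "c (i + 1) \<notin> H"
      proof -
        have "c i \<in> R" "c (i + 1) \<in> R" using h ran by blast+
        then have "c (i - 1) \<in> H" by (rule good_no_three[OF c m])
        then show ?thesis using h by (simp add: lift_def)
      qed
      then show ?thesis using inV cyc_adj[OF cc] by (auto simp: glueE_def lift_def)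
    qed
    have "inj_on (lift c g) {0..<int m}"
      using cc by (auto simp: cyc_def lift_def inj_on_def)
    then show ?thesis using per adj by (simp add: cyc_def)
  qed
  have "inj_on (\<lambda>(c, g). lift c g) (SIGMA c:?G. ?P c)"
  proof (rule inj_onI, clarify)
    fix c g c' g'
    assume c: "c \<in> ?G" "c' \<in> ?G" and g: "g \<in> ?P c" "g' \<in> ?P c'" and eq: "lift c g = lift c' g'"
    have "c i = c' i" for i using fun_cong[OF eq, of i] by (simp add: lift_def)
    then have cc: "c = c'" by blast
    have "g i = g' i" if i: "i \<in> S c" for i
    proof -
      have "c (i - 1) \<in> H" "c i \<notin> H" "i mod int m = i" using i HR_disjoint by (auto simp: S_def)
      then show ?thesis using fun_cong[OF eq, of i] cc by (simp add: lift_def)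
    qed
    then have "g = g'" using g cc by (metis PiE_ext)
    then show "c = c' \<and> g = g'" using cc by simp
  qed
  moreover have "(\<lambda>(c, g). lift c g) ` (SIGMA c:?G. ?P c) \<subseteq> cyc m (glueE q)"
    using lift_in by auto
  moreover have "finite (cyc m (glueE q))" using finite_cyc[OF glue_graph m0] .
  ultimately have "card (SIGMA c:?G. ?P c) \<le> card (cyc m (glueE q))" by (rule card_inj_on_le)
  moreover have "card (SIGMA c:?G. ?P c) = (\<Sum>c\<in>?G. q ^ card (S c))"
    using finG finS by (subst card_SigmaI) (auto simp: card_PiE intro!: finite_PiE)
  moreover have "(\<Sum>c\<in>?G. q ^ (m div 2)) \<le> (\<Sum>c\<in>?G. q ^ card (S c))"
    using q by (intro sum_mono power_increasing) (auto simp: good_cycles_def S_def)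
  ultimately show ?thesis by (simp add: mult.commute)
qed

subsection \<open>Upper bounds for the number of good cycles\<close>

text \<open>Run starts are pinned to the first even positions. For even m this settles the type of
  every position. For odd m with \<open>k = m div 2\<close>, position \<open>2 * k\<close> is
  congruent to -1 and hence a hub, and only position \<open>2 * k - 1\<close> remains open.\<close>

definition canonical :: "nat \<Rightarrow> (int \<Rightarrow> 'v) set" where
  "canonical m = {c \<in> cyc m E. range c \<subseteq> H \<union> R \<and>
     (\<forall>j. int j < int (m div 2) \<longrightarrow> c (2 * int j - 1) \<in> H \<and> c (2 * int j) \<in> R)}"

lemma finite_canonical: "m > 0 \<Longrightarrow> finite (canonical m)"
  using finite_cyc[OF graph] by (rule finite_subset[rotated]) (auto simp: canonical_def)

lemma card_good_le:
  assumes m: "m \<ge> 3"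
  shows "card (good_cycles E H R m) \<le> (if even m then 2 else m) * card (canonical m)"
proof -
  define \<rho> where "\<rho> = (if even m then 2 else m)"
  have m0: "m > 0" using m by simp
  have "good_cycles E H R m \<subseteq> (\<Union>r\<in>{0..<int \<rho>}. (\<lambda>c i. c (i - r)) ` canonical m)"
  proof
    fix c assume c: "c \<in> good_cycles E H R m"
    then have cc: "c \<in> cyc m E" and ran: "range c \<subseteq> H \<union> R"
      and k: "m div 2 \<le> card {i \<in> {0..<int m}. c (i - 1) \<in> H \<and> c i \<in> R}"
      by (auto simp: good_cycles_def)
    obtain r where r: "r \<in> {0..<(if even m then 2 else int m)}"
      "\<forall>j. int j < int (m div 2) \<longrightarrow> c (r + 2 * int j - 1) \<in> H \<and> c (r + 2 * int j) \<in> R"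
      using sparse_canonical[OF start_periodic[OF cc] start_sparse k m] by blast
    have "(\<lambda>i. c (i + r)) \<in> canonical m"
      using cyc_shift[OF cc m0, of r] ran r(2) by (auto simp: canonical_def algebra_simps)
    then have "(\<lambda>c i. c (i - r)) (\<lambda>i. c (i + r)) \<in> (\<lambda>c i. c (i - r)) ` canonical m" by (rule imageI)
    then have "c \<in> (\<lambda>c i. c (i - r)) ` canonical m" by simp
    moreover have "r \<in> {0..<int \<rho>}" using r(1) by (simp add: \<rho>_def split: if_splits)
    ultimately show "c \<in> (\<Union>r\<in>{0..<int \<rho>}. (\<lambda>c i. c (i - r)) ` canonical m)" by (rule UN_I[rotated])
  qed
  then have "card (good_cycles E H R m) \<le> card (\<Union>r\<in>{0..<int \<rho>}. (\<lambda>c i. c (i - r)) ` canonical m)"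
    using finite_canonical[OF m0] by (intro card_mono) auto
  also have "\<dots> \<le> (\<Sum>r\<in>{0..<int \<rho>}. card ((\<lambda>c i. c (i - r)) ` canonical m))"
    by (rule card_UN_le) simp
  also have "\<dots> \<le> (\<Sum>r\<in>{0..<int \<rho>}. card (canonical m))"
    using finite_canonical[OF m0] by (intro sum_mono card_image_le)
  finally show ?thesis by (simp add: \<rho>_def)
qed

end

lemma prod_parity: "(\<Prod>i\<in>{0..<int (2 * k)}. if even i then a else b) = (a * b :: nat) ^ k"
proof (induction k)
  case (Suc k)
  have "{0..<int (2 * Suc k)} = insert (2 * int k + 1) (insert (2 * int k) {0..<int (2 * k)})" by auto
  then show ?case using Suc by (simp add: mult.assoc mult.left_commute)
qed simp

context frame
begin

lemma finV: "finite V" and R_in_V: "x \<in> R \<Longrightarrow> x \<in> V"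
  using graph RV by (auto simp: graph_on_def)

lemma canonical_adj:
  assumes "c \<in> canonical m"
  shows "E (c i) (c (i + 1))" "E (c (i + 1)) (c i)"
  using assms sym[of "c i" "c (i + 1)"] cyc_adj[of c m E i] by (auto simp: canonical_def)

lemma canonical_in_V: "c \<in> canonical m \<Longrightarrow> c i \<in> V"
  using cyc_in_V[OF graph, of c m i] by (simp add: canonical_def)

text \<open>Vertices at even positions are chosen freely; each is followed by a hub from its hub
  neighbourhood, which \<open>card_T\<close> bounds.\<close>

lemma card_canonical_even:
  assumes m: "m = 2 * k" and k: "k \<ge> 1"
  shows "card (canonical m) \<le> (card V * (l div 2)) ^ k"
proof -
  let ?d = "\<lambda>i :: int. if even i then card V else l div 2"
  have "card (canonical m) \<le> (\<Prod>i\<in>{0..<int m}. ?d i)"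
  proof (rule det_count[where A = "{i. even i}" and Y = "\<lambda>_. V" and p = "\<lambda>i. i - 1" and N = "\<lambda>_. T"])
    fix c c' assume "c \<in> canonical m" "c' \<in> canonical m" "\<forall>i\<in>{0..<int m}. c i = c' i"
    then show "c = c'" using cyc_ext[of c m E c'] m k by (simp add: canonical_def)
  next
    fix c i assume "c \<in> canonical m"
    then show "c i \<in> V" using canonical_in_V[of c m i] by auto
  next
    fix c i assume c: "c \<in> canonical m" and i: "i \<in> {0..<int m} - {i. even i}"
    then obtain j' where "i = 2 * j' + 1" by (auto elim: oddE)
    then obtain j where j: "i = 2 * int j + 1" "j < k" using i m
      by (intro that[of "nat j'"]) auto
    have R: "c (i - 1) \<in> R" using c j m by (simp add: canonical_def)
    have "c i \<in> H"
    proof (cases "Suc j < k")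
      case True
      then have "c (2 * int (Suc j) - 1) \<in> H" using c m unfolding canonical_def by auto
      then show ?thesis using j by (simp add: algebra_simps)
    next
      case False
      \<comment> \<open>The last position precedes position 0 cyclically, where the canonical form
        requires a hub.\<close>
      then have "i = -1 + int m" using j m by auto
      moreover have "c (-1 + int m) = c (-1)" using c by (simp only: canonical_def cyc_def mem_Collect_eq)
      moreover have "c (2 * int 0 - 1) \<in> H" using c k m unfolding canonical_def by auto
      ultimately show ?thesis by simp
    qed
    then show "c i \<in> T (c (i - 1)) \<and> finite (T (c (i - 1))) \<and> card (T (c (i - 1))) \<le> ?d i"
      using canonical_adj(1)[OF c, of "i - 1"] finT card_T[OF R] i by (simp add: T_def)
  next
    show "\<exists>\<mu> :: int \<Rightarrow> nat. \<forall>i\<in>{0..<int m} - {i. even i}. \<mu> (i - 1) < \<mu> i"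
      by (intro exI[of _ "\<lambda>i. if even i then 0 else 1"]) auto
  next
    fix i assume "i \<in> {0..<int m} - {i. even i}"
    then have "i \<noteq> 0" "0 \<le> i" "i < int m" by auto
    then show "i - 1 \<in> {0..<int m}" by simp
  qed (use finV in auto)
  then show ?thesis unfolding m prod_parity .
qed

text \<open>Here the open position is a hub, so hubs are adjacent at \<open>2 * k - 1\<close> and
  \<open>2 * k\<close>. The second one is charged to the vertex at position 0, which follows it
  cyclically; this is the additional factor \<open>l div 2\<close>.\<close>

lemma card_canonical_odd_hub:
  assumes m: "m = 2 * k + 1" and k: "k \<ge> 1"
  shows "card {c \<in> canonical m. c (2 * int k - 1) \<in> H} \<le> (card V * (l div 2)) ^ k * (l div 2)"
proof -
  let ?C = "{c \<in> canonical m. c (2 * int k - 1) \<in> H}"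
  let ?d = "\<lambda>i. if i = 2 * int k then l div 2 else if even i then card V else l div 2"
  let ?p = "\<lambda>i. if i = 2 * int k then 0 else i - 1" and ?A = "{i. even i \<and> i \<noteq> 2 * int k}"
  have "card ?C \<le> (\<Prod>i\<in>{0..<int m}. ?d i)"
  proof (rule det_count[where A = ?A and Y = "\<lambda>_. V" and p = ?p and N = "\<lambda>_. T"])
    fix c c' assume "c \<in> ?C"
      "c' \<in> ?C" "\<forall>i\<in>{0..<int m}. c i = c' i"
    then show "c = c'" using cyc_ext[of c m E c'] m k by (simp add: canonical_def)
  next
    fix c i assume "c \<in> ?C"
    then show "c i \<in> V" using canonical_in_V[of c m i] by auto
  next
    fix c i assume "c \<in> ?C" and i: "i \<in> {0..<int m} - ?A"
    then have c: "c \<in> canonical m" and ck: "c (2 * int k - 1) \<in> H" by auto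
    have c0: "c (2 * int 0 - 1) \<in> H" "c (2 * int 0) \<in> R" using c k m unfolding canonical_def by auto
    show "c i \<in> T (c (?p i)) \<and> finite (T (c (?p i))) \<and> card (T (c (?p i))) \<le> ?d i"
    proof (cases "i = 2 * int k")
      case True
      have "c (-1 + int m) = c (-1)" using c by (simp only: canonical_def cyc_def mem_Collect_eq)
      then have "c i = c (-1)" using m True by simp
      then show ?thesis using canonical_adj(2)[OF c, of "-1"] finT card_T c0 True by (simp add: T_def)
    next
      case False
      then obtain j' where "i = 2 * j' + 1" using i by (auto elim: oddE)
      then obtain j where j: "i = 2 * int j + 1" "j < k" using i m
        by (intro that[of "nat j'"]) auto
      have R: "c (i - 1) \<in> R" using c j m by (simp add: canonical_def)
      have "c i \<in> H"
      proof (cases "Suc j < k")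
        case True
        then have "c (2 * int (Suc j) - 1) \<in> H" using c m unfolding canonical_def by auto
        then show ?thesis using j by (simp add: algebra_simps)
      next
        case False
        then have "i = 2 * int k - 1" using j by auto
        then show ?thesis using ck by simp
      qed
      then show ?thesis
        using canonical_adj(1)[OF c, of "i - 1"] finT card_T[OF R] False i by (simp add: T_def)
    qed
  next
    show "\<exists>\<mu> :: int \<Rightarrow> nat. \<forall>i\<in>{0..<int m} - ?A. \<mu> (?p i) < \<mu> i"
    proof (intro exI ballI)
      fix i assume i: "i \<in> {0..<int m} - ?A"
      have "?p i \<in> ?A"
      proof (cases "i = 2 * int k")
        case True
        then show ?thesis using k by simp
      next
        case False
        then have "odd i" "i < 2 * int k + 1" using i m by auto
        then show ?thesis using False by simp
      qed
      moreover have "i \<notin> ?A" using i by blast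
      ultimately show "(if ?p i \<in> ?A then 0 else 1) < (if i \<in> ?A then 0 else (1 :: nat))"
        by (simp only: if_True if_False simp_thms zero_less_one)
    qed
  next
    fix i assume i: "i \<in> {0..<int m} - ?A"
    then have "i \<noteq> 0 \<or> k = 0" by auto
    then show "?p i \<in> {0..<int m}" using i k by auto
  next
    fix i assume "i \<in> {0..<int m} \<inter> ?A"
    then show "finite V \<and> card V \<le> ?d i" using finV by simp
  qed simp
  also have "(\<Prod>i\<in>{0..<int m}. ?d i) = (\<Prod>i\<in>{0..<int (2 * k)}. ?d i) * (l div 2)"
  proof -
    have "{0..<int m} = insert (2 * int k) {0..<int (2 * k)}" using m by auto
    then show ?thesis by (simp add: mult.commute)
  qed
  also have "(\<Prod>i\<in>{0..<int (2 * k)}. ?d i) = (card V * (l div 2)) ^ k"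
    unfolding prod_parity[symmetric] by (rule prod.cong) auto
  finally show ?thesis .
qed

text \<open>With \<open>m = 2 * k + 5\<close> the open position is \<open>2 * k + 3\<close>, and
  \<open>x\<close>, \<open>y\<close> form the run of length two. The hubs at
  \<open>2 * k + 1\<close> and \<open>2 * k + 4\<close> are charged to \<open>x\<close> and
  \<open>y\<close>, so the freely chosen vertex at \<open>2 * k\<close> has no hub charged to
  it.\<close>

lemma card_canonical_odd_pair:
  assumes m: "m = 2 * k + 5" and x: "x \<in> R" "card (T x) \<le> t" and y: "y \<in> R" "card (T y) \<le> t'"
  shows "card {c \<in> canonical m. c (2 * int k + 2) = x \<and> c (2 * int k + 3) = y}
    \<le> (card V * (l div 2)) ^ k * (card V * t * t')"
proof -
  let ?C = "{c \<in> canonical m. c (2 * int k + 2) = x \<and> c (2 * int k + 3) = y}"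
  let ?z = "2 * int k"
  let ?d = "\<lambda>i. if i = ?z + 1 then t else if i = ?z + 2 then 1 else if i = ?z + 3 then 1
      else if i = ?z + 4 then t' else if even i then card V else l div 2"
  let ?p = "\<lambda>i. if i = ?z + 1 then ?z + 2 else i - 1"
    and ?A = "{i. even i \<and> i \<noteq> ?z + 4} \<union> {?z + 3}"
    and ?Y = "\<lambda>i. if i = ?z + 2 then {x} else if i = ?z + 3 then {y} else V"
  have "card ?C \<le> (\<Prod>i\<in>{0..<int m}. ?d i)"
  proof (rule det_count[where A = ?A and Y = ?Y and p = ?p and N = "\<lambda>_. T"])
    fix c c' assume "c \<in> ?C" "c' \<in> ?C" "\<forall>i\<in>{0..<int m}. c i = c' i"
    then show "c = c'" using cyc_ext[of c m E c'] m by (simp add: canonical_def)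
  next
    fix c i assume "c \<in> ?C"
    then show "c i \<in> ?Y i" using canonical_in_V[of c m i] by auto
  next
    fix c i assume "c \<in> ?C" and i: "i \<in> {0..<int m} - ?A"
    then have c: "c \<in> canonical m" and cx: "c (?z + 2) = x" and cy: "c (?z + 3) = y" by auto
    have cH: "c (2 * int j - 1) \<in> H" "c (2 * int j) \<in> R" if "j < k + 2" for j
      using c m that unfolding canonical_def by auto
    consider "i = ?z + 4" | "i = ?z + 1" | j where "i = 2 * int j + 1" "j < k"
    proof (cases "i = ?z + 4 \<or> i = ?z + 1")
      case False
      then obtain j' where "i = 2 * j' + 1" using i by (auto elim: oddE)
      then show ?thesis using i m False by (intro that(3)[of "nat j'"]) auto
    qed (use that in blast)
    then show "c i \<in> T (c (?p i)) \<and> finite (T (c (?p i))) \<and> card (T (c (?p i))) \<le> ?d i"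
    proof cases
      case 1
      have "c (-1 + int m) = c (-1)" using c by (simp only: canonical_def cyc_def mem_Collect_eq)
      then have "c i \<in> H" using m 1 cH(1)[of 0] by (simp add: add.commute)
      then show ?thesis using canonical_adj(1)[OF c, of "?z + 3"] finT y cy 1 by (simp add: T_def add.commute)
    next
      case 2
      then have "c i \<in> H" using cH(1)[of "Suc k"] by (simp add: algebra_simps)
      then show ?thesis using canonical_adj(2)[OF c, of "?z + 1"] finT x cx 2 by (simp add: T_def add.commute)
    next
      case 3
      have "c i \<in> H" using cH(1)[of "Suc j"] 3 by (simp add: algebra_simps)
      moreover have R: "c (i - 1) \<in> R" using cH(2)[of j] 3 by simp
      moreover have "i \<noteq> ?z + 1" "i \<noteq> ?z + 2" "i \<noteq> ?z + 3" "i \<noteq> ?z + 4" "odd i" using 3 by auto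
      ultimately show ?thesis
        using canonical_adj(1)[OF c, of "i - 1"] finT card_T[OF R] by (simp add: T_def)
    qed
  next
    show "\<exists>\<mu> :: int \<Rightarrow> nat. \<forall>i\<in>{0..<int m} - ?A. \<mu> (?p i) < \<mu> i"
      by (intro exI[of _ "\<lambda>i. if i \<in> ?A then 0 else 1"]) (auto simp: m)
  next
    fix i assume i: "i \<in> {0..<int m} - ?A"
    then have "i \<noteq> 0" "0 \<le> i" "i < int m" by auto
    then show "?p i \<in> {0..<int m}" using m by auto
  next
    fix i assume "i \<in> {0..<int m} \<inter> ?A"
    then show "finite (?Y i) \<and> card (?Y i) \<le> ?d i" using finV by auto
  qed simp
  also have "(\<Prod>i\<in>{0..<int m}. ?d i) = (\<Prod>i\<in>{0..<int (2 * k)}. ?d i) * (card V * t * t')"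
  proof -
    have "{0..<int m} = insert (?z + 4) (insert (?z + 3) (insert (?z + 2) (insert (?z + 1)
        (insert ?z {0..<int (2 * k)}))))" by (auto simp: m)
    then show ?thesis by (simp add: mult.commute mult.left_commute)
  qed
  also have "(\<Prod>i\<in>{0..<int (2 * k)}. ?d i) = (card V * (l div 2)) ^ k"
    unfolding prod_parity[symmetric] by (rule prod.cong) auto
  finally show ?thesis .
qed

lemma card_canonical_odd_pairs:
  assumes m: "m = 2 * k + 5" and P: "finite P" "card P \<le> N"
    "\<And>x y. (x, y) \<in> P \<Longrightarrow> x \<in> R \<and> y \<in> R \<and> card (T x) \<le> t \<and> card (T y) \<le> t'"
  shows "card {c \<in> canonical m. (c (2 * int k + 2), c (2 * int k + 3)) \<in> P}
    \<le> N * ((card V * (l div 2)) ^ k * (card V * t * t'))"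
proof -
  let ?C = "\<lambda>(x, y). {c \<in> canonical m. c (2 * int k + 2) = x \<and> c (2 * int k + 3) = y}"
  have fin: "finite (canonical m)" using finite_canonical m by simp
  have "{c \<in> canonical m. (c (2 * int k + 2), c (2 * int k + 3)) \<in> P} = (\<Union>z\<in>P. ?C z)" by auto
  then have "card {c \<in> canonical m. (c (2 * int k + 2), c (2 * int k + 3)) \<in> P} \<le> (\<Sum>z\<in>P. card (?C z))"
    using card_UN_le[OF P(1), of ?C] by simp
  also have "\<dots> \<le> (\<Sum>z\<in>P. (card V * (l div 2)) ^ k * (card V * t * t'))"
  proof (rule sum_mono)
    fix z assume "z \<in> P"
    then show "card (?C z) \<le> (card V * (l div 2)) ^ k * (card V * t * t')"
      using card_canonical_odd_pair[OF m, of "fst z" t "snd z" t'] P(3)[of "fst z" "snd z"]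
      by (cases z) auto
  qed
  also have "\<dots> \<le> N * ((card V * (l div 2)) ^ k * (card V * t * t'))"
    using P(2) by simp
  finally show ?thesis .
qed

text \<open>The first term comes from two adjacent hubs. Pairs in which one vertex has at most
  \<open>2 * g\<close> hub neighbours number at most \<open>2 * l * card V\<close> but allow few
  hubs; the two symmetric cases add up to \<open>8 * l * g\<close>. For pairs of rich vertices the
  number of pairs itself is reduced by \<open>card_rich_edges\<close>.\<close>

lemma card_canonical_odd:
  assumes m: "m = 2 * k + 5" and g: "g \<ge> 1"
  shows "card (canonical m) \<le> card V ^ (k + 2) * ((l div 2) ^ (k + 3)
    + 8 * l * g * (l div 2) ^ (k + 1) + 2 * (l div (2 * g) + 1) * (l div 2) ^ (k + 2))"
proof -
  define n s M where "n = card V" and "s = l div 2" and "M = l div (2 * g) + 1"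
  define P where "P = {(x, y). x \<in> R \<and> y \<in> R \<and> E x y}"
  define P1 where "P1 = {(x, y) \<in> P. card (T x) \<le> 2 * g}"
  define P2 where "P2 = {(x, y) \<in> P. card (T y) \<le> 2 * g}"
  define P3 where "P3 = {(x, y) \<in> P. 2 * g \<le> card (T x) \<and> 2 * g \<le> card (T y)}"
  let ?C = "\<lambda>Q. {c \<in> canonical m. (c (2 * int k + 2), c (2 * int k + 3)) \<in> Q}"
  let ?D = "{c \<in> canonical m. c (2 * int (k + 2) - 1) \<in> H}"
  have fin: "finite (canonical m)" using finite_canonical m by simp
  have PE: "P \<subseteq> {(x, y). x \<in> V \<and> y \<in> V \<and> E x y}" using R_in_V by (auto simp: P_def)
  have finE: "finite {(x, y). x \<in> V \<and> y \<in> V \<and> E x y}"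
    by (rule finite_subset[of _ "V \<times> V"]) (use finV in auto)
  have finP: "finite P" using PE finE finite_subset by blast
  have cP: "card P \<le> 2 * l * n"
    using card_mono[OF finE PE] card_edges_circ[OF graph circ l2] unfolding n_def by linarith
  have sub: "P1 \<subseteq> P" "P2 \<subseteq> P" "P3 \<subseteq> P" by (auto simp: P1_def P2_def P3_def)
  have c1: "card P1 \<le> 2 * l * n" "card P2 \<le> 2 * l * n"
    using card_mono[OF finP sub(1)] card_mono[OF finP sub(2)] cP by auto
  have "P3 = {(x, y). x \<in> {x \<in> R. 2 * g \<le> card (T x)} \<and> y \<in> {x \<in> R. 2 * g \<le> card (T x)} \<and> E x y}"
    by (auto simp: P3_def P_def)
  then have c3: "card P3 \<le> 2 * M * n" using card_rich_edges[OF g] by (simp add: M_def n_def)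
  have Ts: "card (T x) \<le> s" if "x \<in> R" for x using card_T[OF that] by (simp add: s_def)
  have "canonical m \<subseteq> ?D \<union> (?C P1 \<union> (?C P2 \<union> ?C P3))"
  proof
    fix c assume c: "c \<in> canonical m"
    have R: "c (2 * int k + 2) \<in> R" using c m unfolding canonical_def by (auto dest!: spec[of _ "k + 1"] simp: algebra_simps)
    have e: "E (c (2 * int k + 2)) (c (2 * int k + 3))"
      using canonical_adj(1)[OF c, of "2 * int k + 2"] by (simp add: add.commute)
    have "c (2 * int k + 3) \<in> H \<union> R" using c by (auto simp: canonical_def)
    then show "c \<in> ?D \<union> (?C P1 \<union> (?C P2 \<union> ?C P3))"
      using c R e by (auto simp: P1_def P2_def P3_def P_def algebra_simps)
  qed
  then have "card (canonical m) \<le> card (?D \<union> (?C P1 \<union> (?C P2 \<union> ?C P3)))"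
    using fin by (intro card_mono) auto
  also have "\<dots> \<le> card ?D + (card (?C P1) + (card (?C P2) + card (?C P3)))"
    by (meson card_Un_le add_left_mono le_trans)
  also have "\<dots> \<le> (n * s) ^ (k + 2) * s + (2 * l * n * ((n * s) ^ k * (n * (2 * g) * s))
     + (2 * l * n * ((n * s) ^ k * (n * s * (2 * g))) + 2 * M * n * ((n * s) ^ k * (n * s * s))))"
  proof (intro add_mono)
    show "card ?D \<le> (n * s) ^ (k + 2) * s"
      using card_canonical_odd_hub[of m "k + 2"] m by (simp add: n_def s_def)
    show "card (?C P1) \<le> 2 * l * n * ((n * s) ^ k * (n * (2 * g) * s))"
      unfolding n_def s_def
      by (rule card_canonical_odd_pairs[OF m finite_subset[OF sub(1) finP]])
        (use c1 card_T in \<open>auto simp: P1_def P_def n_def\<close>)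
    show "card (?C P2) \<le> 2 * l * n * ((n * s) ^ k * (n * s * (2 * g)))"
      unfolding n_def s_def
      by (rule card_canonical_odd_pairs[OF m finite_subset[OF sub(2) finP]])
        (use c1 card_T in \<open>auto simp: P2_def P_def n_def\<close>)
    show "card (?C P3) \<le> 2 * M * n * ((n * s) ^ k * (n * s * s))"
      unfolding n_def s_def
      by (rule card_canonical_odd_pairs[OF m finite_subset[OF sub(3) finP]])
        (use c3 card_T in \<open>auto simp: P3_def P_def n_def\<close>)
  qed
  also have "\<dots> = n ^ (k + 2) * (s ^ (k + 3) + 8 * l * g * s ^ (k + 1) + 2 * M * s ^ (k + 2))"
    by (simp add: power_mult_distrib power_add algebra_simps power2_eq_square power3_eq_cube)
  finally show ?thesis by (simp add: n_def s_def M_def)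
qed

end

subsection \<open>Orientations of cycles induced by a degenerate ranking\<close>

locale ranked =
  fixes V :: "'v set" and E :: "'v \<Rightarrow> 'v \<Rightarrow> bool" and l m :: nat and r :: "'v \<Rightarrow> nat"
  assumes graph: "graph_on V E" and rinj: "inj_on r V"
    and outdeg: "\<And>x. x \<in> V \<Longrightarrow> card {y\<in>V. E x y \<and> r x < r y} \<le> l"
    and m6: "m \<ge> 6" and l1: "l \<ge> 1"
begin

lemma finV: "finite V"
  using graph by (rule graph_on_finite)

lemma m_pos: "m > 0"
  using m6 by simp

definition Out :: "'v \<Rightarrow> 'v set" where
  "Out x = {y\<in>V. E x y \<and> r x < r y}"

definition up :: "(int \<Rightarrow> 'v) \<Rightarrow> int \<Rightarrow> bool" where
  "up c i \<longleftrightarrow> r (c i) < r (c (i + 1))"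

definition source :: "(int \<Rightarrow> 'v) \<Rightarrow> int \<Rightarrow> bool" where
  "source c i \<longleftrightarrow> up c i \<and> \<not> up c (i - 1)"

definition sink :: "(int \<Rightarrow> 'v) \<Rightarrow> int \<Rightarrow> bool" where
  "sink c i \<longleftrightarrow> \<not> up c i \<and> up c (i - 1)"

definition dir :: "(int \<Rightarrow> 'v) \<Rightarrow> int set" where
  "dir c = {i\<in>{0..<int m}. up c i}"

text \<open>Computed from the pattern of ascending positions alone, so that the source positions are
  known before the cycle is chosen; \<open>src_dir\<close> identifies them with the sources.\<close>

definition src :: "int set \<Rightarrow> int set" where
  "src D = {i\<in>{0..<int m}. i \<in> D \<and> (i - 1) mod int m \<notin> D}"

lemma finite_Out: "finite (Out x)"
  using finV by (simp add: Out_def)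

lemma card_Out: "card (Out x) \<le> l"
proof (cases "x \<in> V")
  case False
  then have "Out x = {}" using graph_onD[OF graph] by (auto simp: Out_def)
  then show ?thesis by simp
qed (simp add: Out_def outdeg)

lemma finite_src: "finite (src D)"
  by (rule finite_subset[of _ "{0..<int m}"]) (auto simp: src_def)

lemma src_le: "card (src D) \<le> m"
proof -
  have "card (src D) \<le> card {0..<int m}" by (rule card_mono) (auto simp: src_def)
  then show ?thesis by simp
qed

context
  fixes c :: "int \<Rightarrow> 'v"
  assumes c: "c \<in> cyc m E"
begin

lemma not_up: "\<not> up c i \<longleftrightarrow> r (c (i + 1)) < r (c i)"
proof -
  have "c i \<in> V" "c (i + 1) \<in> V" "c i \<noteq> c (i + 1)"
    using graph_onD[OF graph cyc_adj[OF c, of i]] by auto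
  then have "r (c i) \<noteq> r (c (i + 1))" using rinj by (auto dest: inj_onD)
  then show ?thesis by (auto simp: up_def)
qed

lemma up_Out: "up c i \<Longrightarrow> c (i + 1) \<in> Out (c i)"
  using cyc_adj[OF c] cyc_in_V[OF graph c] by (simp add: up_def Out_def)

lemma down_Out: "\<not> up c i \<Longrightarrow> c i \<in> Out (c (i + 1))"
  using graph_on_sym[OF graph cyc_adj[OF c]] cyc_in_V[OF graph c] by (simp add: not_up Out_def)

lemma up_mod: "up c (i mod int m) = up c i"
proof -
  have "c (i mod int m + 1) = c (i + 1)"
    using cyc_eq_iff[OF c m_pos] by (simp add: mod_add_left_eq)
  then show ?thesis using cyc_mod[OF c] by (simp add: up_def)
qed

lemma source_mod: "source c (i mod int m) = source c i"
proof -
  have "up c (i mod int m - 1) = up c (i - 1)"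
    using up_mod[of "i mod int m - 1"] up_mod[of "i - 1"] by (simp add: mod_diff_left_eq)
  then show ?thesis by (simp add: source_def up_mod)
qed

lemma dir_iff: "i \<in> {0..<int m} \<Longrightarrow> i \<in> dir c \<longleftrightarrow> up c i"
  by (simp add: dir_def)

lemma mod_in_dir: "i mod int m \<in> dir c \<longleftrightarrow> up c i"
  using m_pos by (simp add: dir_def up_mod)

lemma src_dir: "src (dir c) = {i\<in>{0..<int m}. source c i}"
  by (auto simp: src_def source_def mod_in_dir dir_iff)

lemma mod_in_src: "i mod int m \<in> src (dir c) \<longleftrightarrow> source c i"
  using m_pos by (simp add: src_dir source_mod)

lemma source_periodic: "\<forall>i. source c (i + int m) = source c i"
  using source_mod by (metis mod_add_self2)

lemma source_sparse: "\<forall>i. \<not> (source c i \<and> source c (i + 1))"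
  by (simp add: source_def)

lemma card_src_le: "card (src (dir c)) \<le> m div 2"
  using sparse_card[OF source_periodic source_sparse] by (simp add: src_dir)

end

text \<open>Every vertex of the cycle that is not a source is an out-neighbour of its predecessor or
  successor, so the sources together with bounded choices determine the cycle.\<close>

lemma src_count:
  assumes Y: "\<And>a. a \<in> src D \<Longrightarrow> finite (Y a)"
  shows "card {c \<in> cyc m E. dir c = D \<and> (\<forall>a\<in>src D. c a \<in> Y a)} \<le> (\<Prod>a\<in>src D. card (Y a)) * l ^ m"
proof -
  let ?W = "{c \<in> cyc m E. dir c = D \<and> (\<forall>a\<in>src D. c a \<in> Y a)}"
  let ?I = "{0..<int m}"
  let ?d = "\<lambda>i. if i \<in> src D then card (Y i) else l"
  let ?p = "\<lambda>i. if (i - 1) mod int m \<in> D then (i - 1) mod int m else (i + 1) mod int m"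
  have sub: "src D \<subseteq> ?I" by (auto simp: src_def)
  have par: "c i \<in> Out (c (?p i))" if "c \<in> ?W" "i \<in> ?I - src D" for c i
  proof (cases "(i - 1) mod int m \<in> D")
    case True
    have cc: "c \<in> cyc m E" "dir c = D" using that by auto
    then have "up c (i - 1)" using True mod_in_dir[OF cc(1)] by simp
    then show ?thesis using up_Out[OF cc(1), of "i - 1"] True cyc_mod[OF cc(1)] by simp
  next
    case False
    have cc: "c \<in> cyc m E" "dir c = D" using that by auto
    have "i \<notin> D" using that False by (auto simp: src_def)
    then have "\<not> up c i" using cc that dir_iff[OF cc(1)] by auto
    then show ?thesis using down_Out[OF cc(1), of i] False cyc_mod[OF cc(1)] by simp
  qed
  have "card ?W \<le> (\<Prod>i\<in>?I. ?d i)"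
  proof (rule det_count[where A = "src D" and Y = Y and p = ?p and N = "\<lambda>_. Out"])
    fix c c' assume "c \<in> ?W" "c' \<in> ?W" "\<forall>i\<in>?I. c i = c' i"
    then show "c = c'" using cyc_ext[of c m E c'] m_pos by simp
  next
    fix c i assume "c \<in> ?W" "i \<in> ?I - src D"
    then show "c i \<in> Out (c (?p i)) \<and> finite (Out (c (?p i))) \<and> card (Out (c (?p i))) \<le> ?d i"
      using par finite_Out card_Out by simp
  next
    \<comment> \<open>Rank grows from parent to child, so the ranks along \<open>c\<close> itself
      are the measure.\<close>
    fix c assume "c \<in> ?W"
    then have "\<forall>i\<in>?I - src D. r (c (?p i)) < r (c i)" using par by (simp add: Out_def)
    then show "\<exists>\<mu> :: int \<Rightarrow> nat. \<forall>i\<in>?I - src D. \<mu> (?p i) < \<mu> i" by (intro exI[of _ "\<lambda>i. r (c i)"])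
  qed (use Y m_pos in auto)
  also have "\<dots> = (\<Prod>i\<in>src D. card (Y i)) * l ^ card (?I - src D)"
    using prod.subset_diff[OF sub, of ?d] by (simp add: mult.commute)
  also have "\<dots> \<le> (\<Prod>i\<in>src D. card (Y i)) * l ^ m"
  proof -
    have "card (?I - src D) \<le> card ?I" by (intro card_mono) auto
    then show ?thesis using l1 by (intro mult_le_mono2 power_increasing) auto
  qed
  finally show ?thesis .
qed

lemma card_patterns:
  assumes B: "\<And>c. c \<in> B \<Longrightarrow> c \<in> cyc m E"
    and le: "\<And>D. D \<subseteq> {0..<int m} \<Longrightarrow> card {c \<in> B. dir c = D} \<le> N"
  shows "card B \<le> 2 ^ m * N"
proof -
  let ?P = "Pow {0..<int m}"
  have "dir c \<in> ?P" for c by (auto simp: dir_def)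
  then have "B = (\<Union>D\<in>?P. {c \<in> B. dir c = D})" by blast
  then have "card B = card (\<Union>D\<in>?P. {c \<in> B. dir c = D})" by (rule arg_cong)
  also have "\<dots> \<le> (\<Sum>D\<in>?P. card {c \<in> B. dir c = D})" by (rule card_UN_le) simp
  also have "\<dots> \<le> (\<Sum>D\<in>?P. N)" by (intro sum_mono le) auto
  finally show ?thesis by (simp add: card_Pow)
qed

lemma pattern_count: "card {c \<in> cyc m E. dir c = D} \<le> card V ^ card (src D) * l ^ m"
proof -
  have "{c \<in> cyc m E. dir c = D} = {c \<in> cyc m E. dir c = D \<and> (\<forall>a\<in>src D. c a \<in> V)}"
    using cyc_in_V[OF graph] by blast
  then show ?thesis using src_count[of D "\<lambda>_. V"] finV by simp
qed

lemma card_cyc_few_sources: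
  assumes n: "card V \<ge> 1"
  shows "card {c \<in> cyc m E. card (src (dir c)) \<le> j} \<le> 2 ^ m * (card V ^ j * l ^ m)"
proof (rule card_patterns)
  fix D
  show "card {c \<in> {c \<in> cyc m E. card (src (dir c)) \<le> j}. dir c = D} \<le> card V ^ j * l ^ m"
  proof (cases "card (src D) \<le> j")
    case True
    have "{c \<in> {c \<in> cyc m E. card (src (dir c)) \<le> j}. dir c = D} = {c \<in> cyc m E. dir c = D}"
      using True by auto
    also have "card \<dots> \<le> card V ^ card (src D) * l ^ m" by (rule pattern_count)
    also have "\<dots> \<le> card V ^ j * l ^ m" using True n by (intro mult_le_mono1 power_increasing)
    finally show ?thesis .
  next
    case False
    then have "{c \<in> {c \<in> cyc m E. card (src (dir c)) \<le> j}. dir c = D} = {}" by auto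
    then show ?thesis by (metis card.empty le0)
  qed
qed simp

lemma card_cyc_le:
  assumes n: "card V \<ge> 1"
  shows "card (cyc m E) \<le> 2 ^ m * (card V ^ (m div 2) * l ^ m)"
proof -
  have "{c \<in> cyc m E. card (src (dir c)) \<le> m div 2} = cyc m E" using card_src_le by auto
  then show ?thesis using card_cyc_few_sources[OF n, of "m div 2"] by simp
qed

text \<open>One source confined to \<open>H\<close> costs \<open>card H\<close> instead of
  \<open>card V\<close>; the factor \<open>m\<close> selects its position.\<close>

lemma card_source_in:
  assumes H: "H \<subseteq> V"
  shows "card {c \<in> cyc m E. card (src (dir c)) = j \<and> (\<exists>a\<in>src (dir c). c a \<in> H)}
    \<le> 2 ^ m * (m * (card H * card V ^ (j - 1) * l ^ m))" (is "card ?B \<le> _")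
proof (rule card_patterns)
  fix D
  have finH: "finite H" using H finV finite_subset by blast
  let ?C = "\<lambda>a. {c \<in> cyc m E. dir c = D \<and> (\<forall>b\<in>src D. c b \<in> (if b = a then H else V))}"
  show "card {c \<in> ?B. dir c = D} \<le> m * (card H * card V ^ (j - 1) * l ^ m)"
  proof (cases "card (src D) = j")
    case True
    have one: "card (?C a) \<le> card H * card V ^ (j - 1) * l ^ m" if a: "a \<in> src D" for a
    proof -
      have "(\<Prod>b\<in>src D. card (if b = a then H else V)) =
          card H * (\<Prod>b\<in>src D - {a}. card (if b = a then H else V))"
        using a finite_src by (simp add: prod.remove)
      also have "(\<Prod>b\<in>src D - {a}. card (if b = a then H else V)) = (\<Prod>b\<in>src D - {a}. card V)"
        by (rule prod.cong) auto
      also have "\<dots> = card V ^ (j - 1)" using a True finite_src by simp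
      finally show ?thesis using src_count[of D "\<lambda>b. if b = a then H else V"] finH finV by simp
    qed
    have "{c \<in> ?B. dir c = D} \<subseteq> (\<Union>a\<in>src D. ?C a)" using cyc_in_V[OF graph] by auto
    moreover have "finite (\<Union>a\<in>src D. ?C a)"
      using finite_src finite_cyc[OF graph m_pos] by auto
    ultimately have "card {c \<in> ?B. dir c = D} \<le> card (\<Union>a\<in>src D. ?C a)" by (rule card_mono[rotated])
    also have "\<dots> \<le> (\<Sum>a\<in>src D. card (?C a))" by (rule card_UN_le[OF finite_src])
    also have "\<dots> \<le> (\<Sum>a\<in>src D. card H * card V ^ (j - 1) * l ^ m)" by (intro sum_mono one)
    also have "\<dots> \<le> m * (card H * card V ^ (j - 1) * l ^ m)"
      using src_le by (simp add: mult_le_mono1)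
    finally show ?thesis .
  next
    case False
    then have "{c \<in> ?B. dir c = D} = {}" by auto
    then show ?thesis by (metis card.empty le0)
  qed
qed simp

section \<open>Sinks and the sources near them\<close>

definition In2 :: "'v \<Rightarrow> 'v set" where
  "In2 b = {x \<in> V. b \<in> Out x \<or> (\<exists>y\<in>Out x. b \<in> Out y)}"

text \<open>Double counting: every vertex ascends in one or two steps to at most
  \<open>l + l * l\<close> vertices. A sink together with a source from its set \<open>In2\<close>
  thus costs only linearly many choices.\<close>

lemma sum_In2: "(\<Sum>b\<in>V. card (In2 b)) \<le> card V * (l + l * l)"
proof -
  let ?O = "\<lambda>x. {b \<in> V. x \<in> In2 b}"
  have O: "card (?O x) \<le> l + l * l" for x
  proof -
    have "?O x \<subseteq> Out x \<union> (\<Union>y\<in>Out x. Out y)" by (auto simp: In2_def)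
    then have "card (?O x) \<le> card (Out x \<union> (\<Union>y\<in>Out x. Out y))"
      using finite_Out by (intro card_mono) auto
    also have "\<dots> \<le> card (Out x) + card (\<Union>y\<in>Out x. Out y)" by (rule card_Un_le)
    also have "\<dots> \<le> card (Out x) + (\<Sum>y\<in>Out x. card (Out y))"
      using card_UN_le[OF finite_Out, of Out x] by simp
    also have "\<dots> \<le> card (Out x) + (\<Sum>y\<in>Out x. l)" using card_Out by (intro add_left_mono sum_mono)
    also have "\<dots> \<le> l + l * l" using card_Out[of x] by (simp add: add_mono mult_le_mono1)
    finally show ?thesis .
  qed
  have "(\<Sum>b\<in>V. card (In2 b)) = (\<Sum>b\<in>V. \<Sum>x\<in>V. if x \<in> In2 b then 1 else 0)"
  proof (rule sum.cong)
    fix b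
    have "In2 b = {x \<in> V. x \<in> In2 b}" by (auto simp: In2_def)
    then have "card (In2 b) = (\<Sum>x\<in>{x \<in> V. x \<in> In2 b}. 1)" by simp
    then show "card (In2 b) = (\<Sum>x\<in>V. if x \<in> In2 b then 1 else 0)"
      using finV by (simp add: sum.If_cases Int_def)
  qed simp
  also have "\<dots> = (\<Sum>x\<in>V. \<Sum>b\<in>V. if x \<in> In2 b then 1 else 0)" by (rule sum.swap)
  also have "\<dots> = (\<Sum>x\<in>V. card (?O x))" using finV by (simp add: sum.If_cases Int_def)
  also have "\<dots> \<le> (\<Sum>x\<in>V. l + l * l)" by (intro sum_mono O)
  finally show ?thesis by simp
qed

context
  fixes c :: "int \<Rightarrow> 'v"
  assumes c: "c \<in> cyc m E" and full: "card (src (dir c)) = m div 2"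
begin

text \<open>With \<open>m div 2\<close> sources they occupy every second position except around at
  most one gap, which occurs only for odd m.\<close>

definition gap :: "int \<Rightarrow> bool" where
  "gap i \<longleftrightarrow> \<not> source c i \<and> \<not> source c (i + 1)"

lemma gap_unique:
  assumes "gap z" "gap z'"
  shows "z mod int m = z' mod int m"
proof -
  have "m div 2 \<le> card {i\<in>{0..<int m}. source c i}" using full src_dir[OF c] by simp
  then show ?thesis
    using sparse_gap_unique(1)[OF source_periodic[OF c] source_sparse[OF c] _ m_pos, of z z'] assms
    by (simp add: gap_def)
qed

text \<open>The deductions below compare positions less than 6 apart, which \<open>m \<ge> 6\<close>
  keeps distinct modulo m.\<close>

lemma gap_shift:
  assumes "gap z" "gap (z + d)" "0 < d" "d < 6"
  shows False
proof -
  have "(z + d - z) mod int m = (z - z) mod int m"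
    using gap_unique[OF assms(1,2)] by (metis mod_diff_left_eq)
  then show False using assms m6 by simp
qed

lemma gap_next: "gap z \<Longrightarrow> \<not> gap (z + 1)"
  using gap_shift[of z 1] by auto

text \<open>The single gap spoils at most one side of the sink. On an unspoilt side the next vertex
  is a source; on the other side the source is at most two steps away and ascends to the
  sink.\<close>

lemma sink_sources:
  assumes i: "sink c i"
  shows "\<exists>a a'. source c a \<and> source c a' \<and> a mod int m \<noteq> a' mod int m \<and> E (c i) (c a) \<and> c a' \<in> In2 (c i)"
proof -
  have ns: "\<not> source c i" using i by (simp add: source_def sink_def)
  have up: "\<not> up c i" "up c (i - 1)" using i by (auto simp: sink_def)
  have e: "E (c i) (c (i + 1))" "E (c i) (c (i - 1))"
    using cyc_adj[OF c, of i] graph_on_sym[OF graph cyc_adj[OF c, of "i - 1"]] by auto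
  have o1: "c i \<in> Out (c (i + 1))" "c i \<in> Out (c (i - 1))"
    using down_Out[OF c up(1)] up_Out[OF c up(2)] by auto
  have V: "c j \<in> V" for j using cyc_in_V[OF graph c] .
  have ne: "(i + p) mod int m \<noteq> (i + q) mod int m" if "p - q \<in> {1..5}" for p q
  proof
    assume "(i + p) mod int m = (i + q) mod int m"
    then have "(i + p - (i + q)) mod int m = (i + q - (i + q)) mod int m" by (metis mod_diff_left_eq)
    then show False using that m6 by simp
  qed
  show ?thesis
  proof (cases "source c (i + 1)")
    case s1: True
    show ?thesis
    proof (cases "source c (i - 1)")
      case True
      then show ?thesis
        using s1 e o1 V ne[of 1 "-1"] by (intro exI[of _ "i + 1"] exI[of _ "i - 1"]) (auto simp: In2_def)
    next
      case False
      then have "gap (i - 1)" using ns by (simp add: gap_def)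
      then have "\<not> gap (i - 2)" using gap_next[of "i - 2"] by auto
      then have s2: "source c (i - 2)" using False by (simp add: gap_def)
      then have "c (i - 1) \<in> Out (c (i - 2))" using up_Out[OF c, of "i - 2"] by (simp add: source_def)
      then show ?thesis using s1 s2 e o1 V ne[of 1 "-2"]
        by (intro exI[of _ "i + 1"] exI[of _ "i - 2"]) (auto simp: In2_def)
    qed
  next
    case False
    then have g: "gap i" using ns by (simp add: gap_def)
    then have "\<not> gap (i - 1)" using gap_next[of "i - 1"] by auto
    then have s1: "source c (i - 1)" using ns by (simp add: gap_def)
    have s2: "source c (i + 2)" using gap_next[OF g] False by (simp add: gap_def add.commute)
    then have "c (i + 1) \<in> Out (c (i + 2))"
      using down_Out[OF c, of "i + 1"] by (simp add: source_def add.commute)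
    then show ?thesis using s1 s2 e o1 V ne[of 2 "-1"]
      by (intro exI[of _ "i - 1"] exI[of _ "i + 2"]) (auto simp: In2_def)
  qed
qed

text \<open>A non-hub without an adjacent sink would create two gaps, so every non-hub has a hub
  neighbour and lies in \<open>R\<close>. A source preceded by a hub starts a run; otherwise its
  predecessor does. This maps sources injectively to run starts.\<close>

lemma good_if_fine:
  assumes H0: "\<And>i. sink c i \<Longrightarrow> c i \<in> H" and srcH: "\<And>i. source c i \<Longrightarrow> c i \<notin> H"
    and X: "\<And>i. c i \<notin> X" and R: "R = {x \<in> V - H - X. \<exists>b\<in>H. E x b}"
  shows "c \<in> good_cycles E H R m"
proof -
  have sinkE: "\<exists>b\<in>H. E (c i) b" if "sink c (i + 1) \<or> sink c (i - 1)" for i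
    using that H0 cyc_adj[OF c, of i] graph_on_sym[OF graph cyc_adj[OF c, of "i - 1"]] by auto
  have ran: "c i \<in> H \<union> R" for i
  proof (cases "c i \<in> H")
    case False
    then have ns: "\<not> sink c i" using H0 by blast
    have "sink c (i + 1) \<or> sink c (i - 1)"
    proof (rule ccontr)
      assume no: "\<not> (sink c (i + 1) \<or> sink c (i - 1))"
      show False
      proof (cases "source c i")
        case True
        then have "gap (i + 1)" "gap (i - 2)" using no
          by (auto simp: gap_def source_def sink_def add.commute)
        then show False using gap_shift[of "i - 2" 3] by (simp add: add.commute)
      next
        case ns2: False
        show False
        proof (cases "up c i")
          case True
          then have "gap i" "gap (i + 1)" using no ns2 by (auto simp: gap_def source_def sink_def add.commute)
          then show False using gap_next by blast
        next
          case False
          then have "gap (i - 1)" "gap (i - 2)" using no ns ns2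
            by (auto simp: gap_def source_def sink_def)
          then show False using gap_next[of "i - 2"] by simp
        qed
      qed
    qed
    then show ?thesis using sinkE X R False cyc_in_V[OF graph c] by auto
  qed simp
  let ?st = "\<lambda>i. c (i - 1) \<in> H \<and> c i \<in> R"
  let ?St = "{i \<in> {0..<int m}. ?st i}"
  let ?f = "\<lambda>a. if c (a - 1) \<in> H then a else (a - 1) mod int m"
  \<comment> \<open>The predecessor of \<open>a\<close> is no sink, so the descent to
    \<open>a\<close> has begun earlier and \<open>a - 2\<close> is a gap. As it is the only one,
    \<open>a - 3\<close> is a source, which makes \<open>a - 2\<close> a sink.\<close>
  have before: "c (a - 2) \<in> H" if a: "source c a" "c (a - 1) \<notin> H" for a
  proof -
    have "\<not> sink c (a - 1)" using a(2) H0 by blast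
    then have "gap (a - 2)" "\<not> up c (a - 2)" using a(1) by (auto simp: gap_def source_def sink_def)
    then have "\<not> gap (a - 3)" using gap_next[of "a - 3"] by auto
    then have "sink c (a - 2)" using \<open>gap (a - 2)\<close> \<open>\<not> up c (a - 2)\<close>
      by (auto simp: gap_def source_def sink_def)
    then show ?thesis by (rule H0)
  qed
  have st_mod: "?st (i mod int m) \<longleftrightarrow> ?st i" for i
  proof -
    have "c (i mod int m - 1) = c (i - 1)"
      using cyc_eq_iff[OF c m_pos] by (simp add: mod_diff_left_eq)
    then show ?thesis using cyc_mod[OF c] by simp
  qed
  have "?f ` src (dir c) \<subseteq> ?St"
  proof
    fix y assume "y \<in> ?f ` src (dir c)"
    then obtain a where "a \<in> src (dir c)" and ya: "y = ?f a" by blast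
    then have a: "a \<in> {0..<int m}" "source c a" "y = ?f a" using src_dir[OF c] by auto
    show "y \<in> ?St"
    proof (cases "c (a - 1) \<in> H")
      case True
      then have "?f a = a" "c a \<in> R" using ran[of a] srcH[OF a(2)] by auto
      then show ?thesis using a True by simp
    next
      case False
      then have "?st (a - 1)" using before[OF a(2) False] ran[of "a - 1"] by auto
      then have "?st ((a - 1) mod int m)" by (rule st_mod[THEN iffD2])
      then show ?thesis using a(3) False m_pos by simp
    qed
  qed
  moreover have "inj_on ?f (src (dir c))"
  proof (rule inj_onI)
    fix a b assume "a \<in> src (dir c)" "b \<in> src (dir c)" and eq: "?f a = ?f b"
    then have a: "a \<in> {0..<int m}" "source c a" and b: "b \<in> {0..<int m}" "source c b"
      using src_dir[OF c] by auto
    have mixed: False if "source c x" "source c y" "x = (y - 1) mod int m" for x y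
    proof -
      have "source c (y - 1)" using that source_mod[OF c, of "y - 1"] by simp
      then show False using that source_sparse[OF c] by (auto dest: spec[of _ "y - 1"])
    qed
    consider "c (a - 1) \<in> H" "c (b - 1) \<in> H" | "c (a - 1) \<notin> H" "c (b - 1) \<notin> H"
      | "c (a - 1) \<in> H" "c (b - 1) \<notin> H" | "c (a - 1) \<notin> H" "c (b - 1) \<in> H" by blast
    then show "a = b"
    proof cases
      case 2
      then have "(a - 1) mod int m = (b - 1) mod int m" using eq by simp
      then have "(a - 1 + 1) mod int m = (b - 1 + 1) mod int m" by (metis mod_add_left_eq)
      then show ?thesis using a b by simp
    next
      case 3
      then show ?thesis using mixed[OF a(2) b(2)] eq by simp
    next
      case 4
      then show ?thesis using mixed[OF b(2) a(2)] eq by simp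
    qed (use eq in simp)
  qed
  moreover have "finite ?St" by (rule finite_subset[of _ "{0..<int m}"]) auto
  ultimately have "card (src (dir c)) \<le> card ?St" by (meson card_inj_on_le)
  then show ?thesis using full c ran by (auto simp: good_cycles_def)
qed

end

text \<open>For a sink \<open>b\<close> outside \<open>H0\<close>, one source is among its at most
  \<open>t\<close> neighbours, another one lies in \<open>In2 b\<close>, and the remaining
  \<open>j\<close> are free. By \<open>sum_In2\<close> the sink and the second source together cost
  only \<open>card V * (l + l * l)\<close>.\<close>

lemma card_sink_outside:
  assumes H0: "\<And>v. v \<in> V - H0 \<Longrightarrow> card {w. E v w} \<le> t" and j: "m div 2 = j + 2"
  shows "card {c \<in> cyc m E. card (src (dir c)) = m div 2 \<and> (\<exists>i. sink c i \<and> c i \<notin> H0)}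
    \<le> 2 ^ m * (m * m * (t * (l + l * l) * card V ^ (j + 1) * l ^ m))" (is "card ?B \<le> _")
proof (rule card_patterns)
  fix D
  let ?N = "\<lambda>b. {w. E b w}"
  let ?Y = "\<lambda>a a' b x. if x = a then ?N b else if x = a' then In2 b else V"
  let ?C = "\<lambda>a a' b. {c \<in> cyc m E. dir c = D \<and> (\<forall>x\<in>src D. c x \<in> ?Y a a' b x)}"
  let ?P = "{(a, a'). a \<in> src D \<and> a' \<in> src D \<and> a \<noteq> a'}"
  have finN: "finite (?N b)" for b
    by (rule finite_subset[OF _ finV]) (use graph_onD[OF graph] in auto)
  have finIn2: "finite (In2 b)" for b using finV by (simp add: In2_def)
  have finP: "finite ?P" by (rule finite_subset[of _ "src D \<times> src D"]) (use finite_src in auto)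
  have cardP: "card ?P \<le> m * m"
  proof -
    have "card ?P \<le> card (src D \<times> src D)" using finite_src by (intro card_mono) auto
    also have "\<dots> \<le> m * m" using src_le by (simp add: card_cartesian_product mult_le_mono)
    finally show ?thesis .
  qed
  show "card {c \<in> ?B. dir c = D} \<le> m * m * (t * (l + l * l) * card V ^ (j + 1) * l ^ m)"
  proof (cases "card (src D) = m div 2")
    case True
    have one: "card (?C a a' b) \<le> t * card (In2 b) * card V ^ j * l ^ m"
      if a: "(a, a') \<in> ?P" and b: "b \<in> V - H0" for a a' b
    proof -
      have "(\<Prod>x\<in>src D. card (?Y a a' b x)) = card (?N b) * (\<Prod>x\<in>src D - {a}. card (?Y a a' b x))"
        using a prod.remove[OF finite_src, of a D "\<lambda>x. card (?Y a a' b x)"] by simp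
      also have "(\<Prod>x\<in>src D - {a}. card (?Y a a' b x)) =
          card (In2 b) * (\<Prod>x\<in>src D - {a} - {a'}. card (?Y a a' b x))"
        using a finite_src by (subst prod.remove[of _ a']) auto
      also have "(\<Prod>x\<in>src D - {a} - {a'}. card (?Y a a' b x)) = (\<Prod>x\<in>src D - {a} - {a'}. card V)"
        by (rule prod.cong) auto
      also have "\<dots> = card V ^ j" using a True j finite_src by simp
      finally have "card (?C a a' b) \<le> card (?N b) * (card (In2 b) * card V ^ j) * l ^ m"
        using src_count[of D "?Y a a' b"] finN finIn2 finV by simp
      also have "\<dots> \<le> t * (card (In2 b) * card V ^ j) * l ^ m"
        using H0[OF b] by (intro mult_le_mono1)
      finally show ?thesis by (simp add: mult.assoc)
    qed
    have "{c \<in> ?B. dir c = D} \<subseteq> (\<Union>z\<in>?P. \<Union>b\<in>V - H0. ?C (fst z) (snd z) b)"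
    proof
      fix c assume "c \<in> {c \<in> ?B. dir c = D}"
      then obtain i where c: "c \<in> cyc m E" "dir c = D" and i: "sink c i" "c i \<notin> H0" by blast
      have full: "card (src (dir c)) = m div 2" using True c by simp
      obtain a a' where a: "source c a" "source c a'" "a mod int m \<noteq> a' mod int m"
        "E (c i) (c a)" "c a' \<in> In2 (c i)" using sink_sources[OF c(1) full i(1)] by blast
      have "(a mod int m, a' mod int m) \<in> ?P" using a mod_in_src[OF c(1)] c(2) by auto
      moreover have "c i \<in> V - H0" using i cyc_in_V[OF graph c(1)] by blast
      moreover have "c \<in> ?C (a mod int m) (a' mod int m) (c i)"
        using a c cyc_mod[OF c(1)] cyc_in_V[OF graph c(1)] by auto
      ultimately show "c \<in> (\<Union>z\<in>?P. \<Union>b\<in>V - H0. ?C (fst z) (snd z) b)"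
        by (intro UN_I[of "(a mod int m, a' mod int m)"] UN_I[of "c i"]) auto
    qed
    moreover have "finite (\<Union>z\<in>?P. \<Union>b\<in>V - H0. ?C (fst z) (snd z) b)"
      using finP finV finite_cyc[OF graph m_pos] by (intro finite_UN_I) auto
    ultimately have "card {c \<in> ?B. dir c = D} \<le> card (\<Union>z\<in>?P. \<Union>b\<in>V - H0. ?C (fst z) (snd z) b)"
      by (rule card_mono[rotated])
    also have "\<dots> \<le> (\<Sum>z\<in>?P. card (\<Union>b\<in>V - H0. ?C (fst z) (snd z) b))" by (rule card_UN_le[OF finP])
    also have "\<dots> \<le> (\<Sum>z\<in>?P. \<Sum>b\<in>V - H0. card (?C (fst z) (snd z) b))"
      using finV by (intro sum_mono card_UN_le) auto
    also have "\<dots> \<le> (\<Sum>z\<in>?P. \<Sum>b\<in>V - H0. t * card (In2 b) * card V ^ j * l ^ m)"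
      by (intro sum_mono one) auto
    also have "\<dots> \<le> (\<Sum>z\<in>?P. \<Sum>b\<in>V. t * card (In2 b) * card V ^ j * l ^ m)"
      using finV by (intro sum_mono sum_mono2) auto
    also have "\<dots> = card ?P * (t * (\<Sum>b\<in>V. card (In2 b)) * card V ^ j * l ^ m)"
      by (simp add: sum_distrib_left sum_distrib_right)
    also have "\<dots> \<le> (m * m) * (t * (card V * (l + l * l)) * card V ^ j * l ^ m)"
      using cardP sum_In2 by (intro mult_le_mono) auto
    finally show ?thesis by (simp add: algebra_simps)
  next
    case False
    then have "{c \<in> ?B. dir c = D} = {}" by auto
    then show ?thesis by (metis card.empty le0)
  qed
qed simp

end

subsection \<open>Choosing the hubs\<close>

definition robust :: "'v set \<Rightarrow> ('v \<Rightarrow> 'v \<Rightarrow> bool) \<Rightarrow> nat \<Rightarrow> 'v set \<Rightarrow> 'v set \<Rightarrow> bool" where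
  "robust V E l H X \<longleftrightarrow> (\<forall>b\<in>H. \<forall>b'\<in>H. \<forall>p. 1 \<le> length p \<longrightarrow> length p \<le> l \<longrightarrow>
    link E (V - H - X) b p b' \<longrightarrow> abundant V E l H (length p) b b')"

text \<open>If links with \<open>j\<close> interior vertices between two hubs are not abundant, some
  set of at most \<open>l * card H\<close> vertices meets all of them. The union of these sets over
  all pairs of hubs and all \<open>j \<le> l\<close> is \<open>X\<close>, and every link avoiding
  \<open>X\<close> is then of an abundant kind.\<close>

lemma hitting_set:
  assumes fin: "finite V" and H: "H \<subseteq> V"
  shows "\<exists>X \<subseteq> V - H. card X \<le> l * l * card H ^ 3 \<and>
    robust V E l H X"
proof -
  have finH: "finite H" using assms finite_subset by blast
  define bad where "bad Z j b b' \<longleftrightarrow> finite Z \<and> card Z \<le> l * card H \<and>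
    \<not> (\<exists>p. length p = j \<and> link E (V - H - Z) b p b')" for Z :: "'a set" and j b b'
  define Z where "Z = (\<lambda>(b, b', j). if \<exists>Z. bad Z j b b' then (SOME Z. bad Z j b b') \<inter> (V - H) else {})"
  let ?I = "H \<times> H \<times> {1..l}"
  have Zbad: "bad (SOME Z. bad Z j b b') j b b'" if "\<exists>Z. bad Z j b b'" for b b' j
    using that by (rule someI_ex)
  have cZ: "card (Z (b, b', j)) \<le> l * card H" for b b' j
  proof (cases "\<exists>Z. bad Z j b b'")
    case True
    let ?Z = "SOME Z. bad Z j b b'"
    have b: "finite ?Z" "card ?Z \<le> l * card H" using Zbad[OF True] by (auto simp: bad_def)
    have "card (?Z \<inter> (V - H)) \<le> card ?Z" using b(1) by (intro card_mono) auto
    then show ?thesis using b(2) True by (simp add: Z_def)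
  qed (simp add: Z_def)
  let ?X = "\<Union>z\<in>?I. Z z"
  have "card ?X \<le> (\<Sum>z\<in>?I. card (Z z))" using finH by (intro card_UN_le) auto
  also have "\<dots> \<le> (\<Sum>z\<in>?I. l * card H)" using cZ by (intro sum_mono) auto
  also have "\<dots> = l * l * card H ^ 3"
    by (simp add: card_cartesian_product power3_eq_cube algebra_simps)
  finally have "card ?X \<le> l * l * card H ^ 3" .
  moreover have "?X \<subseteq> V - H" by (auto simp: Z_def split: if_splits)
  moreover have "abundant V E l H (length p) b b'"
    if b: "b \<in> H" "b' \<in> H" and p: "1 \<le> length p" "length p \<le> l" "link E (V - H - ?X) b p b'" for b b' p
  proof (rule ccontr)
    assume "\<not> abundant V E l H (length p) b b'"
    then have ex: "\<exists>Z. bad Z (length p) b b'" by (auto simp: abundant_def bad_def)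
    let ?Z = "SOME Z. bad Z (length p) b b'"
    have "Z (b, b', length p) \<subseteq> ?X" using b p by (intro UN_upper) auto
    then have "V - H - ?X \<subseteq> V - H - ?Z" using ex by (auto simp: Z_def)
    then have "link E (V - H - ?Z) b p b'" using p(3) by (auto simp: link_def)
    then show False using Zbad[OF ex] by (auto simp: bad_def)
  qed
  ultimately show ?thesis unfolding robust_def
    by (intro exI[of _ ?X] conjI ballI allI impI) auto
qed

text \<open>The potential \<open>?f i\<close> counts pairs of a cycle and a position in
  \<open>Hs i\<close>. It never exceeds \<open>m * card (cyc m E)\<close>, and each stage raises it
  by at least the number of cycles meeting the new vertices, so some stage raises it by at most the
  average.\<close>

lemma touch_pigeonhole:
  assumes fin: "finite (cyc m E)" and mono: "\<And>i. Hs i \<subseteq> Hs (Suc i)" and M: "M > 0"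
  shows "\<exists>i<M. M * card {c \<in> cyc m E. \<exists>p\<in>{0..<int m}. c p \<in> Hs (Suc i) - Hs i} \<le> m * card (cyc m E)"
proof (rule ccontr)
  let ?T = "\<lambda>i. {c \<in> cyc m E. \<exists>p\<in>{0..<int m}. c p \<in> Hs (Suc i) - Hs i}"
  let ?A = "\<lambda>i c. {p\<in>{0..<int m}. c p \<in> Hs i}"
  let ?f = "\<lambda>i. \<Sum>c\<in>cyc m E. card (?A i c)"
  assume no: "\<not> (\<exists>i<M. M * card (?T i) \<le> m * card (cyc m E))"
  have finA: "finite (?A i c)" for i c by (rule finite_subset[of _ "{0..<int m}"]) auto
  have step: "?f i + card (?T i) \<le> ?f (Suc i)" for i
  proof -
    have "card (?T i) = (\<Sum>c\<in>cyc m E. if c \<in> ?T i then 1 else 0)"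
      using fin by (simp add: sum.If_cases Int_def)
    then have "?f i + card (?T i) = (\<Sum>c\<in>cyc m E. card (?A i c) + (if c \<in> ?T i then 1 else 0))"
      by (simp add: sum.distrib)
    also have "\<dots> \<le> ?f (Suc i)"
    proof (rule sum_mono)
      fix c
      have sub: "?A i c \<subseteq> ?A (Suc i) c" using mono by auto
      show "card (?A i c) + (if c \<in> ?T i then 1 else 0) \<le> card (?A (Suc i) c)"
      proof (cases "c \<in> ?T i")
        case True
        then obtain p where "p \<in> {0..<int m}" "c p \<in> Hs (Suc i) - Hs i" by blast
        then have "p \<in> ?A (Suc i) c" "p \<notin> ?A i c" by blast+
        then have "?A i c \<subset> ?A (Suc i) c" using sub by blast
        then have "card (?A i c) < card (?A (Suc i) c)" by (rule psubset_card_mono[OF finA])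
        then show ?thesis unfolding if_P[OF True] by simp
      next
        case False
        show ?thesis unfolding if_not_P[OF False] using card_mono[OF finA sub] by simp
      qed
    qed
    finally show ?thesis .
  qed
  have "(\<Sum>i<j. card (?T i)) \<le> ?f j" for j
  proof (induction j)
    case (Suc j)
    then show ?case using step[of j] by simp
  qed simp
  then have "(\<Sum>i<M. card (?T i)) \<le> ?f M" .
  also have "\<dots> \<le> (\<Sum>c\<in>cyc m E. m)"
  proof (rule sum_mono)
    fix c
    have "card (?A M c) \<le> card {0..<int m}" by (intro card_mono) auto
    then show "card (?A M c) \<le> m" by simp
  qed
  finally have up: "(\<Sum>i<M. card (?T i)) \<le> m * card (cyc m E)" by (simp add: mult.commute)
  have "(\<Sum>i<M. m * card (cyc m E)) < (\<Sum>i<M. M * card (?T i))"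
    using no M by (intro sum_strict_mono) auto
  then have "M * (m * card (cyc m E)) < M * (\<Sum>i<M. card (?T i))" by (simp add: sum_distrib_left)
  then show False using up M by simp
qed

text \<open>Sizes of the stages according to \<open>hitting_set\<close>; they do not depend on the
  number of vertices of the graph.\<close>

primrec hub_bound :: "nat \<Rightarrow> nat \<Rightarrow> nat \<Rightarrow> nat" where
  "hub_bound l h 0 = h"
| "hub_bound l h (Suc i) = hub_bound l h i + l * l * hub_bound l h i ^ 3"

lemma hub_bound_mono: "i \<le> j \<Longrightarrow> hub_bound l h i \<le> hub_bound l h j"
  by (rule lift_Suc_mono_le[of "hub_bound l h"]) auto

lemma frame_intro:
  assumes "graph_on V E" "circ_le l E" "l \<ge> 2" "H \<subseteq> V"
    and "robust V E l H X"
  shows "frame V E l H {x \<in> V - H - X. \<exists>b\<in>H. E x b}"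
proof
  fix b b' p
  assume p: "1 \<le> length p" "length p \<le> l" "b \<in> H" "b' \<in> H"
    and "link E {x \<in> V - H - X. \<exists>b\<in>H. E x b} b p b'"
  then have "link E (V - H - X) b p b'" by (auto simp: link_def)
  then show "abundant V E l H (length p) b b'" using p assms(5) unfolding robust_def by blast
qed (use assms in auto)

text \<open>The degree sum is linear in \<open>card V\<close>, so a threshold proportional to
  \<open>card V\<close> is exceeded by boundedly many vertices only.\<close>

lemma card_high_degree:
  assumes g: "graph_on V E" and l: "circ_le l E" "l \<ge> 2"
  shows "card {v\<in>V. t < card {w. E v w}} * Suc t \<le> 2 * l * card V"
proof -
  have finV: "finite V" using g by (rule graph_on_finite)
  have finN: "finite {w. E v w}" for v
    by (rule finite_subset[OF _ finV]) (use graph_onD[OF g] in auto)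
  let ?H = "{v\<in>V. t < card {w. E v w}}"
  have "card ?H * Suc t = (\<Sum>v\<in>?H. Suc t)" by simp
  also have "\<dots> \<le> (\<Sum>v\<in>?H. card {w. E v w})" by (intro sum_mono) auto
  also have "\<dots> \<le> (\<Sum>v\<in>V. card {w. E v w})" using finV by (intro sum_mono2) auto
  also have "\<dots> = card (SIGMA v:V. {w. E v w})" using finV finN by (intro card_SigmaI[symmetric]) auto
  also have "(SIGMA v:V. {w. E v w}) = {(x, y). x \<in> V \<and> y \<in> V \<and> E x y}"
    using graph_onD[OF g] by auto
  also have "card \<dots> \<le> 2 * l * card V" by (rule card_edges_circ[OF g l])
  finally show ?thesis .
qed

lemma ranked_exists:
  assumes g: "graph_on V E" and l: "circ_le l E" "l \<ge> 2" and m: "m \<ge> 6"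
  shows "\<exists>r. ranked V E l m r"
proof -
  obtain r :: "'a \<Rightarrow> nat" where "inj_on r V" "\<forall>x\<in>V. card {y\<in>V. E x y \<and> r x < r y} \<le> l"
    using degenerate_rank[OF graph_on_finite[OF g] circ_low_degree[OF g l]] by blast
  then have "ranked V E l m r" using g l m by unfold_locales auto
  then show ?thesis by blast
qed

text \<open>The error terms stand for cycles with fewer than \<open>k\<close> sources, with a source
  in \<open>H\<close>, with a sink of degree at most \<open>t\<close> and, in \<open>B\<close>, for
  those meeting the discarded set of the selected stage; \<open>good_if_fine\<close> handles the
  rest. Vertices of high degree belong to every stage, so the third term does not depend on the
  selection.\<close>

lemma structure_nat:
  fixes V :: "'v set"
  assumes g: "graph_on V E" and l: "circ_le l E" "l \<ge> 2" and m: "m \<ge> 6" and n: "card V \<ge> 1"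
    and M: "M > 0" and h0: "card {v\<in>V. t < card {w. E v w}} \<le> h0"
  defines "k \<equiv> m div 2" and "n \<equiv> card V"
  shows "\<exists>H R B. frame V E l H R \<and> M * B \<le> m * (2 ^ m * (n ^ k * l ^ m)) \<and>
    card (cyc m E) \<le> card (good_cycles E H R m) + (2 ^ m * (n ^ (k - 1) * l ^ m)
      + (2 ^ m * (m * (hub_bound l h0 M * n ^ (k - 1) * l ^ m))
      + (2 ^ m * (m * m * (t * (l + l * l) * n ^ (k - 1) * l ^ m)) + B)))"
    (is "\<exists>H R B. _ \<and> _ \<and> _ \<le> _ + (?b1 + (?b2 + (?b3 + _)))")
proof -
  obtain r where "ranked V E l m r" using ranked_exists[OF g l m] by blast
  then interpret ranked V E l m r .
  define H0 where "H0 = {v\<in>V. t < card {w. E v w}}"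
  have "\<exists>X. H \<subseteq> V \<longrightarrow> X \<subseteq> V - H \<and> card X \<le> l * l * card H ^ 3 \<and>
    robust V E l H X" for H
    using hitting_set[OF finV, of H l E] by blast
  then obtain X where X: "\<And>H. H \<subseteq> V \<Longrightarrow> X H \<subseteq> V - H \<and> card (X H) \<le> l * l * card H ^ 3 \<and>
    robust V E l H (X H)" by metis
  define Hs where "Hs = rec_nat H0 (\<lambda>_ H. H \<union> X H)"
  have Hs0: "Hs 0 = H0" and HsS: "Hs (Suc i) = Hs i \<union> X (Hs i)" for i by (simp_all add: Hs_def)
  have HsV: "Hs i \<subseteq> V" for i
  proof (induction i)
    case (Suc i)
    then show ?case using X[of "Hs i"] by (auto simp: HsS)
  qed (auto simp: Hs0 H0_def)
  have cH: "card (Hs i) \<le> hub_bound l h0 i" for i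
  proof (induction i)
    case (Suc i)
    have "card (Hs (Suc i)) \<le> card (Hs i) + card (X (Hs i))" unfolding HsS by (rule card_Un_le)
    also have "\<dots> \<le> card (Hs i) + l * l * card (Hs i) ^ 3" using X[OF HsV] by simp
    also have "\<dots> \<le> hub_bound l h0 i + l * l * hub_bound l h0 i ^ 3"
      using Suc by (intro add_mono mult_le_mono power_mono) auto
    finally show ?case by simp
  qed (use h0 in \<open>simp add: Hs0 H0_def\<close>)
  have mono: "Hs i \<subseteq> Hs (Suc i)" for i by (auto simp: HsS)
  have H0Hs: "H0 \<subseteq> Hs i" for i
    by (induction i) (use mono in \<open>auto simp: Hs0\<close>)
  have fin: "finite (cyc m E)" by (rule finite_cyc[OF graph m_pos])
  obtain i where i: "i < M"
    "M * card {c \<in> cyc m E. \<exists>p\<in>{0..<int m}. c p \<in> Hs (Suc i) - Hs i} \<le> m * card (cyc m E)"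
    using touch_pigeonhole[where Hs = Hs, OF fin mono M] by blast
  define H where "H = Hs i"
  define R where "R = {x \<in> V - H - X H. \<exists>b\<in>H. E x b}"
  have HV: "H \<subseteq> V" by (simp add: H_def HsV)
  have XH: "X H = Hs (Suc i) - Hs i" using X[OF HV] by (auto simp: HsS H_def)
  have fr: "frame V E l H R"
    unfolding R_def by (rule frame_intro[OF g l HV]) (use X[OF HV] in blast)
  let ?B1 = "{c \<in> cyc m E. card (src (dir c)) \<le> k - 1}"
    and ?B2 = "{c \<in> cyc m E. card (src (dir c)) = k \<and> (\<exists>a\<in>src (dir c). c a \<in> H)}"
    and ?B3 = "{c \<in> cyc m E. card (src (dir c)) = k \<and> (\<exists>i. sink c i \<and> c i \<notin> H0)}"
    and ?B4 = "{c \<in> cyc m E. \<exists>p\<in>{0..<int m}. c p \<in> Hs (Suc i) - Hs i}"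
  let ?G = "good_cycles E H R m"
  have k2: "m div 2 = (k - 2) + 2" using m by (simp add: k_def)
  have "cyc m E \<subseteq> ?G \<union> (?B1 \<union> (?B2 \<union> (?B3 \<union> ?B4)))"
  proof
    fix c assume c: "c \<in> cyc m E"
    show "c \<in> ?G \<union> (?B1 \<union> (?B2 \<union> (?B3 \<union> ?B4)))"
    proof (cases "c \<in> ?B1 \<union> (?B2 \<union> (?B3 \<union> ?B4))")
      case False
      then have no: "c \<notin> ?B1" "c \<notin> ?B2" "c \<notin> ?B3" "c \<notin> ?B4" by blast+
      have full: "card (src (dir c)) = m div 2"
        using no(1) c card_src_le[OF c] by (auto simp: k_def)
      have "c j \<in> H" if "sink c j" for j
        using no(3) c full that H0Hs[of i] by (auto simp: k_def H_def)
      moreover have "c j \<notin> H" if s: "source c j" for j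
      proof -
        have "j mod int m \<in> src (dir c)" using mod_in_src[OF c] s by blast
        then have "c (j mod int m) \<notin> H" using no(2) c full by (auto simp: k_def)
        then show ?thesis using cyc_mod[OF c] by simp
      qed
      moreover have "c j \<notin> X H" for j
      proof -
        have "c (j mod int m) \<notin> X H" using no(4) c m_pos unfolding XH by auto
        then show ?thesis using cyc_mod[OF c] by simp
      qed
      ultimately have "c \<in> ?G" using good_if_fine[OF c full _ _ _ R_def] by blast
      then show ?thesis by blast
    qed blast
  qed
  moreover have "finite (?G \<union> (?B1 \<union> (?B2 \<union> (?B3 \<union> ?B4))))"
    using fin by (intro finite_UnI) (auto simp: good_cycles_def)
  ultimately have "card (cyc m E) \<le> card (?G \<union> (?B1 \<union> (?B2 \<union> (?B3 \<union> ?B4))))" by (rule card_mono[rotated])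
  also have "\<dots> \<le> card ?G + (card ?B1 + (card ?B2 + (card ?B3 + card ?B4)))"
    by (meson card_Un_le add_left_mono le_trans)
  also have "\<dots> \<le> card ?G + (?b1 + (?b2 + (?b3 + card ?B4)))"
  proof (intro add_mono order_refl)
    show "card ?B1 \<le> ?b1"
      unfolding n_def by (rule card_cyc_few_sources[OF n])
    have "card ?B2 \<le> 2 ^ m * (m * (card H * n ^ (k - 1) * l ^ m))"
      unfolding n_def by (rule card_source_in[OF HV])
    also have "card H \<le> hub_bound l h0 M"
      using cH[of i] hub_bound_mono[of i M l h0] i(1) by (simp add: H_def)
    then have "2 ^ m * (m * (card H * n ^ (k - 1) * l ^ m)) \<le> ?b2"
      by (intro mult_le_mono order_refl)
    finally show "card ?B2 \<le> ?b2" .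
    have "k - 2 + 1 = k - 1" using m by (simp add: k_def)
    moreover have "card {w. E v w} \<le> t" if "v \<in> V - H0" for v using that by (auto simp: H0_def)
    ultimately show "card ?B3 \<le> ?b3"
      using card_sink_outside[OF _ k2, of H0 t] by (simp add: n_def k_def)
  qed
  finally have "card (cyc m E) \<le> card ?G + (?b1 + (?b2 + (?b3 + card ?B4)))" .
  moreover have "M * card ?B4 \<le> m * (2 ^ m * (n ^ k * l ^ m))"
    using i(2) card_cyc_le[OF n] by (simp add: n_def k_def) (meson le_trans mult_le_mono2)
  ultimately show ?thesis using fr by blast
qed

section \<open>From explicit estimates to asymptotic ones\<close>

text \<open>Each of the four error terms receives a quarter of \<open>\<delta>\<close>. The degree
  threshold \<open>\<epsilon> * n\<close> bounds the initial number of hubs by \<open>h0\<close>,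
  and \<open>M\<close> limits the loss at the selected stage; only then can \<open>N0\<close> be
  taken large in terms of the final hub bound \<open>hM\<close>.\<close>

lemma frame_structure:
  assumes l: "l \<ge> 2" and m: "m \<ge> 6" and \<delta>: "\<delta> > 0"
  shows "\<exists>N0. \<forall>(V :: 'v set) E. graph_on V E \<longrightarrow> circ_le l E \<longrightarrow> card V \<ge> N0 \<longrightarrow>
    (\<exists>H R. frame V E l H R \<and>
      real (card (cyc m E)) \<le> real (card (good_cycles E H R m)) + \<delta> * real (card V) ^ (m div 2))"
proof -
  define k where "k = m div 2"
  define C where "C = real (2 ^ m * l ^ m)"
  define Q where "Q = real (m * m * (l + l * l))"
  have C: "C > 0" using l by (simp add: C_def)
  have "m * m * (l + l * l) > 0" using l m by simp
  then have Q: "Q > 0" unfolding Q_def of_nat_0_less_iff .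
  \<comment> \<open>With this choice \<open>C * Q * \<epsilon> = \<delta> / 4\<close>, the share of
    the low-degree sinks.\<close>
  define \<epsilon> where "\<epsilon> = \<delta> / (4 * C * Q)"
  have \<epsilon>: "\<epsilon> > 0" using C Q \<delta> by (simp add: \<epsilon>_def)
  define h0 where "h0 = nat \<lceil>2 * real l / \<epsilon>\<rceil>"
  define M where "M = Suc (nat \<lceil>4 * real m * C / \<delta>\<rceil>)"
  define hM where "hM = hub_bound l h0 M"
  define N0 where "N0 = Suc (nat \<lceil>4 * C / \<delta>\<rceil> + nat \<lceil>4 * C * real m * real hM / \<delta>\<rceil>)"
  have "\<exists>H R. frame V E l H R \<and>
      real (card (cyc m E)) \<le> real (card (good_cycles E H R m)) + \<delta> * real (card V) ^ k"
    if g: "graph_on V E" and circ: "circ_le l E" and N: "card V \<ge> N0" for V :: "'v set" and E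
  proof -
    define n where "n = card V"
    have n1: "n \<ge> 1" using N by (simp add: n_def N0_def)
    define t where "t = nat \<lfloor>\<epsilon> * real n\<rfloor>"
    have t: "real t \<le> \<epsilon> * real n" "\<epsilon> * real n \<le> real (Suc t)"
      using \<epsilon> by (auto simp: t_def) (linarith)
    let ?H = "{v\<in>V. t < card {w. E v w}}"
    have "real (card ?H) * (\<epsilon> * real n) \<le> real (card ?H) * real (Suc t)"
      using t(2) by (intro mult_left_mono) auto
    also have "\<dots> = real (card ?H * Suc t)" by (simp only: of_nat_mult)
    also have "\<dots> \<le> real (2 * l * n)"
      using card_high_degree[OF g circ l, of t] unfolding n_def of_nat_le_iff .
    finally have "real (card ?H) * \<epsilon> \<le> 2 * real l" using n1 by simp
    then have "real (card ?H) \<le> 2 * real l / \<epsilon>" using \<epsilon> by (simp add: field_simps)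
    then have h0: "card ?H \<le> h0" unfolding h0_def by linarith
    have nV: "card V \<ge> 1" using n1 by (simp add: n_def)
    have M0: "M > 0" by (simp add: M_def)
    obtain H R B where fr: "frame V E l H R" and B: "M * B \<le> m * (2 ^ m * (n ^ k * l ^ m))"
      and le: "card (cyc m E) \<le> card (good_cycles E H R m) + (2 ^ m * (n ^ (k - 1) * l ^ m)
      + (2 ^ m * (m * (hM * n ^ (k - 1) * l ^ m))
      + (2 ^ m * (m * m * (t * (l + l * l) * n ^ (k - 1) * l ^ m)) + B)))"
      using structure_nat[OF g circ l m nV M0 h0] unfolding n_def k_def hM_def by blast
    have "k > 0" using m by (simp add: k_def)
    then have nk: "real n ^ k = real n * real n ^ (k - 1)" by (simp add: power_eq_if)
    have b1: "real (2 ^ m * (n ^ (k - 1) * l ^ m)) \<le> \<delta> / 4 * real n ^ k"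
    proof -
      have "4 * C / \<delta> \<le> real N0" unfolding N0_def by linarith
      then have "4 * C / \<delta> \<le> real n" using N by (simp add: n_def)
      then have "C \<le> \<delta> / 4 * real n" using \<delta> by (simp add: field_simps)
      then have "C * real n ^ (k - 1) \<le> \<delta> / 4 * real n * real n ^ (k - 1)" by (intro mult_right_mono) auto
      then show ?thesis by (simp add: nk C_def mult.assoc mult.left_commute mult.commute)
    qed
    have b2: "real (2 ^ m * (m * (hM * n ^ (k - 1) * l ^ m))) \<le> \<delta> / 4 * real n ^ k"
    proof -
      have "4 * C * real m * real hM / \<delta> \<le> real N0" unfolding N0_def by linarith
      then have "4 * C * real m * real hM / \<delta> \<le> real n" using N by (simp add: n_def)
      then have "C * real m * real hM \<le> \<delta> / 4 * real n" using \<delta> by (simp add: field_simps)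
      then have "C * real m * real hM * real n ^ (k - 1) \<le> \<delta> / 4 * real n * real n ^ (k - 1)"
        by (intro mult_right_mono) auto
      then show ?thesis by (simp add: nk C_def mult.assoc mult.left_commute mult.commute)
    qed
    have b3: "real (2 ^ m * (m * m * (t * (l + l * l) * n ^ (k - 1) * l ^ m))) \<le> \<delta> / 4 * real n ^ k"
    proof -
      have "real (2 ^ m * (m * m * (t * (l + l * l) * n ^ (k - 1) * l ^ m)))
          = C * Q * real n ^ (k - 1) * real t"
        by (simp add: C_def Q_def algebra_simps)
      also have "\<dots> \<le> C * Q * real n ^ (k - 1) * (\<epsilon> * real n)"
        using t(1) C Q by (intro mult_left_mono) auto
      also have "\<dots> = \<delta> / 4 * real n ^ k" using C Q by (simp add: nk \<epsilon>_def)
      finally show ?thesis .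
    qed
    have b4: "real B \<le> \<delta> / 4 * real n ^ k"
    proof -
      have "real (M * B) \<le> real (m * (2 ^ m * (n ^ k * l ^ m)))" using B unfolding of_nat_le_iff .
      then have MB: "real M * real B \<le> real m * C * real n ^ k" by (simp add: C_def algebra_simps)
      have "4 * real m * C / \<delta> \<le> real M" unfolding M_def by linarith
      then have "real m * C \<le> real M * (\<delta> / 4)" using \<delta> by (simp add: field_simps)
      then have "real m * C * real n ^ k \<le> real M * (\<delta> / 4) * real n ^ k" by (intro mult_right_mono) auto
      with MB have "real M * real B \<le> real M * (\<delta> / 4 * real n ^ k)" by (simp add: mult.assoc)
      then show ?thesis using M0 by simp
    qed
    have "real (card (cyc m E)) \<le> real (card (good_cycles E H R m) + (2 ^ m * (n ^ (k - 1) * l ^ m)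
      + (2 ^ m * (m * (hM * n ^ (k - 1) * l ^ m))
      + (2 ^ m * (m * m * (t * (l + l * l) * n ^ (k - 1) * l ^ m)) + B))))"
      using le unfolding of_nat_le_iff .
    also have "\<dots> \<le> real (card (good_cycles E H R m)) + \<delta> * real n ^ k"
      using b1 b2 b3 b4 unfolding of_nat_add by linarith
    finally show ?thesis using fr unfolding n_def by blast
  qed
  then show ?thesis unfolding k_def by blast
qed

lemma exc_le:
  assumes l: "l \<ge> 2" and m: "m \<ge> 6" and n: "n \<ge> 1"
  shows "exc l m n \<le> 2 ^ m * l ^ m * n ^ (m div 2)"
proof -
  obtain V :: "nat set" and E where V: "graph_on V E" "card V = n" "circ_le l E" "card (cyc m E) = exc l m n"
    using exc_attained[of m n l] m by auto
  obtain r where "ranked V E l m r" using ranked_exists[OF V(1,3) l m] by blast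
  then interpret ranked V E l m r .
  show ?thesis using card_cyc_le n V by (simp add: algebra_simps)
qed

definition hub_approx :: "nat \<Rightarrow> nat \<Rightarrow> real \<Rightarrow> nat \<Rightarrow> bool" where
  "hub_approx l m \<delta> n \<longleftrightarrow> (\<exists>(V :: nat set) E H R. frame V E l H R \<and> card V = n \<and>
    real (exc l m n) \<le> real (card (good_cycles E H R m)) + \<delta> * real n ^ (m div 2))"

lemma exc_structure:
  assumes l: "l \<ge> 2" and m: "m \<ge> 6" and \<delta>: "\<delta> > 0"
  shows "\<exists>N0. \<forall>n\<ge>N0. hub_approx l m \<delta> n"
proof -
  obtain N0 where N0: "\<forall>(V :: nat set) E. graph_on V E \<longrightarrow> circ_le l E \<longrightarrow> card V \<ge> N0 \<longrightarrow>
    (\<exists>H R. frame V E l H R \<and>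
      real (card (cyc m E)) \<le> real (card (good_cycles E H R m)) + \<delta> * real (card V) ^ (m div 2))"
    using frame_structure[OF assms] by blast
  have "hub_approx l m \<delta> n" if "n \<ge> N0" for n
  proof -
    obtain V :: "nat set" and E where V: "graph_on V E" "card V = n" "circ_le l E" "card (cyc m E) = exc l m n"
      using exc_attained[of m n l] m by auto
    have "card V \<ge> N0" using V that by simp
    then obtain H R where "frame V E l H R"
      "real (card (cyc m E)) \<le> real (card (good_cycles E H R m)) + \<delta> * real (card V) ^ (m div 2)"
      using N0[rule_format, OF V(1,3)] by blast
    then show ?thesis using V unfolding hub_approx_def by metis
  qed
  then show ?thesis by blast
qed

text \<open>Gluing \<open>q\<close> copies onto a frame of an extremal graph uses at most
  \<open>q * n\<close> vertices. The threshold \<open>N0\<close> is uniform in \<open>q\<close>,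
  since the limit argument lets \<open>q\<close> grow while \<open>n\<close> stays fixed.\<close>

lemma exc_scale:
  assumes l: "l \<ge> 2" and m: "m \<ge> 6" and \<delta>: "\<delta> > 0"
  shows "\<exists>N0. \<forall>n\<ge>N0. \<forall>q\<ge>1.
    real q ^ (m div 2) * (real (exc l m n) - \<delta> * real n ^ (m div 2)) \<le> real (exc l m (q * n))"
proof -
  obtain N0 where N0: "\<forall>n\<ge>N0. hub_approx l m \<delta> n"
    using exc_structure[OF assms] by blast
  have "real q ^ (m div 2) * (real (exc l m n) - \<delta> * real n ^ (m div 2)) \<le> real (exc l m (q * n))"
    if n: "n \<ge> N0" and q: "q \<ge> 1" for n q
  proof -
    obtain V :: "nat set" and E H R where fr: "frame V E l H R" and V: "card V = n"
      and le: "real (exc l m n) \<le> real (card (good_cycles E H R m)) + \<delta> * real n ^ (m div 2)"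
      using N0 n unfolding hub_approx_def by blast
    interpret frame V E l H R by (rule fr)
    have "card H + card R \<le> n"
    proof -
      have "card (H \<union> R) = card H + card R" using finH finR RV by (intro card_Un_disjoint) auto
      moreover have "card (H \<union> R) \<le> card V" using HV RV finV by (intro card_mono) auto
      ultimately show ?thesis using V by simp
    qed
    then have "q * (card H + card R) \<le> q * n" by (rule mult_le_mono2)
    moreover have "card H \<le> q * card H" using mult_le_mono1[OF q, of "card H"] by simp
    ultimately have "card (glueV q) \<le> q * n"
      using card_glueV[of q] unfolding distrib_left by linarith
    then have "card (cyc m (glueE q)) \<le> exc l m (q * n)"
      using exc_ge[OF glue_graph glue_circ] m by simp
    then have "q ^ (m div 2) * card (good_cycles E H R m) \<le> exc l m (q * n)"
      using glue_count[of m q] m q by linarith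
    then have "real (q ^ (m div 2) * card (good_cycles E H R m)) \<le> real (exc l m (q * n))"
      unfolding of_nat_le_iff .
    moreover have "real q ^ (m div 2) * (real (exc l m n) - \<delta> * real n ^ (m div 2))
        \<le> real q ^ (m div 2) * real (card (good_cycles E H R m))"
      using le by (intro mult_left_mono) auto
    ultimately show ?thesis by simp
  qed
  then show ?thesis by blast
qed

subsection \<open>Existence of the inner limit\<close>

text \<open>By scaling, the ratio at a multiple of a large \<open>N\<close> is at least about the
  ratio at \<open>N\<close>, and monotonicity fills in the other arguments. The sequence thus cannot
  end up noticeably below any of its late values, so a convergent subsequence determines its
  limit.\<close>

lemma scaled_limit_exists:
  fixes a :: "nat \<Rightarrow> real"
  assumes a0: "\<And>n. 0 \<le> a n" and mono: "\<And>n n'. n \<le> n' \<Longrightarrow> a n \<le> a n'"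
    and bd: "\<And>n. n \<ge> 1 \<Longrightarrow> a n \<le> C * real n ^ k"
    and scale: "\<And>\<delta>. \<delta> > 0 \<Longrightarrow> \<exists>N0. \<forall>n\<ge>N0. \<forall>q\<ge>1. real q ^ k * (a n - \<delta> * real n ^ k) \<le> a (q * n)"
  shows "\<exists>L. (\<lambda>n. a n / real n ^ k) \<longlonglongrightarrow> L"
proof -
  define x where "x n = a n / real n ^ k" for n
  have x0: "0 \<le> x n" for n using a0 by (simp add: x_def)
  have xC: "x n \<le> \<bar>C\<bar> + x 0" for n
  proof (cases "n = 0")
    case False
    then have "x n \<le> C" using bd[of n] by (simp add: x_def divide_le_eq)
    then show ?thesis using x0[of 0] by simp
  qed simp
  have low: "\<exists>N0. \<forall>N\<ge>N0. \<forall>\<^sub>F n in sequentially. x N - 2 * \<delta> < x n" if \<delta>: "\<delta> > 0" for \<delta>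
  proof -
    obtain N0 where N0: "\<forall>n\<ge>N0. \<forall>q\<ge>1. real q ^ k * (a n - \<delta> * real n ^ k) \<le> a (q * n)"
      using scale[OF \<delta>] by blast
    have "\<forall>\<^sub>F n in sequentially. x N - 2 * \<delta> < x n" if N: "N \<ge> Suc N0" for N
    \<comment> \<open>If \<open>x N\<close> is small, nonnegativity suffices; otherwise
      \<open>x N - \<delta>\<close> is positive and can multiply inequalities.\<close>
    proof (cases "x N \<le> \<delta>")
      case True
      then have "x N - 2 * \<delta> < x n" for n using x0[of n] \<delta> by linarith
      then show ?thesis by simp
    next
      case False
      have "(\<lambda>n. real N / real n) \<longlonglongrightarrow> 0" by (rule lim_const_over_n)
      \<comment> \<open>The factor \<open>(1 - real N / real n) ^ k\<close> is the loss from
        rounding \<open>n\<close> down to a multiple of \<open>N\<close>.\<close>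
      then have "(\<lambda>n. (1 - real N / real n) ^ k * (x N - \<delta>)) \<longlonglongrightarrow> (1 - 0) ^ k * (x N - \<delta>)"
        by (intro tendsto_intros)
      then have "\<forall>\<^sub>F n in sequentially. x N - 2 * \<delta> < (1 - real N / real n) ^ k * (x N - \<delta>)"
        by (rule order_tendstoD(1)) (use \<delta> in simp)
      moreover have "\<forall>\<^sub>F n in sequentially. n \<ge> N" by (rule eventually_ge_at_top)
      ultimately show ?thesis
      proof eventually_elim
        case (elim n)
        define q where "q = n div N"
        have N1: "N \<ge> 1" "n \<ge> 1" using N elim by auto
        have q1: "q \<ge> 1" using elim N1 by (simp add: q_def Suc_le_eq div_greater_zero_iff)
        have "n = q * N + n mod N" "n mod N < N" using N1 by (simp_all add: q_def)
        then have qN: "q * N \<le> n" "n < q * N + N" by linarith+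
        have "real n - real N \<le> real (q * N)" using qN by linarith
        then have "(real n - real N) / real n \<le> real (q * N) / real n"
          by (intro divide_right_mono) auto
        then have "1 - real N / real n \<le> real (q * N) / real n"
          using N1 by (simp add: diff_divide_distrib)
        moreover have "0 \<le> 1 - real N / real n" using elim N1 by (simp add: field_simps)
        ultimately have "(1 - real N / real n) ^ k \<le> (real (q * N) / real n) ^ k" by (intro power_mono)
        then have "(1 - real N / real n) ^ k * (x N - \<delta>) \<le> (real (q * N) / real n) ^ k * (x N - \<delta>)"
          using False by (intro mult_right_mono) auto
        also have "\<dots> = real q ^ k * (a N - \<delta> * real N ^ k) / real n ^ k"
          using N1 by (simp add: x_def power_divide power_mult_distrib field_simps)
        also have "\<dots> \<le> a (q * N) / real n ^ k"
          using N0 N q1 by (intro divide_right_mono) auto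
        also have "\<dots> \<le> x n" unfolding x_def using mono[OF qN(1)] by (intro divide_right_mono) auto
        finally show ?case using elim by linarith
      qed
    qed
    then show ?thesis by blast
  qed
  obtain \<phi> :: "nat \<Rightarrow> nat" where \<phi>: "strict_mono \<phi>" "monoseq (\<lambda>n. x (\<phi> n))"
    using seq_monosub by blast
  have "Bseq (\<lambda>n. x (\<phi> n))"
    using x0 xC by (intro BseqI'[of _ "\<bar>C\<bar> + x 0"]) simp
  then have "convergent (\<lambda>n. x (\<phi> n))" using \<phi>(2) by (rule Bseq_monoseq_convergent)
  then obtain L where L: "(\<lambda>n. x (\<phi> n)) \<longlonglongrightarrow> L" by (auto simp: convergent_def)
  have \<phi>_top: "filterlim \<phi> at_top sequentially" using \<phi>(1) by (rule filterlim_subseq)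
  have "x \<longlonglongrightarrow> L"
  proof (rule order_tendstoI)
    fix y assume y: "y < L"
    define \<delta> where "\<delta> = (L - y) / 3"
    have \<delta>: "\<delta> > 0" using y by (simp add: \<delta>_def)
    obtain N0 where N0: "\<forall>N\<ge>N0. \<forall>\<^sub>F n in sequentially. x N - 2 * \<delta> < x n" using low[OF \<delta>] by blast
    have "\<forall>\<^sub>F i in sequentially. L - \<delta> < x (\<phi> i)" using L \<delta> by (intro order_tendstoD(1)[OF L]) simp
    moreover have "\<forall>\<^sub>F i in sequentially. \<phi> i \<ge> N0" using \<phi>_top by (simp add: filterlim_at_top)
    ultimately have "\<forall>\<^sub>F i in sequentially. L - \<delta> < x (\<phi> i) \<and> \<phi> i \<ge> N0" by (rule eventually_conj)
    from eventually_happens'[OF sequentially_bot this]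
    obtain i where "L - \<delta> < x (\<phi> i)" "\<phi> i \<ge> N0" by blast
    then have "\<forall>\<^sub>F n in sequentially. x (\<phi> i) - 2 * \<delta> < x n" using N0 by blast
    then show "\<forall>\<^sub>F n in sequentially. y < x n"
      by eventually_elim (use \<open>L - \<delta> < x (\<phi> i)\<close> in \<open>simp add: \<delta>_def field_simps\<close>)
  next
    fix y assume y: "L < y"
    define \<delta> where "\<delta> = (y - L) / 3"
    have \<delta>: "\<delta> > 0" using y by (simp add: \<delta>_def)
    obtain N0 where N0: "\<forall>N\<ge>N0. \<forall>\<^sub>F n in sequentially. x N - 2 * \<delta> < x n" using low[OF \<delta>] by blast
    \<comment> \<open>A late value of at least \<open>y = L + 3 * \<delta>\<close> would keep the
      subsequence above \<open>L + \<delta>\<close>.\<close>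
    have "x N < y" if N: "N \<ge> N0" for N
    proof (rule ccontr)
      assume "\<not> x N < y"
      moreover have "\<forall>\<^sub>F n in sequentially. x N - 2 * \<delta> < x n" using N0 N by blast
      then have "\<forall>\<^sub>F i in sequentially. x N - 2 * \<delta> < x (\<phi> i)"
        using \<phi>_top by (rule eventually_compose_filterlim)
      moreover have "\<forall>\<^sub>F i in sequentially. x (\<phi> i) < L + \<delta>"
        using \<delta> by (intro order_tendstoD(2)[OF L]) simp
      ultimately have "\<forall>\<^sub>F i in sequentially. x N - 2 * \<delta> < x (\<phi> i) \<and> x (\<phi> i) < L + \<delta>"
        by (intro eventually_conj)
      from eventually_happens'[OF sequentially_bot this]
    obtain i where "x N - 2 * \<delta> < x (\<phi> i)" "x (\<phi> i) < L + \<delta>"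
        by blast
      then show False using \<open>\<not> x N < y\<close> by (simp add: \<delta>_def field_simps)
    qed
    then show "\<forall>\<^sub>F n in sequentially. x n < y" using eventually_sequentially by blast
  qed
  then show ?thesis unfolding x_def by blast
qed

lemma exc_limit_exists:
  assumes l: "l \<ge> 2" and m: "m \<ge> 6"
  shows "\<exists>L. (\<lambda>n. real (exc l m n) / real n ^ (m div 2)) \<longlonglongrightarrow> L"
proof (rule scaled_limit_exists)
  show "real (exc l m n) \<le> real (2 ^ m * l ^ m) * real n ^ (m div 2)" if "n \<ge> 1" for n
    using exc_le[OF l m that] by (metis of_nat_le_iff of_nat_mult of_nat_power)
  show "real (exc l m n) \<le> real (exc l m n')" if "n \<le> n'" for n n'
    using exc_mono[OF that] m by simp
qed (use exc_scale[OF l m] in auto)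

subsection \<open>The extremal construction\<close>

definition hub_graph :: "nat \<Rightarrow> nat \<Rightarrow> nat \<Rightarrow> nat \<Rightarrow> bool" where
  "hub_graph s n x y \<longleftrightarrow> x \<noteq> y \<and> x < n \<and> y < n \<and> (x < s \<or> y < s)"

lemma graph_on_hub_graph: "graph_on {..<n} (hub_graph s n)"
  by (auto simp: graph_on_def hub_graph_def)

text \<open>Vertices outside the clique are never consecutive, so they fill at most half of a cycle;
  the rest are among the \<open>s\<close> clique vertices.\<close>

lemma circ_hub_graph:
  assumes "2 * s \<le> l"
  shows "circ_le l (hub_graph s n)"
  unfolding circ_le_iff_cyc
proof (intro allI impI, rule ccontr)
  fix j assume j: "j \<ge> 3" "j > l" and "cyc j (hub_graph s n) \<noteq> {}"
  then obtain c where c: "c \<in> cyc j (hub_graph s n)" by blast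
  let ?f = "\<lambda>i. s \<le> c i"
  have "2 * card {i\<in>{0..<int j}. ?f i} \<le> j"
  proof (rule sparse_card)
    show "\<forall>i. (s \<le> c (i + int j)) = (s \<le> c i)" using c by (simp add: cyc_def)
    have "c i < s \<or> c (i + 1) < s" for i using cyc_adj[OF c, of i] by (simp add: hub_graph_def)
    then show "\<forall>i. \<not> (s \<le> c i \<and> s \<le> c (i + 1))" by (meson not_le)
  qed
  moreover have "card {i\<in>{0..<int j}. \<not> ?f i} \<le> s"
  proof -
    have "inj_on c {i\<in>{0..<int j}. \<not> ?f i}"
      using c by (auto simp: cyc_def intro: inj_on_subset)
    moreover have "c ` {i\<in>{0..<int j}. \<not> ?f i} \<subseteq> {..<s}" by auto
    ultimately show ?thesis by (metis card_inj_on_le card_lessThan finite_lessThan)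
  qed
  moreover have "card {i\<in>{0..<int j}. ?f i} + card {i\<in>{0..<int j}. \<not> ?f i} = j"
  proof -
    have "{i\<in>{0..<int j}. ?f i} \<union> {i\<in>{0..<int j}. \<not> ?f i} = {0..<int j}" by auto
    moreover have "card ({i\<in>{0..<int j}. ?f i} \<union> {i\<in>{0..<int j}. \<not> ?f i})
        = card {i\<in>{0..<int j}. ?f i} + card {i\<in>{0..<int j}. \<not> ?f i}"
      by (rule card_Un_disjoint) (auto intro: finite_subset[of _ "{0..<int j}"])
    ultimately show ?thesis by simp
  qed
  ultimately show False using assms j by linarith
qed

definition distinct_lists :: "nat \<Rightarrow> 'a set \<Rightarrow> 'a list set" where
  "distinct_lists j A = {xs. length xs = j \<and> distinct xs \<and> set xs \<subseteq> A}"

text \<open>Each factor of the falling factorial is at least \<open>card A - j\<close>; if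
  \<open>A\<close> is too small, truncated subtraction makes the left side zero.\<close>

lemma card_distinct_lists_ge:
  assumes "finite A"
  shows "(card A - j) ^ j \<le> card (distinct_lists j A)"
proof (cases "j \<le> card A")
  case True
  have "(card A - j) ^ j = (\<Prod>i\<in>{card A - j + 1..card A}. card A - j)" using True by simp
  also have "\<dots> \<le> \<Prod>{card A - j + 1..card A}" by (rule prod_mono) auto
  also have "\<dots> = card (distinct_lists j A)"
    unfolding distinct_lists_def using card_lists_distinct_length_eq[OF assms True] by simp
  finally show ?thesis .
next
  case False
  then have "j > 0" "card A - j = 0" by linarith+
  then show ?thesis by (simp add: zero_power)
qed

text \<open>Counted from the start \<open>r\<close>, the list \<open>xs\<close> of independent
  vertices occupies the first \<open>k\<close> even positions and the clique vertices
  \<open>ys\<close> all others. Different starts give different cycles: for even m they exchange the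
  two parity classes, for odd m they move the only place with two consecutive clique
  vertices.\<close>

lemma exc_ge_construction:
  fixes l m n :: nat
  defines "s \<equiv> l div 2" and "k \<equiv> m div 2"
  assumes m: "m \<ge> 3" and n: "n \<ge> s"
  shows "(if even m then 2 else m) * ((n - s - k) ^ k * (s - (m - k)) ^ (m - k)) \<le> exc l m n"
proof -
  define \<rho> where "\<rho> = (if even m then 2 else m)"
  define \<tau> where "\<tau> r i = nat ((i - r) mod int m)" for r i
  define \<Phi> :: "int \<times> nat list \<times> nat list \<Rightarrow> int \<Rightarrow> nat" where "\<Phi> = (\<lambda>(r, xs, ys) i. if even (\<tau> r i) \<and> \<tau> r i < 2 * k
    then xs ! (\<tau> r i div 2) else ys ! (\<tau> r i div 2))"
  let ?X = "distinct_lists k {s..<n}" and ?Y = "distinct_lists (m - k) {..<s}"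
  let ?E = "hub_graph s n"
  have m0: "m > 0" using m by simp
  have \<tau>m: "\<tau> r i < m" for r i using nat_mod_less[OF m0] by (simp add: \<tau>_def)
  have \<tau>eq: "\<tau> r i = \<tau> r j \<longleftrightarrow> i mod int m = j mod int m" for r i j
  proof -
    have "\<tau> r i = \<tau> r j \<longleftrightarrow> (i - r) mod int m = (j - r) mod int m"
      using m0 by (simp add: \<tau>_def eq_nat_nat_iff)
    also have "\<dots> \<longleftrightarrow> i mod int m = j mod int m"
    proof
      assume "(i - r) mod int m = (j - r) mod int m"
      then have "(i - r + r) mod int m = (j - r + r) mod int m" by (metis mod_add_left_eq)
      then show "i mod int m = j mod int m" by simp
    next
      assume "i mod int m = j mod int m"
      then show "(i - r) mod int m = (j - r) mod int m" by (metis mod_diff_left_eq)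
    qed
    finally show ?thesis .
  qed
  have \<tau>S: "\<tau> r (i + 1) = (\<tau> r i + 1) mod m" for r i
  proof -
    have "int (\<tau> r (i + 1)) = (i - r + 1) mod int m" using m0 by (simp add: \<tau>_def algebra_simps)
    also have "\<dots> = ((i - r) mod int m + 1) mod int m" by (simp add: mod_add_left_eq)
    also have "\<dots> = int ((\<tau> r i + 1) mod m)" using m0 by (simp add: \<tau>_def zmod_int add.commute)
    finally show ?thesis by simp
  qed
  \<comment> \<open>Halving enumerates the positions filled from \<open>ys\<close>:
    \<open>2 * j + 1\<close> goes to \<open>j\<close> and, for odd m, the last position
    \<open>2 * k\<close> goes to \<open>k\<close>.\<close>
  have half: "t div 2 < m - k" if "t < m" "\<not> (even t \<and> t < 2 * k)" for t
    using that unfolding k_def by presburger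
  have half_inj: "t div 2 = u div 2 \<Longrightarrow> t = u"
    if "t < m" "u < m" "\<not> (even t \<and> t < 2 * k)" "\<not> (even u \<and> u < 2 * k)" for t u
  proof -
    have "t = 2 * (t div 2) + 1 \<or> t = 2 * (t div 2) \<and> t + 1 = m"
      if "t < m" "\<not> (even t \<and> t < 2 * k)" for t
      using that unfolding k_def by presburger
    from this[OF that(1,3)] this[OF that(2,4)] show "t div 2 = u div 2 \<Longrightarrow> t = u"
      using that(1,2) by linarith
  qed
  have val: "s \<le> \<Phi> (r, xs, ys) i \<and> \<Phi> (r, xs, ys) i < n \<and> \<Phi> (r, xs, ys) i = xs ! (\<tau> r i div 2)"
    if "xs \<in> ?X" "even (\<tau> r i) \<and> \<tau> r i < 2 * k" for r xs ys i
  proof -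
    have "\<tau> r i div 2 < length xs" using that by (auto simp: distinct_lists_def)
    then have "xs ! (\<tau> r i div 2) \<in> {s..<n}" using that(1) nth_mem by (force simp: distinct_lists_def)
    then show ?thesis using that(2) by (simp add: \<Phi>_def)
  qed
  have val': "\<Phi> (r, xs, ys) i < s \<and> \<Phi> (r, xs, ys) i = ys ! (\<tau> r i div 2)"
    if "ys \<in> ?Y" "\<not> (even (\<tau> r i) \<and> \<tau> r i < 2 * k)" for r xs ys i
  proof -
    have "\<tau> r i div 2 < length ys" using half[OF \<tau>m that(2)] that(1) by (simp add: distinct_lists_def)
    then have "ys ! (\<tau> r i div 2) \<in> {..<s}" using that(1) nth_mem by (force simp: distinct_lists_def)
    then show ?thesis using that(2) by (auto simp: \<Phi>_def)
  qed
  have \<Phi>_inj: "i mod int m = j mod int m"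
    if z: "xs \<in> ?X" "ys \<in> ?Y" and eq: "\<Phi> (r, xs, ys) i = \<Phi> (r, xs, ys) j" for r xs ys i j
  proof -
    let ?p = "\<lambda>i. even (\<tau> r i) \<and> \<tau> r i < 2 * k"
    have d: "distinct xs" "length xs = k" "distinct ys" "length ys = m - k"
      using z by (auto simp: distinct_lists_def)
    have "?p i = ?p j" using val[OF z(1)] val'[OF z(2)] eq by (metis not_le)
    moreover have "\<tau> r i = \<tau> r j" if p: "?p i" "?p j"
    proof -
      have "xs ! (\<tau> r i div 2) = xs ! (\<tau> r j div 2)" using val[OF z(1)] p eq by metis
      then have "\<tau> r i div 2 = \<tau> r j div 2" using d p by (auto simp: nth_eq_iff_index_eq)
      then show ?thesis using p by (metis dvd_div_mult_self)
    qed
    moreover have "\<tau> r i = \<tau> r j" if p: "\<not> ?p i" "\<not> ?p j"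
    proof -
      have "ys ! (\<tau> r i div 2) = ys ! (\<tau> r j div 2)" using val'[OF z(2)] p eq by metis
      then have "\<tau> r i div 2 = \<tau> r j div 2"
        using d half[OF \<tau>m p(1)] half[OF \<tau>m p(2)] by (auto simp: nth_eq_iff_index_eq)
      then show ?thesis using half_inj[OF \<tau>m \<tau>m p] by blast
    qed
    ultimately show ?thesis using \<tau>eq by blast
  qed
  have in_cyc: "\<Phi> (r, xs, ys) \<in> cyc m ?E" if z: "xs \<in> ?X" "ys \<in> ?Y" for r xs ys
  proof -
    have "\<Phi> (r, xs, ys) (i + int m) = \<Phi> (r, xs, ys) i" for i
      using \<tau>eq[of r "i + int m" i] by (simp add: \<Phi>_def)
    moreover have "inj_on (\<Phi> (r, xs, ys)) {0..<int m}"
      using \<Phi>_inj[OF z] by (intro inj_onI) fastforce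
    moreover have "?E (\<Phi> (r, xs, ys) i) (\<Phi> (r, xs, ys) (i + 1))" for i
    proof -
      have "\<Phi> (r, xs, ys) i \<noteq> \<Phi> (r, xs, ys) (i + 1)"
      proof
        assume "\<Phi> (r, xs, ys) i = \<Phi> (r, xs, ys) (i + 1)"
        then have "i mod int m = (i + 1) mod int m" by (rule \<Phi>_inj[OF z])
        then have "(i - i) mod int m = (i + 1 - i) mod int m" by (metis mod_diff_left_eq)
        then show False using m by simp
      qed
      moreover have "\<Phi> (r, xs, ys) j < n" for j using val[OF z(1)] val'[OF z(2)] n by (meson less_le_trans)
      moreover have "\<Phi> (r, xs, ys) i < s \<or> \<Phi> (r, xs, ys) (i + 1) < s"
      proof (cases "even (\<tau> r i) \<and> \<tau> r i < 2 * k")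
        case True
        then have "\<tau> r i + 1 < m" unfolding k_def by presburger
        then have "odd (\<tau> r (i + 1))" using True by (simp add: \<tau>S)
        then show ?thesis using val'[OF z(2)] by blast
      next
        case False
        then show ?thesis using val'[OF z(2)] by blast
      qed
      ultimately show ?thesis by (simp add: hub_graph_def)
    qed
    ultimately show ?thesis by (simp add: cyc_def)
  qed
  have "inj_on \<Phi> ({0..<int \<rho>} \<times> ?X \<times> ?Y)"
  proof (rule inj_onI)
    fix z z' assume "z \<in> {0..<int \<rho>} \<times> ?X \<times> ?Y" "z' \<in> {0..<int \<rho>} \<times> ?X \<times> ?Y" "\<Phi> z = \<Phi> z'"
    then obtain r xs ys r' xs' ys' where zz: "z = (r, xs, ys)" "z' = (r', xs', ys')"
      and r: "r \<in> {0..<int \<rho>}" "r' \<in> {0..<int \<rho>}"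
      and z: "xs \<in> ?X" "ys \<in> ?Y" "xs' \<in> ?X" "ys' \<in> ?Y" and eq: "\<Phi> (r, xs, ys) = \<Phi> (r', xs', ys')"
      by (cases z; cases z') auto
    have k0: "k > 0" using m by (simp add: k_def)
    have same: "(even (\<tau> r i) \<and> \<tau> r i < 2 * k) \<longleftrightarrow> (even (\<tau> r' i) \<and> \<tau> r' i < 2 * k)" for i
      using val[OF z(1)] val'[OF z(2)] val[OF z(3)] val'[OF z(4)] fun_cong[OF eq, of i] by (metis not_le)
    \<comment> \<open>Both starts carry independent vertices, so the distance between them is even
      in either direction round the cycle. Then m is even, and the only possible starts are 0 and
      1.\<close>
    have rr: "r = r'"
    proof (rule ccontr)
      assume ne: "r \<noteq> r'"
      have rm: "\<bar>r - r'\<bar> < int m" using r m by (auto simp: \<rho>_def split: if_splits)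
      have "\<tau> r r = 0" "\<tau> r' r' = 0" by (simp_all add: \<tau>_def)
      then have ev: "even (\<tau> r r')" "even (\<tau> r' r)" using same[of r'] same[of r] k0 by auto
      have e: "even ((r' - r) mod int m)" "even ((r - r') mod int m)"
        using ev m0 by (auto simp: \<tau>_def even_nat_iff)
      obtain a b where ab: "{a, b} = {r, r'}" "b - a \<in> {1..<int m}"
      proof (cases "r < r'")
        case True
        then show ?thesis using that[of r r'] rm by auto
      next
        case False
        then show ?thesis using that[of r' r] rm ne by auto
      qed
      have m1: "(b - a) mod int m = b - a" using ab by simp
      have "(a - b + int m) mod int m = a - b + int m"
        by (rule mod_pos_pos_trivial) (use ab(2) in auto)
      then have m2: "(a - b) mod int m = int m - (b - a)" by simp
      have "even (b - a)" "even (int m - (b - a))" using e ab(1) m1 m2 by (auto simp: doubleton_eq_iff)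
      then have "even m" by presburger
      then have "b - a = 1" using ab r by (auto simp: \<rho>_def doubleton_eq_iff)
      then show False using \<open>even (b - a)\<close> by simp
    qed
    have \<tau>at: "\<tau> r (r + int t) = t" if "t < m" for t using that by (simp add: \<tau>_def)
    have "xs = xs'"
    proof (rule nth_equalityI)
      show "length xs = length xs'" using z by (simp add: distinct_lists_def)
      fix i assume "i < length xs"
      then have i: "2 * i < 2 * k" "2 * i < m" using z by (auto simp: distinct_lists_def k_def)
      then have "\<tau> r (r + int (2 * i)) = 2 * i" using \<tau>at by blast
      then show "xs ! i = xs' ! i"
        using val[OF z(1), of r "r + int (2 * i)" ys] val[OF z(3), of r "r + int (2 * i)" ys']
          fun_cong[OF eq, of "r + int (2 * i)"] rr i by simp
    qed
    moreover have "ys = ys'"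
    proof (rule nth_equalityI)
      show "length ys = length ys'" using z by (simp add: distinct_lists_def)
      fix i assume "i < length ys"
      then have i: "i < m - k" using z by (auto simp: distinct_lists_def)
      \<comment> \<open>The inverse of halving on the positions filled from
        \<open>ys\<close>.\<close>
      define t where "t = (if i < k then 2 * i + 1 else 2 * k)"
      have t: "t < m" "t div 2 = i" "\<not> (even t \<and> t < 2 * k)"
        using i unfolding t_def k_def by (auto; presburger)+
      then have "\<tau> r (r + int t) = t" using \<tau>at by blast
      then show "ys ! i = ys' ! i"
        using val'[OF z(2), of r "r + int t" xs] val'[OF z(4), of r "r + int t" xs']
          fun_cong[OF eq, of "r + int t"] rr t by simp
    qed
    ultimately show "z = z'" using rr zz by simp
  qed
  moreover have "\<Phi> ` ({0..<int \<rho>} \<times> ?X \<times> ?Y) \<subseteq> cyc m ?E" using in_cyc by auto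
  moreover have "finite (cyc m ?E)" using finite_cyc[OF graph_on_hub_graph m0] .
  ultimately have "card ({0..<int \<rho>} \<times> ?X \<times> ?Y) \<le> card (cyc m ?E)" by (rule card_inj_on_le)
  also have "\<dots> \<le> exc l m n"
    using exc_ge[OF graph_on_hub_graph circ_hub_graph _ m, of s l n n] by (simp add: s_def)
  finally have "\<rho> * (card ?X * card ?Y) \<le> exc l m n" by (simp add: card_cartesian_product)
  moreover have "(n - s - k) ^ k * (s - (m - k)) ^ (m - k) \<le> card ?X * card ?Y"
    using card_distinct_lists_ge[of "{s..<n}" k] card_distinct_lists_ge[of "{..<s}" "m - k"]
    by (intro mult_le_mono) auto
  then have "\<rho> * ((n - s - k) ^ k * (s - (m - k)) ^ (m - k)) \<le> \<rho> * (card ?X * card ?Y)"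
    by (rule mult_le_mono2)
  ultimately show ?thesis unfolding \<rho>_def by linarith
qed

subsection \<open>The value of the double limit\<close>

text \<open>As \<open>l \<le> 3 * s\<close>, the error terms of \<open>card_canonical_odd\<close>
  relative to the main term are at most \<open>24 * g / s\<close>, \<open>3 / g\<close> and
  \<open>2 / s\<close>. The parameter \<open>g\<close> is left free so that it can be fixed
  according to the desired precision before \<open>l\<close> grows.\<close>

lemma exc_eventually_le:
  assumes l: "l \<ge> 2" and m: "m \<ge> 6" and g: "g \<ge> 1" and \<delta>: "\<delta> > 0"
  defines "s \<equiv> real (l div 2)" and "\<rho> \<equiv> real (if even m then 2 else m)"
  shows "\<forall>\<^sub>F n in sequentially. real (exc l m n) / real n ^ (m div 2)
    \<le> \<rho> * (s ^ (m - m div 2) * (1 + 24 * real g / s + 3 / real g + 2 / s)) + \<delta>"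
proof -
  define k where "k = m div 2"
  have s1: "s \<ge> 1" using l by (simp add: s_def)
  have "l \<le> 3 * (l div 2)" using l by presburger
  then have ls: "real l \<le> 3 * s" unfolding s_def by linarith
  obtain N0 where N0: "\<forall>n\<ge>N0. hub_approx l m \<delta> n"
    using exc_structure[OF l m \<delta>] by blast
  let ?U = "s ^ (m - k) * (1 + 24 * real g / s + 3 / real g + 2 / s)"
  have "real (exc l m n) / real n ^ k \<le> \<rho> * ?U + \<delta>" if n: "n \<ge> Suc N0" for n
  proof -
    obtain V :: "nat set" and E H R where fr: "frame V E l H R" and V: "card V = n"
      and le: "real (exc l m n) \<le> real (card (good_cycles E H R m)) + \<delta> * real n ^ k"
      using N0 n unfolding k_def hub_approx_def by (meson Suc_leD)
    interpret frame V E l H R by (rule fr)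
    have can: "real (card (canonical m)) \<le> real n ^ k * ?U"
    proof (cases "even m")
      case True
      then have mk: "m = 2 * k" "k \<ge> 1" using m by (auto simp: k_def)
      have "real (card (canonical m)) \<le> real ((n * (l div 2)) ^ k)"
        using card_canonical_even[OF mk] V unfolding of_nat_le_iff by simp
      also have "\<dots> = real n ^ k * (s ^ (m - k) * 1)" using mk by (simp add: s_def power_mult_distrib)
      also have "\<dots> \<le> real n ^ k * ?U" using s1 g by (intro mult_left_mono) auto
      finally show ?thesis .
    next
      case False
      define j where "j = k - 2"
      have mj: "m = 2 * j + 5" "k = j + 2" using m False unfolding j_def k_def by presburger+
      have ld: "real (l div (2 * g)) \<le> 3 * s / (2 * real g)"
      proof -
        have "real (l div (2 * g)) \<le> real l / real (2 * g)" by (rule of_nat_div_le_of_nat)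
        also have "\<dots> \<le> 3 * s / real (2 * g)" using ls by (intro divide_right_mono) auto
        finally show ?thesis by simp
      qed
      have "real (card (canonical m)) \<le> real (n ^ (j + 2) * ((l div 2) ^ (j + 3)
        + 8 * l * g * (l div 2) ^ (j + 1) + 2 * (l div (2 * g) + 1) * (l div 2) ^ (j + 2)))"
        using card_canonical_odd[OF mj(1) g] V unfolding of_nat_le_iff by simp
      also have "\<dots> = real n ^ k * (s ^ (j + 3) + 8 * real l * real g * s ^ (j + 1)
        + 2 * (real (l div (2 * g)) + 1) * s ^ (j + 2))"
        by (simp add: mj(2) s_def algebra_simps)
      also have "\<dots> \<le> real n ^ k * (s ^ (j + 3) + 8 * (3 * s) * real g * s ^ (j + 1)
        + 2 * (3 * s / (2 * real g) + 1) * s ^ (j + 2))"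
        using ls ld s1 by (intro mult_left_mono add_mono mult_right_mono order_refl) auto
      also have "\<dots> = real n ^ k * (s ^ (j + 3) * (1 + 24 * real g / s + 3 / real g + 2 / s))"
        using s1 g by (simp add: field_simps power_add power2_eq_square power3_eq_cube)
      also have "j + 3 = m - k" using mj by simp
      finally show ?thesis .
    qed
    have "real (card (good_cycles E H R m)) \<le> real ((if even m then 2 else m) * card (canonical m))"
      using card_good_le[of m] m unfolding of_nat_le_iff by simp
    also have "\<dots> = \<rho> * real (card (canonical m))" by (simp add: \<rho>_def)
    also have "\<dots> \<le> \<rho> * (real n ^ k * ?U)" using can by (intro mult_left_mono) (auto simp: \<rho>_def)
    finally have "real (exc l m n) \<le> (\<rho> * ?U + \<delta>) * real n ^ k" using le by (simp add: algebra_simps)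
    then show ?thesis using n by (simp add: divide_le_eq)
  qed
  then show ?thesis unfolding k_def eventually_sequentially by blast
qed

text \<open>For the upper bound, \<open>\<delta>\<close> is arbitrary. For the lower bound, the
  number of hubs is fixed while n grows, so the finitely many vertices excluded from the free
  choices do not matter in the limit.\<close>

lemma exc_limit_bounds:
  assumes l: "l \<ge> 2" and m: "m \<ge> 6"
    and L: "(\<lambda>n. real (exc l m n) / real n ^ (m div 2)) \<longlonglongrightarrow> L"
  defines "s \<equiv> real (l div 2)" and "\<rho> \<equiv> real (if even m then 2 else m)"
  shows "g \<ge> 1 \<Longrightarrow> L \<le> \<rho> * (s ^ (m - m div 2) * (1 + 24 * real g / s + 3 / real g + 2 / s))"
    and "l div 2 \<ge> m \<Longrightarrow> \<rho> * (s - real (m - m div 2)) ^ (m - m div 2) \<le> L"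
proof -
  assume g: "g \<ge> 1"
  show "L \<le> \<rho> * (s ^ (m - m div 2) * (1 + 24 * real g / s + 3 / real g + 2 / s))"
  proof (rule field_le_epsilon)
    fix \<delta> :: real assume "\<delta> > 0"
    from exc_eventually_le[OF l m g this]
    show "L \<le> \<rho> * (s ^ (m - m div 2) * (1 + 24 * real g / s + 3 / real g + 2 / s)) + \<delta>"
      unfolding s_def \<rho>_def by (intro tendsto_upperbound[OF L]) auto
  qed
next
  assume lm: "l div 2 \<ge> m"
  define k where "k = m div 2"
  let ?c = "real (l div 2 + k)"
  have "(\<lambda>n. (1 - ?c / real n) ^ k * (\<rho> * (s - real (m - k)) ^ (m - k)))
      \<longlonglongrightarrow> (1 - 0) ^ k * (\<rho> * (s - real (m - k)) ^ (m - k))"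
    by (intro tendsto_intros lim_const_over_n)
  then have lim: "(\<lambda>n. (1 - ?c / real n) ^ k * (\<rho> * (s - real (m - k)) ^ (m - k)))
      \<longlonglongrightarrow> \<rho> * (s - real (m - k)) ^ (m - k)" by simp
  have "(1 - ?c / real n) ^ k * (\<rho> * (s - real (m - k)) ^ (m - k)) \<le> real (exc l m n) / real n ^ k"
    if n: "n \<ge> l div 2 + k + 1" for n
  proof -
    have "\<rho> * (real (n - l div 2 - k) ^ k * real (l div 2 - (m - k)) ^ (m - k)) =
        real ((if even m then 2 else m) * ((n - l div 2 - k) ^ k * (l div 2 - (m - k)) ^ (m - k)))"
      by (simp add: \<rho>_def)
    also have "\<dots> \<le> real (exc l m n)"
      using exc_ge_construction[of m l n] m n unfolding of_nat_le_iff k_def by simp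
    finally have "\<rho> * (real (n - l div 2 - k) ^ k * real (l div 2 - (m - k)) ^ (m - k)) \<le> real (exc l m n)" .
    moreover have "real (n - l div 2 - k) = real n * (1 - ?c / real n)"
      using n by (simp add: of_nat_diff field_simps)
    moreover have "real (l div 2 - (m - k)) = s - real (m - k)" using lm by (simp add: s_def)
    ultimately have "\<rho> * ((real n * (1 - ?c / real n)) ^ k * (s - real (m - k)) ^ (m - k)) \<le> real (exc l m n)"
      by metis
    then show ?thesis using n by (simp add: le_divide_eq power_mult_distrib mult_ac)
  qed
  then have "\<forall>\<^sub>F n in sequentially.
      (1 - ?c / real n) ^ k * (\<rho> * (s - real (m - k)) ^ (m - k)) \<le> real (exc l m n) / real n ^ k"
    unfolding eventually_sequentially by blast
  from tendsto_le[OF sequentially_bot L[folded k_def] lim this]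
  show "\<rho> * (s - real (m - m div 2)) ^ (m - m div 2) \<le> L" by (simp add: k_def)
qed

lemma filterlim_half: "filterlim (\<lambda>l. real (l div 2)) at_top sequentially"
proof (rule filterlim_compose[OF filterlim_real_sequentially])
  have "\<forall>l\<ge>2 * Z. Z \<le> l div 2" for Z :: nat by auto
  then show "filterlim (\<lambda>l :: nat. l div 2) at_top sequentially"
    unfolding filterlim_at_top eventually_sequentially by blast
qed

lemma gen_turan_double_limit:
  assumes m: "m \<ge> 6"
  defines "\<rho> \<equiv> real (if even m then 2 else m)"
  shows "\<exists>L :: nat \<Rightarrow> real. (\<forall>l\<ge>2. (\<lambda>n. real (gen_turan n (cycle_graph m) (cycles_ge (l + 1)))
      / (real (l div 2) ^ (m - m div 2) * real n ^ (m div 2))) \<longlonglongrightarrow> L l)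
    \<and> L \<longlonglongrightarrow> \<rho> / (2 * real m)"
proof -
  define k where "k = m div 2"
  define e where "e = m - k"
  define c where "c = \<rho> / (2 * real m)"
  have c: "c > 0" using m by (simp add: c_def \<rho>_def)
  have "\<forall>l\<in>{2..}. \<exists>L. (\<lambda>n. real (exc l m n) / real n ^ k) \<longlonglongrightarrow> L"
    using exc_limit_exists[OF _ m] by (simp add: k_def)
  then obtain K where K: "\<And>l. l \<ge> 2 \<Longrightarrow> (\<lambda>n. real (exc l m n) / real n ^ k) \<longlonglongrightarrow> K l"
    by (metis atLeast_iff)
  \<comment> \<open>Dividing by \<open>2 * m\<close> returns from labelled cycles to copies.\<close>
  define L where "L l = K l / (2 * real m * real (l div 2) ^ e)" for l
  have "(\<lambda>n. real (gen_turan n (cycle_graph m) (cycles_ge (l + 1))) / (real (l div 2) ^ e * real n ^ k)) \<longlonglongrightarrow> L l"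
    if l: "l \<ge> 2" for l
  proof -
    have "real (gen_turan n (cycle_graph m) (cycles_ge (l + 1))) / (real (l div 2) ^ e * real n ^ k)
        = real (exc l m n) / real n ^ k / (2 * real m * real (l div 2) ^ e)" for n
      using m by (simp add: exc_def field_simps)
    moreover have "(\<lambda>n. real (exc l m n) / real n ^ k / (2 * real m * real (l div 2) ^ e)) \<longlonglongrightarrow> L l"
      unfolding L_def by (rule tendsto_divide[OF K[OF l] tendsto_const]) (use l m in auto)
    ultimately show ?thesis by (simp only:)
  qed
  moreover have "L \<longlonglongrightarrow> c"
  proof (rule order_tendstoI)
    fix y assume y: "y < c"
    have "((\<lambda>s :: real. c * (1 - real e / s) ^ e) \<longlongrightarrow> c * (1 - 0) ^ e) at_top"
      by (intro tendsto_intros real_tendsto_divide_at_top[OF tendsto_const filterlim_ident])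
    then have "(\<lambda>l. c * (1 - real e / real (l div 2)) ^ e) \<longlonglongrightarrow> c"
      using filterlim_compose[OF _ filterlim_half] by fastforce
    then have "\<forall>\<^sub>F l in sequentially. y < c * (1 - real e / real (l div 2)) ^ e"
      using y by (rule order_tendstoD(1))
    moreover have "\<forall>\<^sub>F l in sequentially. l \<ge> 2 * m" by (rule eventually_ge_at_top)
    ultimately show "\<forall>\<^sub>F l in sequentially. y < L l"
    proof eventually_elim
      case (elim l)
      then have l: "l \<ge> 2" "l div 2 \<ge> m" using m by auto
      let ?s = "real (l div 2)"
      have s: "?s > 0" using l m by simp
      have "\<rho> * (?s - real e) ^ e \<le> K l"
        using exc_limit_bounds(2)[OF l(1) m _ l(2)] K[OF l(1)] unfolding \<rho>_def k_def e_def by blast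
      then have "\<rho> * (?s - real e) ^ e / (2 * real m * ?s ^ e) \<le> L l"
        unfolding L_def by (rule divide_right_mono) simp
      moreover have "?s - real e = ?s * (1 - real e / ?s)" using s by (simp add: field_simps)
      then have "\<rho> * (?s - real e) ^ e / (2 * real m * ?s ^ e) = c * (1 - real e / ?s) ^ e"
        using s by (simp add: c_def power_mult_distrib)
      ultimately show ?case using elim by linarith
    qed
  next
    fix y assume y: "c < y"
    have "(\<lambda>g. c * (1 + 3 / real g)) \<longlonglongrightarrow> c * (1 + 0)"
      by (intro tendsto_intros lim_const_over_n)
    then have "\<forall>\<^sub>F g in sequentially. c * (1 + 3 / real g) < y" using y by (intro order_tendstoD(2)) auto
    then have "\<forall>\<^sub>F g in sequentially. c * (1 + 3 / real g) < y \<and> g \<ge> 1"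
      using eventually_ge_at_top by (rule eventually_conj)
    from eventually_happens'[OF sequentially_bot this]
    \<comment> \<open>\<open>g\<close> makes \<open>3 / g\<close> harmless first; for this fixed
      \<open>g\<close> the term \<open>24 * g / s\<close> vanishes as \<open>l\<close>
      grows.\<close>
    obtain g where g: "c * (1 + 3 / real g) < y" "g \<ge> 1"
      by blast
    have "((\<lambda>s :: real. c * (1 + 24 * real g / s + 3 / real g + 2 / s)) \<longlongrightarrow> c * (1 + 0 + 3 / real g + 0)) at_top"
      by (intro tendsto_intros real_tendsto_divide_at_top[OF tendsto_const filterlim_ident])
    then have "(\<lambda>l. c * (1 + 24 * real g / real (l div 2) + 3 / real g + 2 / real (l div 2)))
        \<longlonglongrightarrow> c * (1 + 3 / real g)"
      using filterlim_compose[OF _ filterlim_half] by fastforce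
    then have "\<forall>\<^sub>F l in sequentially. c * (1 + 24 * real g / real (l div 2) + 3 / real g + 2 / real (l div 2)) < y"
      using g(1) by (rule order_tendstoD(2))
    moreover have "\<forall>\<^sub>F l in sequentially. l \<ge> (2 :: nat)" by (rule eventually_ge_at_top)
    ultimately show "\<forall>\<^sub>F l in sequentially. L l < y"
    proof eventually_elim
      case (elim l)
      let ?s = "real (l div 2)" and ?U = "1 + 24 * real g / real (l div 2) + 3 / real g + 2 / real (l div 2)"
      have s: "?s > 0" using elim by simp
      have "K l \<le> \<rho> * (?s ^ e * ?U)"
        using exc_limit_bounds(1)[OF elim(2) m _ g(2)] K[OF elim(2)] unfolding \<rho>_def k_def e_def by blast
      then have "L l \<le> \<rho> * (?s ^ e * ?U) / (2 * real m * ?s ^ e)"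
        unfolding L_def by (rule divide_right_mono) simp
      also have "\<dots> = c * ?U" using s by (simp add: c_def)
      finally show ?case using elim by linarith
    qed
  qed
  ultimately show ?thesis unfolding c_def k_def e_def by blast
qed

text \<open>\<open>L\<close> records the inner limits. The range \<open>l \<ge> 2\<close> keeps
  \<open>l div 2\<close> positive and does not affect the outer limit. Both values are
  \<open>\<rho> / (2 * m)\<close>, with \<open>\<rho> = 2\<close> for even m and
  \<open>\<rho> = m\<close> for odd m.\<close>

theorem theorem8:
  fixes k :: nat
  assumes "k \<ge> 3"
  shows "(\<exists>L :: nat \<Rightarrow> real.
           (\<forall>l\<ge>2. (\<lambda>n. real (gen_turan n (cycle_graph (2 * k)) (cycles_ge (l + 1)))
                        / (real (l div 2) ^ k * real n ^ k)) \<longlonglongrightarrow> L l)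
           \<and> L \<longlonglongrightarrow> 1 / (2 * real k))
       \<and> (\<exists>L :: nat \<Rightarrow> real.
           (\<forall>l\<ge>2. (\<lambda>n. real (gen_turan n (cycle_graph (2 * k + 1)) (cycles_ge (l + 1)))
                        / (real (l div 2) ^ (k + 1) * real n ^ k)) \<longlonglongrightarrow> L l)
           \<and> L \<longlonglongrightarrow> 1 / 2)"
proof -
  have even: "2 * k div 2 = k" "2 * k - k = k"
    "real (if even (2 * k) then 2 else 2 * k) / (2 * real (2 * k)) = 1 / (2 * real k)" by auto
  have odd: "(2 * k + 1) div 2 = k" "2 * k + 1 - k = k + 1"
    "real (if even (2 * k + 1) then 2 else 2 * k + 1) / (2 * real (2 * k + 1)) = 1 / 2"
    by (auto simp: field_simps)
  have "6 \<le> 2 * k" "6 \<le> 2 * k + 1" using assms by simp_all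
  from gen_turan_double_limit[OF this(1), unfolded even] gen_turan_double_limit[OF this(2), unfolded odd]
  show ?thesis by (rule conjI)
qed

end
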